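(* Let $N\ge 3$, $2^*=\frac{2N}{N-2}$ and $q\in[1,\infty]$. Then the following hold. (i) The embedding $H^1_{\mathrm{rad}}(\mathbb{R}^N)\cap L^{p,q}(\mathbb{R}^N)\hookrightarrow L^2(\mathbb{R}^N)$ is compact for every $p\in[1,2)$. (ii) The embedding $H^1_{\mathrm{rad}}(\mathbb{R}^N)\cap L^{p,q}(\mathbb{R}^N)\hookrightarrow L^{2^*}(\mathbb{R}^N)$ is compact for every $p$ with $2^*<p<\infty$.
   Context: $H^1_{\mathrm{rad}}(\mathbb{R}^N)$ is the subspace of radial functions in $H^1(\mathbb{R}^N)$. For measurable $u:\mathbb{R}^N\to\mathbb{R}$, the decreasing rearrangement is $u^*(t)=\inf\{\lambda>0: |\{x\in\mathbb{R}^N: |u(x)|>\lambda\}|\le t\}$, $t\ge0$. For $1\le p<\infty$, the Lorentz space $L^{p,q}(\mathbb{R}^N)$ consists of the measurable $u$ with $\|u\|_{p,q}<\infty$, where $\|u\|_{p,q}=\left(\int_0^\infty (s^{1/p}u^*(s))^q\frac{ds}{s}\right)^{1/q}$ if $1\le q<\infty$ and $\|u\|_{p,\infty}=\sup_{s>0}s^{1/p}u^*(s)$. A sequence is bounded in $H^1_{\mathrm{rad}}(\mathbb{R}^N)\cap L^{p,q}(\mathbb{R}^N)$ if both $\|\cdot\|_{H^1}$ and $\|\cdot\|_{p,q}$ are bounded along it; an embedding $X\hookrightarrow Y$ is compact if every bounded sequence in $X$ has a subsequence converging in $Y$. *)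

theory Defs
  imports "HOL-Analysis.Analysis"
begin

text \<open>Elements of the function spaces below are functions rather than classes modulo null sets;
  all norms are invariant under changes on null sets. Norms take values in \<open>[0, \<infinity>]\<close>.\<close>

definition ennpow :: "ennreal \<Rightarrow> real \<Rightarrow> ennreal" where
  "ennpow x a = (if x = \<infinity> then \<infinity> else ennreal (enn2real x powr a))"
  \<comment> \<open>only used for \<open>a > 0\<close>\<close>

definition Lp_norm :: "real \<Rightarrow> ('a::euclidean_space \<Rightarrow> real) \<Rightarrow> ennreal" where
  "Lp_norm r u = ennpow (\<integral>\<^sup>+ x. ennreal (\<bar>u x\<bar> powr r) \<partial>lebesgue) (1 / r)"

definition Lp_space :: "real \<Rightarrow> ('a::euclidean_space \<Rightarrow> real) set" where
  "Lp_space r = {u. u \<in> borel_measurable lebesgue \<and> Lp_norm r u < \<infinity>}"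

definition partial_deriv :: "'a::euclidean_space \<Rightarrow> ('a \<Rightarrow> real) \<Rightarrow> 'a \<Rightarrow> real" where
  "partial_deriv b f x = frechet_derivative f (at x) b"

text \<open>A function is of class \<open>C\<^sup>k\<^sup>+\<^sup>1\<close> iff it is (Frechet) differentiable
  with all first-order partial derivatives of class \<open>C\<^sup>k\<close>.\<close>

fun C_class :: "nat \<Rightarrow> ('a::euclidean_space \<Rightarrow> real) \<Rightarrow> bool" where
  "C_class 0 f \<longleftrightarrow> continuous_on UNIV f"
| "C_class (Suc k) f \<longleftrightarrow>
     (\<forall>x. f differentiable (at x)) \<and> (\<forall>b\<in>Basis. C_class k (partial_deriv b f))"

definition test_function :: "('a::euclidean_space \<Rightarrow> real) \<Rightarrow> bool" where
  "test_function \<phi> \<longleftrightarrow> (\<forall>k. C_class k \<phi>) \<and> compact (closure {x. \<phi> x \<noteq> 0})"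

definition locally_integrable :: "('a::euclidean_space \<Rightarrow> real) \<Rightarrow> bool" where
  "locally_integrable u \<longleftrightarrow> (\<forall>K. compact K \<longrightarrow> set_integrable lebesgue K u)"

definition has_weak_partial :: "'a::euclidean_space \<Rightarrow> ('a \<Rightarrow> real) \<Rightarrow> ('a \<Rightarrow> real) \<Rightarrow> bool" where
  "has_weak_partial b u v \<longleftrightarrow> locally_integrable u \<and> locally_integrable v \<and>
     (\<forall>\<phi>. test_function \<phi> \<longrightarrow>
        (LINT x|lebesgue. u x * partial_deriv b \<phi> x) = - (LINT x|lebesgue. v x * \<phi> x))"

definition H1_space :: "('a::euclidean_space \<Rightarrow> real) set" where
  "H1_space = {u \<in> Lp_space 2. \<forall>b\<in>Basis. \<exists>v\<in>Lp_space 2. has_weak_partial b u v}"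

text \<open>For \<open>u \<in> H1_space\<close> the weak partial derivatives are unique up to null sets,
  so the choice does not affect \<open>H1_norm\<close>.\<close>

definition weak_partial :: "'a::euclidean_space \<Rightarrow> ('a \<Rightarrow> real) \<Rightarrow> 'a \<Rightarrow> real" where
  "weak_partial b u = (SOME v. v \<in> Lp_space 2 \<and> has_weak_partial b u v)"

definition H1_norm :: "('a::euclidean_space \<Rightarrow> real) \<Rightarrow> ennreal" where
  "H1_norm u = ennpow ((Lp_norm 2 u)\<^sup>2 + (\<Sum>b\<in>Basis. (Lp_norm 2 (weak_partial b u))\<^sup>2)) (1 / 2)"

definition radial :: "('a::euclidean_space \<Rightarrow> real) \<Rightarrow> bool" where
  "radial w \<longleftrightarrow> (\<forall>x y. norm x = norm y \<longrightarrow> w x = w y)"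

text \<open>Since elements of \<open>H\<^sup>1\<close> are only determined almost everywhere, radiality means having a
  radial representative.\<close>

definition H1_rad :: "('a::euclidean_space \<Rightarrow> real) set" where
  "H1_rad = {u \<in> H1_space. \<exists>w. radial w \<and> (AE x in lebesgue. u x = w x)}"

text \<open>The infimum is taken in \<open>[0, \<infinity>]\<close>, so that it is \<open>\<infinity>\<close> for the empty set.\<close>

definition rearrangement :: "('a::euclidean_space \<Rightarrow> real) \<Rightarrow> real \<Rightarrow> ennreal" where
  "rearrangement u t =
     Inf {ennreal l | l. l > 0 \<and> emeasure lebesgue {x. \<bar>u x\<bar> > l} \<le> ennreal t}"

definition lorentz_norm :: "real \<Rightarrow> ennreal \<Rightarrow> ('a::euclidean_space \<Rightarrow> real) \<Rightarrow> ennreal" where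
  "lorentz_norm p q u =
     (if q = \<infinity> then (SUP s\<in>{0<..}. ennreal (s powr (1 / p)) * rearrangement u s)
      else ennpow (\<integral>\<^sup>+ s\<in>{0<..}. ennpow (ennreal (s powr (1 / p)) * rearrangement u s) (enn2real q)
                     * ennreal (1 / s) \<partial>lborel) (1 / enn2real q))"

definition lorentz_space :: "real \<Rightarrow> ennreal \<Rightarrow> ('a::euclidean_space \<Rightarrow> real) set" where
  "lorentz_space p q = {u. u \<in> borel_measurable lebesgue \<and> lorentz_norm p q u < \<infinity>}"

text \<open>Compactness of the embedding of \<open>X \<inter> Z\<close> into \<open>Y\<close>, where boundedness in \<open>X \<inter> Z\<close> means
  boundedness with respect to both \<open>nX\<close> and \<open>nZ\<close>.\<close>

definition compact_embedding_Int ::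
  "('a \<Rightarrow> real) set \<Rightarrow> (('a \<Rightarrow> real) \<Rightarrow> ennreal) \<Rightarrow>
   ('a \<Rightarrow> real) set \<Rightarrow> (('a \<Rightarrow> real) \<Rightarrow> ennreal) \<Rightarrow>
   ('a \<Rightarrow> real) set \<Rightarrow> (('a \<Rightarrow> real) \<Rightarrow> ennreal) \<Rightarrow> bool" where
  "compact_embedding_Int X nX Z nZ Y nY \<longleftrightarrow>
     X \<inter> Z \<subseteq> Y \<and>
     (\<forall>u :: nat \<Rightarrow> 'a \<Rightarrow> real.
        (\<forall>k. u k \<in> X \<inter> Z) \<and>
        (\<exists>C::real. \<forall>k. nX (u k) \<le> ennreal C) \<and> (\<exists>C::real. \<forall>k. nZ (u k) \<le> ennreal C) \<longrightarrow>
        (\<exists>\<sigma> v. strict_mono \<sigma> \<and> v \<in> Y \<and> (\<lambda>k. nY (\<lambda>x. u (\<sigma> k) x - v x)) \<longlonglongrightarrow> 0))"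

definition sobolev_exponent :: "nat \<Rightarrow> real" where
  "sobolev_exponent N = 2 * real N / (real N - 2)"

end

theory Submission
  imports Defs "HOL-Library.Diagonal_Subsequence"
begin

text \<open>Put \<open>\<tau> = |x|\<^sup>2\<^sup>-\<^sup>N\<close>, the fundamental solution of the Laplacian up to a constant. For a
  radial \<open>u(x) = G(\<tau>)\<close>, testing the weak gradient with the fields \<open>x |x|\<^sup>-\<^sup>N X(\<tau>)\<close> and using that
  \<open>x |x|\<^sup>-\<^sup>N\<close> is divergence free, Cauchy-Schwarz gives
  \<open>|\<integral> G X' d\<tau>| \<le> C \<parallel>X\<parallel>\<^sub>2\<close> for all test functions \<open>X\<close> on the half line. Hence \<open>G\<close> is Hoelder continuous
  with exponent \<open>1/2\<close> in \<open>\<tau>\<close>, and \<open>u \<in> L\<^sup>2\<close> forces \<open>G(0+) = 0\<close>, so that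
  \<open>|u(x)|\<^sup>2 \<le> C |x|\<^sup>2\<^sup>-\<^sup>N\<close> uniformly along a bounded sequence. By equicontinuity a subsequence
  converges almost everywhere; the differences are uniformly small near infinity.
  For \<open>p < 2\<close> the pointwise bound is locally square integrable, and the weak \<open>L\<^sup>p\<close> bound controls
  the tails. For \<open>p > 2\<^sup>*\<close> the weak \<open>L\<^sup>p\<close> bound excludes concentration at the origin,
  and the \<open>L\<^sup>2\<close> bound controls the tails. No Sobolev inequality is needed.\<close>


section \<open>Functions of class C\<open>\<^sup>k\<close> on open sets\<close>

text \<open>The variable \<tau> is the one in which the Dirichlet integral of a radial function
  becomes flat: it is a constant times the integral of G'(\<tau>)^2. A gradient bound is thus an L^2
  bound for G' on the half line, and the exponent 1/2 is plain Cauchy-Schwarz. The obstacle is that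
  the gradient is only weak and the radial representative is given only up to null sets; so G' is
  never formed, and its bound enters dually, as a bound on the oscillation of averages of G. The
  envelope sqrt(\<tau>) decides what the Lorentz norm must supply. Its square |x|^(2-N) is
  integrable at the origin but not at infinity, so for p < 2 only the tails are missing. Its power
  with the critical exponent is |x|^(-N), which just fails at the origin and at infinity; at
  infinity the smallness of the envelope is combined with the L^2 bound, but concentration at 0 has
  to be excluded separately. For arbitrary q only a weak L^p bound is extracted from the Lorentz
  norm, hence the auxiliary exponent s strictly between p and the target exponent.\<close>

fun C_class_on :: "nat \<Rightarrow> 'a::euclidean_space set \<Rightarrow> ('a \<Rightarrow> real) \<Rightarrow> bool" where
  "C_class_on 0 U f \<longleftrightarrow> continuous_on U f"
| "C_class_on (Suc k) U f \<longleftrightarrow>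
     (\<forall>x\<in>U. f differentiable (at x)) \<and> (\<forall>b\<in>Basis. C_class_on k U (partial_deriv b f))"

lemma C_class_iff_C_class_on: "C_class k f \<longleftrightarrow> C_class_on k UNIV f"
  by (induction k arbitrary: f) auto

lemma C_class_on_cong:
  assumes "open U" "\<And>x. x \<in> U \<Longrightarrow> f x = g x"
  shows "C_class_on k U f \<longleftrightarrow> C_class_on k U g"
  using assms
proof (induction k arbitrary: f g)
  case 0
  then show ?case by (simp cong: continuous_on_cong)
next
  case (Suc k)
  have D: "(f has_derivative D) (at x) \<longleftrightarrow> (g has_derivative D) (at x)" if "x \<in> U" for x D
    by (metis has_derivative_transform_within_open Suc.prems that)
  then have "partial_deriv b f x = partial_deriv b g x" if "x \<in> U" for b x
    using that by (simp add: partial_deriv_def frechet_derivative_def)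
  then have "C_class_on k U (partial_deriv b f) \<longleftrightarrow> C_class_on k U (partial_deriv b g)" for b
    by (intro Suc.IH[OF Suc.prems(1)])
  moreover have "f differentiable (at x) \<longleftrightarrow> g differentiable (at x)" if "x \<in> U" for x
    using D that by (simp add: differentiable_def)
  ultimately show ?case
    by simp
qed

lemma C_class_on_Suc_D: "C_class_on (Suc k) U f \<Longrightarrow> C_class_on k U f"
proof (induction k arbitrary: f)
  case 0
  then show ?case
    by (metis C_class_on.simps differentiable_at_imp_differentiable_on differentiable_imp_continuous_on)
next
  case (Suc k)
  have "C_class_on (Suc k) U (partial_deriv b f)" if "b \<in> Basis" for b
    using Suc.prems that unfolding C_class_on.simps(2)[of "Suc k"] by blast
  then have "C_class_on k U (partial_deriv b f)" if "b \<in> Basis" for b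
    using Suc.IH that by blast
  moreover have "\<forall>x\<in>U. f differentiable (at x)"
    using Suc.prems unfolding C_class_on.simps(2)[of "Suc k"] by blast
  ultimately show ?case by simp
qed

text \<open>The localized class serves this gluing: the radial test fields are given by one formula
  away from the origin and by 0 near it.\<close>

lemma C_class_on_Un:
  assumes "open U" "open V" "C_class_on k U f" "C_class_on k V f"
  shows "C_class_on k (U \<union> V) f"
  using assms
  by (induction k arbitrary: f) (auto simp: continuous_on_open_Un)

lemma partial_deriv_eqI:
  "(f has_derivative D) (at x) \<Longrightarrow> partial_deriv b f x = D b"
  using frechet_derivative_at[of f D x] by (simp add: partial_deriv_def)

lemma C_class_on_SucI:
  assumes "open U"
    and "\<And>x. x \<in> U \<Longrightarrow> (f has_derivative (\<lambda>h. D h x)) (at x)"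
    and "\<And>b. b \<in> Basis \<Longrightarrow> C_class_on k U (D b)"
  shows "C_class_on (Suc k) U f"
proof -
  have "C_class_on k U (partial_deriv b f)" if "b \<in> Basis" for b
    using assms(3)[OF that] C_class_on_cong[OF assms(1), of "partial_deriv b f" "D b" k]
      partial_deriv_eqI[OF assms(2)] by blast
  then show ?thesis
    using assms(2) by (auto simp: differentiable_def)
qed

lemma C_class_on_real_SucI:
  fixes f :: "real \<Rightarrow> real"
  assumes "open U"
    and "\<And>x. x \<in> U \<Longrightarrow> (f has_real_derivative f' x) (at x)"
    and "C_class_on k U f'"
  shows "C_class_on (Suc k) U f"
  by (rule C_class_on_SucI[where D = "\<lambda>h x. f' x * h"])
    (use assms in \<open>auto simp: has_field_derivative_def\<close>)

lemma C_class_on_const: "C_class_on k U (\<lambda>x. c)"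
proof (induction k arbitrary: c)
  case (Suc k)
  have "partial_deriv b (\<lambda>x. c) = (\<lambda>x::'a. 0)" for b
    by (rule ext) (simp add: partial_deriv_def)
  then show ?case using Suc by simp
qed simp

lemma has_derivative_of_C_class_on_Suc:
  assumes "C_class_on (Suc k) U f" "x \<in> U"
  shows "(f has_derivative (\<lambda>h. partial_deriv h f x)) (at x)"
  using assms by (auto simp: partial_deriv_def frechet_derivative_works[symmetric])

lemma C_class_on_add:
  assumes "open U" "C_class_on k U f" "C_class_on k U g"
  shows "C_class_on k U (\<lambda>x. f x + g x)"
  using assms
proof (induction k arbitrary: f g)
  case (Suc k)
  show ?case
    by (rule C_class_on_SucI[where D = "\<lambda>h x. partial_deriv h f x + partial_deriv h g x"])
      (use Suc in \<open>auto intro!: has_derivative_add has_derivative_of_C_class_on_Suc\<close>)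
qed (auto intro: continuous_intros)

lemma C_class_on_mult:
  assumes "open U" "C_class_on k U f" "C_class_on k U g"
  shows "C_class_on k U (\<lambda>x. f x * g x)"
  using assms
proof (induction k arbitrary: f g)
  case (Suc k)
  have "C_class_on k U f" "C_class_on k U g"
    using Suc.prems by (blast intro: C_class_on_Suc_D)+
  with Suc show ?case
    by (intro C_class_on_SucI[where D = "\<lambda>h x. f x * partial_deriv h g x + partial_deriv h f x * g x"])
      (auto intro!: C_class_on_add has_derivative_mult has_derivative_of_C_class_on_Suc)
qed (auto intro: continuous_intros)

text \<open>In the induction \<open>g\<close> is replaced by its derivative while \<open>f\<close>
  stays: a partial derivative of the composition is g' composed with \<open>f\<close>, times a
  partial derivative of \<open>f\<close>, and products are already covered.\<close>

lemma C_class_on_compose: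
  fixes g :: "real \<Rightarrow> real" and f :: "'a::euclidean_space \<Rightarrow> real"
  assumes "open U" "open V" "f ` U \<subseteq> V" "C_class_on k U f" "C_class_on k V g"
  shows "C_class_on k U (\<lambda>x. g (f x))"
  using assms
proof (induction k arbitrary: g)
  case 0
  then show ?case by (auto intro: continuous_on_compose2)
next
  case (Suc k)
  let ?g' = "partial_deriv 1 g"
  have g': "(g has_real_derivative ?g' y) (at y)" if "y \<in> V" for y
  proof -
    have "g differentiable (at y)" using Suc.prems(5) that by simp
    then have "linear (frechet_derivative g (at y))" by (rule linear_frechet_derivative)
    then have "partial_deriv h g y = ?g' y * h" for h
      using linear_scale[of "frechet_derivative g (at y)" h 1] by (simp add: partial_deriv_def)
    then have "(\<lambda>h. partial_deriv h g y) = (*) (?g' y)" by blast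
    with has_derivative_of_C_class_on_Suc[OF Suc.prems(5) that] show ?thesis
      unfolding has_field_derivative_def by metis
  qed
  show ?case
  proof (rule C_class_on_SucI[where D = "\<lambda>h x. ?g' (f x) * partial_deriv h f x"])
    fix x assume x: "x \<in> U"
    have "(f has_derivative (\<lambda>h. partial_deriv h f x)) (at x)"
      using Suc.prems(4) x by (rule has_derivative_of_C_class_on_Suc)
    moreover have "(g has_derivative (*) (?g' (f x))) (at (f x))"
      using g'[of "f x"] x Suc.prems(3) unfolding has_field_derivative_def by blast
    ultimately show "((\<lambda>x. g (f x)) has_derivative (\<lambda>h. ?g' (f x) * partial_deriv h f x)) (at x)"
      by (rule has_derivative_compose)
  next
    fix b :: 'a assume "b \<in> Basis"
    then have "C_class_on k U (partial_deriv b f)"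
      using Suc.prems(4) unfolding C_class_on.simps(2) by blast
    moreover have "C_class_on k V ?g'"
      using Suc.prems(5) unfolding C_class_on.simps(2) Basis_real_def by blast
    then have "C_class_on k U (\<lambda>x. ?g' (f x))"
      using Suc.IH[of ?g'] Suc.prems(1-3) C_class_on_Suc_D[OF Suc.prems(4)] by blast
    ultimately show "C_class_on k U (\<lambda>x. ?g' (f x) * partial_deriv b f x)"
      using Suc.prems(1) by (intro C_class_on_mult)
  qed (rule assms)
qed

lemma C_class_on_linear:
  fixes f :: "'a::euclidean_space \<Rightarrow> real"
  assumes "bounded_linear f"
  shows "C_class_on k UNIV f"
proof (cases k)
  case 0
  then show ?thesis using assms by (simp add: linear_continuous_on)
next
  case (Suc j)
  show ?thesis unfolding Suc
    by (rule C_class_on_SucI[where D = "\<lambda>h x. f h"])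
      (use assms in \<open>auto intro: bounded_linear_imp_has_derivative C_class_on_const\<close>)
qed

lemma C_class_on_inner_self: "C_class_on k UNIV (\<lambda>x. x \<bullet> x)"
proof (cases k)
  case 0
  then show ?thesis by (auto intro: continuous_intros)
next
  case (Suc j)
  show ?thesis unfolding Suc
    by (rule C_class_on_SucI[where D = "\<lambda>h x. 2 * (x \<bullet> h)"])
      (auto intro!: derivative_eq_intros C_class_on_linear simp: inner_commute
        intro: bounded_linear_const_mult bounded_linear_inner_right)
qed

lemma C_class_on_powr: "C_class_on k {0<..} (\<lambda>t::real. t powr s)"
proof (induction k arbitrary: s)
  case 0
  then show ?case by (auto intro!: continuous_intros)
next
  case (Suc k)
  show ?case
    by (rule C_class_on_real_SucI[where f' = "\<lambda>t. s * t powr (s - 1)"])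
      (use Suc in \<open>auto intro!: C_class_on_mult C_class_on_const has_real_derivative_powr\<close>)
qed

section \<open>Flat exponentials, the source of smooth cutoffs\<close>

text \<open>For \<open>m = 0\<close> this is the classical flat function exp(-1/t). The powers in
  the denominator make the family closed under differentiation up to linear combinations, so
  smoothness of all members follows by one induction.\<close>

definition flat_exp :: "nat \<Rightarrow> real \<Rightarrow> real" where
  "flat_exp m t = (if t > 0 then exp (- 1 / t) / t ^ m else 0)"

lemma flat_exp_tendsto_0: "((\<lambda>t. flat_exp m t) \<longlongrightarrow> 0) (at_right 0)"
proof -
  have "((\<lambda>y::real. y ^ m / exp y) \<longlongrightarrow> 0) at_top"
    by (rule tendsto_power_div_exp_0)
  then have "((\<lambda>t::real. inverse t ^ m / exp (inverse t)) \<longlongrightarrow> 0) (at_right 0)"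
    by (rule filterlim_compose) (rule filterlim_inverse_at_top_right)
  moreover have "eventually (\<lambda>t::real. inverse t ^ m / exp (inverse t) = flat_exp m t) (at_right 0)"
    unfolding eventually_at_right_field
    by (intro exI[of _ 1]) (auto simp: flat_exp_def exp_minus field_simps)
  ultimately show ?thesis by (rule Lim_transform_eventually)
qed

lemma flat_exp_has_derivative:
  "(flat_exp m has_real_derivative flat_exp (m + 2) t - real m * flat_exp (m + 1) t) (at t)"
proof -
  consider "t < 0" | "t = 0" | "t > 0" by linarith
  then show ?thesis
  proof cases
    case 1
    have "((\<lambda>t. 0) has_real_derivative 0) (at t)" by simp
    then have "(flat_exp m has_real_derivative 0) (at t)"
      by (rule has_field_derivative_transform_within_open[where S = "{..<0}"])
        (use 1 in \<open>auto simp: flat_exp_def\<close>)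
    then show ?thesis using 1 by (simp add: flat_exp_def)
  next
    case 3
    have "((\<lambda>t. exp (- 1 / t) / t ^ m) has_real_derivative
        flat_exp (m + 2) t - real m * flat_exp (m + 1) t) (at t)"
      using 3 by (auto intro!: derivative_eq_intros simp: flat_exp_def)
        (cases m; simp add: field_simps power2_eq_square)
    then show ?thesis
      by (rule has_field_derivative_transform_within_open[where S = "{0<..}"])
        (use 3 in \<open>auto simp: flat_exp_def\<close>)
  next
    case 2
    \<comment> \<open>For \<open>h > 0\<close> the difference quotient at 0 is again a member of the
      family, \<open>flat_exp (Suc m) h\<close>, and tends to 0.\<close>
    have "((\<lambda>h. flat_exp m h / h) \<longlongrightarrow> 0) (at_right 0)"
      using flat_exp_tendsto_0[of "Suc m"]
      by (rule Lim_transform_eventually) (auto simp: eventually_at_right_field flat_exp_def intro!: exI[of _ 1])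
    moreover have "((\<lambda>h. flat_exp m h / h) \<longlongrightarrow> 0) (at_left 0)"
      by (rule Lim_transform_eventually[of "\<lambda>_. 0"])
        (auto simp: eventually_at_left_field flat_exp_def intro!: exI[of _ "-1"])
    ultimately have "((\<lambda>h. flat_exp m h / h) \<longlongrightarrow> 0) (at 0)"
      by (simp add: filterlim_split_at)
    then show ?thesis using 2 by (simp add: has_field_derivative_iff flat_exp_def)
  qed
qed

lemma C_class_on_flat: "C_class_on k UNIV (flat_exp m)"
proof (induction k arbitrary: m)
  case 0
  then show ?case
    by (auto intro!: continuous_at_imp_continuous_on DERIV_isCont[OF flat_exp_has_derivative])
next
  case (Suc k)
  have "C_class_on k UNIV (\<lambda>t. flat_exp (m + 2) t + (- real m) * flat_exp (m + 1) t)"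
    by (rule C_class_on_add[OF open_UNIV Suc C_class_on_mult[OF open_UNIV C_class_on_const Suc]])
  then show ?case
    by (rule C_class_on_real_SucI[OF open_UNIV, rotated]) (use flat_exp_has_derivative[of m] in simp)
qed


section \<open>Radial test fields\<close>

lemma C_class_on_affine: "C_class_on k UNIV (\<lambda>s::real. p * s + q)"
  by (intro C_class_on_add C_class_on_linear C_class_on_const open_UNIV bounded_linear_mult_right)

text \<open>The slope is prescribed rather than the step: as \<open>c\<close> grows,
  \<open>f\<close> tends to \<open>1 / h\<close> on the open interval from \<open>a\<close> to
  \<open>a + h\<close>, so \<open>F\<close> approaches a linear ramp. The bound \<open>1 / h\<close>
  on the slope keeps the total rise at most 1. The rise may stay below 1; what is used later is that
  \<open>F\<close> is constant from \<open>a + h\<close> on, so that a translate cancels it.\<close>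

lemma smooth_step_exists:
  fixes a h c :: real
  assumes h: "h > 0" and c: "c > 0"
  defines "f \<equiv> (\<lambda>s. 1 / h * (flat_exp 0 (c * (s - a)) * flat_exp 0 (c * (a + h - s))))"
  obtains F where "\<And>k. C_class_on k UNIV F" "\<And>s. (F has_real_derivative f s) (at s)"
    "\<And>s. 0 \<le> F s \<and> F s \<le> 1" "\<And>s. s \<le> a \<Longrightarrow> F s = 0" "\<And>s. a + h \<le> s \<Longrightarrow> F s = F (a + h)"
proof -
  have fC: "C_class_on k UNIV f" for k
  proof -
    have "C_class_on k UNIV (\<lambda>s. flat_exp 0 (c * (s - a)))"
      by (rule C_class_on_compose[OF open_UNIV open_UNIV _ _ C_class_on_flat]) (use C_class_on_affine[of k c "- c * a"] in \<open>auto simp: algebra_simps\<close>)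
    moreover have "C_class_on k UNIV (\<lambda>s. flat_exp 0 (c * (a + h - s)))"
      by (rule C_class_on_compose[OF open_UNIV open_UNIV _ _ C_class_on_flat]) (use C_class_on_affine[of k "- c" "c * (a + h)"] in \<open>auto simp: algebra_simps\<close>)
    ultimately show ?thesis
      unfolding f_def by (intro C_class_on_mult C_class_on_const open_UNIV)
  qed
  then have "continuous_on UNIV f"
    by (metis C_class_on.simps(1))
  then obtain G where G: "\<And>s. (G has_vector_derivative f s) (at s)"
    using einterval_antiderivative[of "-\<infinity>" "\<infinity>" f]
    by (auto simp: continuous_on_eq_continuous_at)
  define F where "F s = G s - G a" for s
  have F: "(F has_real_derivative f s) (at s)" for s
    using G[of s] unfolding F_def has_real_derivative_iff_has_vector_derivative[symmetric]
    by (auto intro!: derivative_eq_intros)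
  have flat01: "0 \<le> flat_exp 0 t" "flat_exp 0 t \<le> 1" for t
    by (auto simp: flat_exp_def)
  have f_nonneg: "0 \<le> f s" for s
    using h by (auto simp: f_def flat01)
  have f_le: "f s \<le> 1 / h" for s
    using h mult_le_one[OF flat01(2) flat01(1) flat01(2)]
    by (auto simp: f_def intro!: divide_right_mono)
  have f0: "f s = 0" if "s < a \<or> s > a + h" for s
  proof -
    have "c * (s - a) \<le> 0 \<or> c * (a + h - s) \<le> 0"
      using that c by (auto simp: mult_le_0_iff)
    then show ?thesis by (auto simp: f_def flat_exp_def)
  qed
  have Fa: "F a = 0" by (simp add: F_def)
  have low: "F s = 0" if "s \<le> a" for s
  proof (cases "s < a")
    case True
    then obtain z where "s < z" "z < a" "F a - F s = (a - s) * f z"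
      using MVT2[of s a F f] F by blast
    then show ?thesis using f0 Fa by simp
  qed (use that Fa in auto)
  have up: "F s = F (a + h)" if "a + h \<le> s" for s
  proof (cases "a + h < s")
    case True
    then obtain z where "a + h < z" "z < s" "F s - F (a + h) = (s - (a + h)) * f z"
      using MVT2[of "a + h" s F f] F by blast
    then show ?thesis using f0 by simp
  qed (use that in auto)
  have mono: "F s \<le> F t" if "s \<le> t" for s t
    using that DERIV_nonneg_imp_nondecreasing[of s t F] F f_nonneg by blast
  have "F (a + h) \<le> 1"
  proof -
    obtain z where "F (a + h) - F a = (a + h - a) * f z"
      using MVT2[of a "a + h" F f] F h by auto
    then show ?thesis using Fa f_le[of z] h by (simp add: field_simps)
  qed
  then have "0 \<le> F s \<and> F s \<le> 1" for s
    using mono[of a s] mono[of s a] mono[of s "a + h"] mono[of "a+h" s] low[of s] up[of s] Fa h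
    by (metis linear order_trans)
  moreover have "C_class_on k UNIV F" for k
    using C_class_on_Suc_D[OF C_class_on_real_SucI[OF open_UNIV F fC]] by blast
  ultimately show ?thesis
    using that F low up by blast
qed

lemma flat_exp_0_scaled_tendsto:
  "(\<lambda>n. flat_exp 0 (real (Suc n) * t)) \<longlonglongrightarrow> (if t > 0 then 1 else 0)"
proof (cases "t > 0")
  case True
  have "(\<lambda>n. exp (- (1 / t) * inverse (real (Suc n)))) \<longlonglongrightarrow> exp (- (1 / t) * 0)"
    by (intro tendsto_intros LIMSEQ_inverse_real_of_nat)
  moreover have "flat_exp 0 (real (Suc n) * t) = exp (- (1 / t) * inverse (real (Suc n)))" for n
    using True unfolding flat_exp_def by (simp add: divide_inverse zero_less_mult_iff)
  ultimately show ?thesis using True by simp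
next
  case False
  then have "flat_exp 0 (real (Suc n) * t) = 0" for n
    by (auto simp: flat_exp_def zero_less_mult_iff)
  then show ?thesis using False by simp
qed

text \<open>Chosen such that \<open>radial_profile m X (|x|\<^sup>2) = |x|\<^sup>-\<^sup>m X(|x|\<^sup>2\<^sup>-\<^sup>m)\<close>; a function of \<open>|x|\<^sup>2\<close> avoids the
  non-smoothness of the norm at the origin.\<close>

definition radial_profile :: "real \<Rightarrow> (real \<Rightarrow> real) \<Rightarrow> real \<Rightarrow> real" where
  "radial_profile m X t = (if t > 0 then t powr (- m / 2) * X (t powr (1 - m / 2)) else 0)"

context
  fixes m :: real and X :: "real \<Rightarrow> real" and \<alpha> \<beta> :: real
  assumes m: "m > 2" and \<alpha>\<beta>: "0 < \<alpha>" "\<alpha> \<le> \<beta>"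
    and X: "\<And>k. C_class_on k UNIV X" and X0: "\<And>s. s \<notin> {\<alpha>..\<beta>} \<Longrightarrow> X s = 0"
begin

text \<open>The exponent \<open>1 - m / 2\<close> is negative, so passing back from \<tau> to the
  squared norm exchanges the roles of \<alpha> and \<beta>. The resulting interval is bounded and
  bounded away from 0.\<close>

lemma powr_exponent_bounds:
  assumes "t > 0" "t powr (1 - m / 2) \<in> {\<alpha>..\<beta>}"
  shows "t \<in> {\<beta> powr (1 / (1 - m / 2))..\<alpha> powr (1 / (1 - m / 2))}"
proof -
  have e: "1 / (1 - m / 2) < 0" using m by (simp add: field_simps)
  have t: "t = (t powr (1 - m / 2)) powr (1 / (1 - m / 2))"
    using assms m by (simp add: powr_powr)
  have "\<beta> powr (1 / (1 - m / 2)) \<le> (t powr (1 - m / 2)) powr (1 / (1 - m / 2))"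
    using assms e \<alpha>\<beta> by (intro powr_mono2') auto
  moreover have "(t powr (1 - m / 2)) powr (1 / (1 - m / 2)) \<le> \<alpha> powr (1 / (1 - m / 2))"
    using assms e \<alpha>\<beta> by (intro powr_mono2') auto
  ultimately show ?thesis using t by auto
qed

lemma radial_profile_eq_0:
  assumes "t \<notin> {\<beta> powr (1 / (1 - m / 2))..\<alpha> powr (1 / (1 - m / 2))}"
  shows "radial_profile m X t = 0"
  using powr_exponent_bounds[of t] X0[of "t powr (1 - m / 2)"] assms
  by (auto simp: radial_profile_def)

text \<open>The powers are smooth only for \<open>t > 0\<close>. Small \<open>t > 0\<close> means
  large \<tau>, where \<open>X\<close> vanishes above \<beta>, so the profile is 0 on an open half
  line reaching beyond 0. The two open half lines overlap and cover everything.\<close>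

lemma C_class_on_radial_profile: "C_class_on k UNIV (radial_profile m X)"
proof -
  let ?\<delta> = "\<beta> powr (1 / (1 - m / 2))"
  have \<delta>: "?\<delta> > 0" using \<alpha>\<beta> by simp
  have "C_class_on k {..<?\<delta>} (radial_profile m X)"
    using C_class_on_cong[of "{..<?\<delta>}" "radial_profile m X" "\<lambda>_. 0" k] radial_profile_eq_0 C_class_on_const
    by auto
  moreover have "C_class_on k {0<..} (radial_profile m X)"
  proof -
    have "C_class_on k {0<..} (\<lambda>t. t powr (- m / 2) * X (t powr (1 - m / 2)))"
      by (intro C_class_on_mult C_class_on_powr C_class_on_compose[OF _ open_UNIV _ C_class_on_powr X]) auto
    then show ?thesis
      using C_class_on_cong[of "{0<..}" "radial_profile m X" "\<lambda>t. t powr (- m / 2) * X (t powr (1 - m / 2))" k]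
      by (auto simp: radial_profile_def)
  qed
  ultimately have "C_class_on k ({..<?\<delta>} \<union> {0<..}) (radial_profile m X)"
    by (intro C_class_on_Un) auto
  moreover have "{..<?\<delta>} \<union> {0<..} = UNIV" using less_le_trans[OF \<delta>] by (auto simp: not_less intro: le_less_trans[OF _ \<delta>])
  ultimately show ?thesis by simp
qed

text \<open>The support is bounded because \<open>X\<close> vanishes below \<alpha>, that is for
  large \<open>x\<close>.\<close>

lemma test_function_radial_field:
  fixes b :: "'a::euclidean_space"
  shows "test_function (\<lambda>x. (x \<bullet> b) * radial_profile m X (x \<bullet> x))"
proof -
  have "C_class_on k UNIV (\<lambda>x. (x \<bullet> b) * radial_profile m X (x \<bullet> x))" for k
    by (intro C_class_on_mult C_class_on_linear bounded_linear_inner_left open_UNIV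
        C_class_on_compose[OF open_UNIV open_UNIV _ C_class_on_inner_self C_class_on_radial_profile]) auto
  moreover have "bounded {x. (x \<bullet> b) * radial_profile m X (x \<bullet> x) \<noteq> 0}"
  proof -
    have "norm x \<le> sqrt (\<alpha> powr (1 / (1 - m / 2)))"
      if "(x \<bullet> b) * radial_profile m X (x \<bullet> x) \<noteq> 0" for x
      using that radial_profile_eq_0[of "x \<bullet> x"] by (auto simp: norm_eq_sqrt_inner)
    then show ?thesis unfolding bounded_iff by blast
  qed
  ultimately show ?thesis
    unfolding test_function_def C_class_iff_C_class_on by (auto simp: compact_eq_bounded_closed intro: bounded_closure)
qed

text \<open>The sum is the divergence of x |x|^(-m) X(|x|^(2-m)). When \<open>m\<close> is the
  dimension, x |x|^(-m) is divergence free away from 0, so only the derivative of \<open>X\<close>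
  survives. It is multiplied by the inner product of x |x|^(-m) with the gradient (2-m) x |x|^(-m)
  of |x|^(2-m), which gives the factor (2-m) |x|^(2-2m).\<close>

lemma sum_partial_radial_field:
  fixes x :: "'a::euclidean_space"
  assumes mN: "m = real DIM('a)"
    and X': "\<And>s. (X has_real_derivative X' s) (at s)"
  shows "(\<Sum>b\<in>Basis. partial_deriv b (\<lambda>x. (x \<bullet> b) * radial_profile m X (x \<bullet> x)) x)
     = (2 - m) * norm x powr (2 - 2 * m) * X' (norm x powr (2 - m))"
proof -
  let ?P = "radial_profile m X"
  have P': "(?P has_real_derivative partial_deriv 1 ?P t) (at t)" for t
  proof -
    have d: "?P differentiable (at t)" using C_class_on_radial_profile[of 1] by simp
    then have "linear (frechet_derivative ?P (at t))" by (rule linear_frechet_derivative)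
    then have "frechet_derivative ?P (at t) h = partial_deriv 1 ?P t * h" for h
      using linear_scale[of "frechet_derivative ?P (at t)" h 1] by (simp add: partial_deriv_def)
    then have "frechet_derivative ?P (at t) = (*) (partial_deriv 1 ?P t)" by blast
    with d show ?thesis
      unfolding has_field_derivative_def frechet_derivative_works by metis
  qed
  have pd: "partial_deriv b (\<lambda>x. (x \<bullet> b) * ?P (x \<bullet> x)) x
      = (b \<bullet> b) * ?P (x \<bullet> x) + (x \<bullet> b) * (partial_deriv 1 ?P (x \<bullet> x) * (2 * (x \<bullet> b)))" for b
  proof -
    have "((\<lambda>x. ?P (x \<bullet> x)) has_derivative (\<lambda>h. partial_deriv 1 ?P (x \<bullet> x) * (2 * (x \<bullet> h)))) (at x)"
      by (rule has_derivative_compose[OF _ P'[unfolded has_field_derivative_def]])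
        (auto intro!: derivative_eq_intros simp: inner_commute)
    then have "((\<lambda>x. (x \<bullet> b) * ?P (x \<bullet> x)) has_derivative
        (\<lambda>h. (x \<bullet> b) * (partial_deriv 1 ?P (x \<bullet> x) * (2 * (x \<bullet> h))) + (h \<bullet> b) * ?P (x \<bullet> x))) (at x)"
      by (intro has_derivative_mult) (auto intro!: derivative_eq_intros)
    from partial_deriv_eqI[OF this, of b] show ?thesis by (simp add: algebra_simps)
  qed
  have "(\<Sum>b\<in>Basis. partial_deriv b (\<lambda>x. (x \<bullet> b) * ?P (x \<bullet> x)) x)
     = (\<Sum>b\<in>Basis. ?P (x \<bullet> x) + 2 * partial_deriv 1 ?P (x \<bullet> x) * ((x \<bullet> b) * (x \<bullet> b)))"
    by (rule sum.cong) (auto simp: pd)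
  also have "\<dots> = m * ?P (x \<bullet> x) + 2 * partial_deriv 1 ?P (x \<bullet> x) * (x \<bullet> x)"
    by (simp add: sum.distrib mN sum_distrib_left[symmetric] euclidean_inner[of x x])
  also have "\<dots> = (2 - m) * norm x powr (2 - 2 * m) * X' (norm x powr (2 - m))"
  proof (cases "x = 0")
    \<comment> \<open>At the origin both sides are 0, the right one because
      \<open>0 powr s = 0\<close>.\<close>
    case True
    then show ?thesis by (simp add: radial_profile_def)
  next
    case False
    define t where "t = x \<bullet> x"
    have t: "t > 0" using False by (simp add: t_def)
    have nx: "norm x powr r = t powr (r / 2)" for r
      using t by (simp add: norm_eq_sqrt_inner t_def powr_half_sqrt[symmetric] powr_powr)
    have "(?P has_real_derivative
        (- m / 2) * t powr (- m / 2 - 1) * X (t powr (1 - m / 2)) +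
        t powr (- m / 2) * (X' (t powr (1 - m / 2)) * ((1 - m / 2) * t powr (1 - m / 2 - 1)))) (at t)"
    proof (rule has_field_derivative_transform_within_open[where S = "{0<..}"])
      have "((\<lambda>t. X (t powr (1 - m / 2))) has_real_derivative
          X' (t powr (1 - m / 2)) * ((1 - m / 2) * t powr (1 - m / 2 - 1))) (at t)"
        by (rule DERIV_chain2[OF X' has_real_derivative_powr[OF t]])
      then show "((\<lambda>t. t powr (- m / 2) * X (t powr (1 - m / 2))) has_real_derivative
        (- m / 2) * t powr (- m / 2 - 1) * X (t powr (1 - m / 2)) +
        t powr (- m / 2) * (X' (t powr (1 - m / 2)) * ((1 - m / 2) * t powr (1 - m / 2 - 1)))) (at t)"
        by (rule DERIV_cong[OF DERIV_mult[OF has_real_derivative_powr[OF t, of "- m / 2"]]])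
          (simp only: mult_ac add_ac)
    qed (use t in \<open>auto simp: radial_profile_def\<close>)
    from DERIV_unique[OF P' this]
    have "partial_deriv 1 ?P t = (- m / 2) * t powr (- m / 2 - 1) * X (t powr (1 - m / 2)) +
        t powr (- m / 2) * (X' (t powr (1 - m / 2)) * ((1 - m / 2) * t powr (1 - m / 2 - 1)))" .
    moreover have "t * t powr (- m / 2 - 1) = t powr (- m / 2)"
      using t powr_mult_base[of t "- m / 2 - 1"] by (simp add: algebra_simps)
    moreover have "t powr (- m / 2) * t powr (1 - m / 2 - 1) * t = t powr (1 - m)"
    proof -
      have "t powr (- m / 2) * t powr (1 - m / 2 - 1) * t powr 1 = t powr (1 - m)"
        by (simp only: powr_add[symmetric]) (simp add: algebra_simps)
      then show ?thesis using t by simp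
    qed
    \<comment> \<open>Here the divergence of x |x|^(-m) cancels: \<open>2 * P * t\<close> contains
      the term \<open>- m * B * Y\<close>. The powers are abstracted to variables so that this is
      pure ring algebra.\<close>
    moreover have "m * (B * Y) + 2 * P * t = (2 - m) * E * Y'"
      if "P = (- m / 2) * A * Y + B * (Y' * ((1 - m / 2) * B'))" "t * A = B" "B * B' * t = E"
      for P A B B' E Y Y' :: real
    proof -
      have "2 * P * t = - m * (t * A) * Y + (2 - m) * (B * B' * t) * Y'"
        unfolding that(1) by (simp add: field_simps)
      then show ?thesis unfolding that by simp
    qed
    moreover have "?P t = t powr (- m / 2) * X (t powr (1 - m / 2))"
      using t by (simp add: radial_profile_def)
    ultimately have "m * ?P t + 2 * partial_deriv 1 ?P t * t
       = (2 - m) * t powr (1 - m) * X' (t powr (1 - m / 2))"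
      by metis
    then show ?thesis by (simp add: nx t_def[symmetric] diff_divide_distrib)
  qed
  finally show ?thesis .
qed

end


section \<open>Radial functions and the radial change of variables\<close>

text \<open>Continuous images of Borel sets can fail to be Borel. An F-sigma set in Euclidean space,
  however, is a countable union of compact sets, and their images are compact.\<close>

lemma fsigma_image_borel:
  fixes f :: "'a::euclidean_space \<Rightarrow> 'b::t2_space"
  assumes "fsigma C" "continuous_on UNIV f"
  shows "f ` C \<in> sets borel"
  using assms(1)
proof cases
  case (1 F)
  have "F n \<subseteq> (\<Union>j::nat. F n \<inter> cball 0 (real j))" for n
    by (auto simp: real_arch_simple)
  then have "C = (\<Union>n. \<Union>j::nat. F n \<inter> cball 0 (real j))"
    unfolding 1(1) by (intro equalityI UN_mono UN_least order_refl) (auto simp: real_arch_simple)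
  then have "f ` C = (\<Union>n. \<Union>j::nat. f ` (F n \<inter> cball 0 (real j)))"
    by (simp only: image_UN[symmetric])
  moreover have "f ` (F n \<inter> cball 0 (real j)) \<in> sets borel" for n j
    using 1 assms(2)
    by (intro borel_closed compact_imp_closed compact_continuous_image)
      (auto intro: continuous_on_subset closed_Int_compact)
  ultimately show ?thesis by auto
qed

text \<open>A superlevel set of a radial function differs from an \<open>F\<^sub>\<sigma>\<close> subset by a null set, and
  the norms of the points of an \<open>F\<^sub>\<sigma>\<close> set form a Borel set.\<close>

lemma radial_borel_profile:
  fixes w :: "'a::euclidean_space \<Rightarrow> real"
  assumes "w \<in> borel_measurable lebesgue" "radial w"
  obtains g :: "real \<Rightarrow> real" where "g \<in> borel_measurable borel" "AE x in lborel. w x = g (norm x)"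
proof -
  have "{x. w x > a} \<in> sets lebesgue" for a
    using assms(1) borel_measurable_iff_greater[of w lebesgue] by auto
  then have "\<exists>C T. fsigma C \<and> T \<in> null_sets lebesgue \<and> C \<union> T = {x. w x > a}" for a
    using lebesgue_set_almost_fsigma by metis
  then obtain C T where CT: "\<And>a. fsigma (C a)" "\<And>a. T a \<in> null_sets lebesgue"
      "\<And>a. C a \<union> T a = {x. w x > a}"
    by metis
  \<comment> \<open>A real number is the supremum of the rationals below it. Membership of
    \<open>r\<close> in the set of norms of \<open>C a\<close> plays the role of "w > a on the
    sphere of radius r"; restricting \<open>a\<close> to rationals keeps the union of the
    exceptional sets null. Values are extended reals because at exceptional radii the supremum may
    be infinite.\<close>
  define h :: "real \<Rightarrow> ereal" where
    "h r = (SUP a\<in>\<rat>. if r \<in> norm ` C a then ereal a else - \<infinity>)" for r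
  have meas: "h \<in> borel_measurable borel"
    unfolding h_def
  proof (rule borel_measurable_SUP)
    show "countable (\<rat> :: real set)" by (rule countable_rat)
    show "(\<lambda>r. if r \<in> norm ` C a then ereal a else - \<infinity>) \<in> borel_measurable borel" for a
      using fsigma_image_borel[OF CT(1)[of a] continuous_on_norm_id] by simp
  qed
  have "(\<Union>a\<in>\<rat>. T a) \<in> null_sets lebesgue"
    by (intro null_sets_UN') (auto simp: CT countable_rat)
  then have "AE x in lebesgue. x \<notin> (\<Union>a\<in>\<rat>. T a)"
    by (rule AE_not_in)
  then have "AE x in lborel. x \<notin> (\<Union>a\<in>\<rat>. T a)"
    by (simp add: AE_completion_iff)
  moreover have "w x = real_of_ereal (h (norm x))" if x: "x \<notin> (\<Union>a\<in>\<rat>. T a)" for x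
  proof -
    have *: "norm x \<in> norm ` C a \<longleftrightarrow> a < w x" if "a \<in> \<rat>" for a
    proof
      assume "norm x \<in> norm ` C a"
      then obtain y where y: "y \<in> C a" "norm y = norm x" by auto
      then have "a < w y" using CT(3)[of a] by blast
      then show "a < w x" using y assms(2) by (metis radial_def)
    next
      assume "a < w x"
      then show "norm x \<in> norm ` C a" using CT(3)[of a] x that by blast
    qed
    have "h (norm x) = ereal (w x)"
    proof (rule antisym)
      show "h (norm x) \<le> ereal (w x)"
        unfolding h_def using * by (intro SUP_least) auto
      show "ereal (w x) \<le> h (norm x)"
      proof (rule ccontr)
        assume "\<not> ereal (w x) \<le> h (norm x)"
        then obtain z where z: "h (norm x) < ereal z" "z < w x"
          using ereal_dense2[of "h (norm x)" "ereal (w x)"] by (auto simp: not_le)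
        then obtain a where a: "a \<in> \<rat>" "z < a" "a < w x"
          using Rats_dense_in_real[of z "w x"] by auto
        then have "ereal a \<le> h (norm x)"
          unfolding h_def using * by (intro SUP_upper2[of a]) auto
        then have "ereal a < ereal z" using z(1) by (rule le_less_trans)
        then show False using a by simp
      qed
    qed
    then show ?thesis by simp
  qed
  ultimately have "AE x in lborel. w x = real_of_ereal (h (norm x))" by auto
  moreover have "(\<lambda>r. real_of_ereal (h r)) \<in> borel_measurable borel"
    using meas by simp
  ultimately show ?thesis using that by blast
qed

text \<open>Uniqueness from finite tails applies to the restrictions to \<open>{e<..}\<close> with
  \<open>e > 0\<close>; letting \<open>e\<close> decrease to 0 recovers the measures. This detour
  admits infinite mass near 0, which does occur: small values of \<open>newton\<close> correspond to
  the exterior of a ball.\<close>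

lemma measure_eq_on_positive:
  fixes M N :: "real measure"
  assumes sets: "sets M = sets borel" "sets N = sets borel"
    and null: "emeasure M {..0} = 0" "emeasure N {..0} = 0"
    and fin: "\<And>c. c > 0 \<Longrightarrow> emeasure M {c<..} < \<infinity>"
    and eq: "\<And>c. c > 0 \<Longrightarrow> emeasure M {c<..} = emeasure N {c<..}"
  shows "M = N"
proof (rule measure_eqI)
  show "sets M = sets N" using sets by simp
  fix A assume "A \<in> sets M"
  then have A: "A \<in> sets borel" using sets by simp
  have restr: "density M (indicator {e<..}) = density N (indicator {e<..})" if "e > 0" for e :: real
  proof (rule measure_eqI_lessThan)
    have *: "emeasure (density K (indicator {e<..})) {x<..} = emeasure K {max e x<..}"
      if "sets K = sets borel" for x and K :: "real measure"
    proof -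
      have "{e<..} \<inter> {x<..} = {max e x<..}" by auto
      then show ?thesis using that
        by (simp add: emeasure_density indicator_inter_arith[symmetric])
    qed
    show "emeasure (density M (indicator {e<..})) {x<..} < \<infinity>" for x
      using that fin[of "max e x"] by (subst *) (auto simp: sets)
    show "emeasure (density M (indicator {e<..})) {x<..} = emeasure (density N (indicator {e<..})) {x<..}" for x
      using that by (simp add: * sets eq)
  qed (use sets in simp_all)
  have lim: "emeasure K A = (SUP n. emeasure (density K (indicator {1 / real (Suc n)<..})) A)"
    if K: "sets K = sets borel" "emeasure K {..0} = 0" for K :: "real measure"
  proof -
    have "emeasure K A = emeasure K (A - {..0})"
      using K A by (intro emeasure_Diff_null_set[symmetric]) auto
    also have "A - {..0} = (\<Union>n. A \<inter> {1 / real (Suc n)<..})"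
    proof -
      have "\<exists>n. 1 / real (Suc n) < x" if "x > 0" for x :: real
        using reals_Archimedean[OF that] by (auto simp: inverse_eq_divide)
      moreover have "x > 0" if "1 / real (Suc n) < x" for x n
        using that by (meson less_trans of_nat_0_less_iff zero_less_Suc zero_less_divide_1_iff)
      ultimately show ?thesis
        by (intro set_eqI) (simp only: Diff_iff UN_iff Int_iff greaterThan_iff atMost_iff not_le, blast)
    qed
    also have "emeasure K \<dots> = (SUP n. emeasure K (A \<inter> {1 / real (Suc n)<..}))"
    proof (rule SUP_emeasure_incseq[symmetric])
      show "incseq (\<lambda>n. A \<inter> {1 / real (Suc n)<..})"
        unfolding incseq_def
        by (intro allI impI Int_mono subset_refl greaterThan_subset_iff[THEN iffD2] divide_left_mono) auto
      show "range (\<lambda>n. A \<inter> {1 / real (Suc n)<..}) \<subseteq> sets K"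
        unfolding K(1) by (intro image_subsetI sets.Int A borel_open open_greaterThan)
    qed
    also have "\<dots> = (SUP n. emeasure (density K (indicator {1 / real (Suc n)<..})) A)"
    proof (rule SUP_cong)
      fix n
      have "(\<lambda>x. indicator {1 / real (Suc n)<..} x * indicator A x :: ennreal) =
          indicator (A \<inter> {1 / real (Suc n)<..})"
        by (auto simp: indicator_def)
      then show "emeasure K (A \<inter> {1 / real (Suc n)<..}) =
          emeasure (density K (indicator {1 / real (Suc n)<..})) A"
        using K A by (subst emeasure_density) auto
    qed simp
    finally show ?thesis .
  qed
  show "emeasure M A = emeasure N A"
    using restr by (simp add: lim[OF sets(1) null(1)] lim[OF sets(2) null(2)])
qed

section \<open>The image of Lebesgue measure under the Newtonian kernel\<close>

text \<open>This is \<tau> as a function of the point. By \<open>0 powr s = 0\<close> its value at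
  the origin is 0 instead of infinity, so superlevel sets are punctured balls and
  \<open>newton x > 0\<close> means that \<open>x\<close> is not the origin.\<close>

definition newton :: "'a::euclidean_space \<Rightarrow> real" where
  "newton x = norm x powr (2 - real DIM('a))"

lemma newton_measurable [measurable]: "newton \<in> borel_measurable borel"
  unfolding newton_def[abs_def] by measurable

text \<open>The set where \<open>newton\<close> exceeds t is a punctured ball of volume \<omega>
  t^(-N/(N-2)), with \<omega> the volume of the unit ball. Minus the derivative in t is c
  t^(-\<gamma>); here \<gamma> is \<open>newton_exp\<close> and c is \<open>newton_const\<close>.
  The same \<gamma> satisfies |x|^(2-2N) = newton(x)^\<gamma>, so the factor in the divergence
  formula cancels the density exactly.\<close>

definition newton_exp :: "'a::euclidean_space itself \<Rightarrow> real" where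
  "newton_exp _ = (2 * real DIM('a) - 2) / (real DIM('a) - 2)"

definition newton_const :: "'a::euclidean_space itself \<Rightarrow> real" where
  "newton_const _ = unit_ball_vol (real DIM('a)) * real DIM('a) / (real DIM('a) - 2)"

lemma newton_superlevel:
  assumes "DIM('a::euclidean_space) \<ge> 3" "c > 0"
  shows "{x::'a. c < newton x} = ball 0 (c powr (1 / (2 - real DIM('a)))) - {0}"
proof -
  let ?m = "real DIM('a)"
  have "c < newton x \<longleftrightarrow> norm x < c powr (1 / (2 - ?m))" if "x \<noteq> 0" for x :: 'a
  proof -
    have n: "norm x = newton x powr (1 / (2 - ?m))"
      using that assms by (simp add: newton_def powr_powr)
    have e: "1 / (2 - ?m) < 0" using assms by (simp add: field_simps)
    show ?thesis
    proof
      assume "c < newton x"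
      then show "norm x < c powr (1 / (2 - ?m))"
        unfolding n using assms e by (intro powr_less_mono2_neg) auto
    next
      assume l: "norm x < c powr (1 / (2 - ?m))"
      show "c < newton x"
      proof (rule ccontr)
        assume "\<not> c < newton x"
        then have "c powr (1 / (2 - ?m)) \<le> newton x powr (1 / (2 - ?m))"
          using that e by (intro powr_mono2') (auto simp: newton_def)
        then show False using l n by simp
      qed
    qed
  qed
  moreover have "\<not> c < newton (0 :: 'a)" using assms(2) by (simp add: newton_def)
  ultimately show ?thesis by auto (metis | fastforce)+
qed

text \<open>This takes the place of polar coordinates. It is enough to compare tails: one is the
  volume of a ball, the other an elementary integral.\<close>

lemma distr_newton:
  assumes N: "DIM('a::euclidean_space) \<ge> 3"
  shows "distr lborel borel (newton :: 'a \<Rightarrow> real) =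
    density lborel (\<lambda>t. ennreal (newton_const TYPE('a) * t powr (- newton_exp TYPE('a))) * indicator {0<..} t)"
    (is "?M = density lborel ?d")
proof (rule measure_eq_on_positive)
  let ?m = "real DIM('a)" and ?\<omega> = "unit_ball_vol (real DIM('a))"
  have [measurable]: "?d \<in> borel_measurable borel" by measurable
  have "emeasure ?M {..0} = emeasure lborel (newton -` {..0} :: 'a set)"
    by (subst emeasure_distr) auto
  also have "(newton -` {..0} :: 'a set) = {0}"
    by (auto simp: newton_def not_le[symmetric])
  finally have "emeasure ?M {..0} = emeasure lborel {0::'a}" .
  then show "emeasure ?M {..0} = 0" by simp
  have "(\<lambda>t. ?d t * indicator {..0} t) = (\<lambda>_. 0)" by (auto simp: indicator_def)
  then show "emeasure (density lborel ?d) {..0} = 0"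
    by (subst emeasure_density) auto
  have M: "emeasure ?M {c<..} = ennreal (?\<omega> * c powr (- (?m / (?m - 2))))" if c: "c > 0" for c
  proof -
    have "emeasure ?M {c<..} = emeasure lborel {x::'a. c < newton x}"
      by (subst emeasure_distr) (auto intro!: arg_cong2[where f = emeasure])
    also have "\<dots> = emeasure lborel (ball 0 (c powr (1 / (2 - ?m))) :: 'a set)"
      unfolding newton_superlevel[OF N c] by (intro emeasure_Diff_null_set) auto
    also have "\<dots> = ennreal (?\<omega> * (c powr (1 / (2 - ?m))) ^ DIM('a))"
      by (simp add: emeasure_ball)
    also have "(c powr (1 / (2 - ?m))) ^ DIM('a) = c powr (1 / (2 - ?m) * ?m)"
      using c by (simp add: powr_realpow[symmetric] powr_powr)
    also have "1 / (2 - ?m) * ?m = - (?m / (?m - 2))" using N by (simp add: field_simps)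
    finally show ?thesis .
  qed
  then show "emeasure ?M {c<..} < \<infinity>" if "c > 0" for c using that by simp
  have "emeasure (density lborel ?d) {c<..} = ennreal (?\<omega> * c powr (- (?m / (?m - 2))))" if c: "c > 0" for c
  proof -
    let ?e = "- (?m / (?m - 2))"
    have e: "?e < 0" using N by simp
    have "emeasure (density lborel ?d) {c<..} = (\<integral>\<^sup>+ t. ?d t * indicator {c<..} t \<partial>lborel)"
      by (rule emeasure_density) auto
    also have "\<dots> = (\<integral>\<^sup>+ t. ennreal (newton_const TYPE('a) * t powr (- newton_exp TYPE('a))) * indicator {c..} t \<partial>lborel)"
      using c AE_lborel_singleton[of c]
      by (intro nn_integral_cong_AE) (auto elim!: eventually_mono simp: indicator_def)
    also have "\<dots> = ennreal (0 - (- ?\<omega> * c powr ?e))"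
    proof (rule nn_integral_FTC_atLeast)
      fix t assume t: "c \<le> t"
      have "((\<lambda>t. - ?\<omega> * t powr ?e) has_real_derivative - ?\<omega> * (?e * t powr (?e - 1))) (at t)"
        using t c by (intro DERIV_cmult has_real_derivative_powr) auto
      moreover have "- ?\<omega> * (?e * t powr (?e - 1)) = newton_const TYPE('a) * t powr (- newton_exp TYPE('a))"
      proof -
        have "?e - 1 = - newton_exp TYPE('a)" using N by (simp add: newton_exp_def field_simps)
        then show ?thesis by (simp add: newton_const_def)
      qed
      ultimately show "((\<lambda>t. - ?\<omega> * t powr ?e) has_real_derivative
          newton_const TYPE('a) * t powr (- newton_exp TYPE('a))) (at t)" by simp
      show "0 \<le> newton_const TYPE('a) * t powr - newton_exp TYPE('a)"
        using N by (simp add: newton_const_def)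
    next
      have "((\<lambda>t. - ?\<omega> * t powr ?e) \<longlongrightarrow> - ?\<omega> * 0) at_top"
        by (intro tendsto_intros tendsto_neg_powr filterlim_ident e)
      then show "((\<lambda>t. - ?\<omega> * t powr ?e) \<longlongrightarrow> 0) at_top" by simp
    qed simp
    finally show ?thesis by simp
  qed
  then show "emeasure ?M {c<..} = emeasure (density lborel ?d) {c<..}" if "c > 0" for c
    using M that by simp
qed simp_all


section \<open>Hoelder continuity from oscillation of averages\<close>

text \<open>The positive and negative parts of \<open>f\<close> are densities of two measures that
  agree on all rays \<open>{x<..}\<close>, hence coincide; uniqueness of densities makes both parts
  equal almost everywhere, which is possible only where \<open>f\<close> is 0.\<close>

lemma AE_eq_0_if_greaterThan_integrals_0:
  fixes f :: "real \<Rightarrow> real"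
  assumes f: "integrable lborel f"
    and zero: "\<And>x. (\<integral>t. f t * indicator {x<..} t \<partial>lborel) = 0"
  shows "AE t in lborel. f t = 0"
proof -
  have [measurable]: "f \<in> borel_measurable borel" using f by simp
  let ?p = "\<lambda>t. max (f t) 0" and ?n = "\<lambda>t. max (- f t) 0"
  have i: "integrable lborel ?p" "integrable lborel ?n" using f by auto
  have i': "integrable lborel (\<lambda>t. ?p t * indicator {x<..} t)"
      "integrable lborel (\<lambda>t. ?n t * indicator {x<..} t)" for x
    using i by (auto intro: integrable_real_mult_indicator)
  have p: "emeasure (density lborel ?p) {x<..} = ennreal (\<integral>t. ?p t * indicator {x<..} t \<partial>lborel)" for x
    by (subst emeasure_density) (auto simp: ennreal_mult' ennreal_indicator[symmetric]
        nn_integral_eq_integral[OF i'(1), symmetric] intro!: nn_integral_cong)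
  have n: "emeasure (density lborel ?n) {x<..} = ennreal (\<integral>t. ?n t * indicator {x<..} t \<partial>lborel)" for x
    by (subst emeasure_density) (auto simp: ennreal_mult' ennreal_indicator[symmetric]
        nn_integral_eq_integral[OF i'(2), symmetric] intro!: nn_integral_cong)
  have pn: "(\<integral>t. ?p t * indicator {x<..} t \<partial>lborel) = (\<integral>t. ?n t * indicator {x<..} t \<partial>lborel)" for x
  proof -
    have "(\<integral>t. ?p t * indicator {x<..} t \<partial>lborel) - (\<integral>t. ?n t * indicator {x<..} t \<partial>lborel)
        = (\<integral>t. ?p t * indicator {x<..} t - ?n t * indicator {x<..} t \<partial>lborel)"
      using i' by simp
    also have "\<dots> = (\<integral>t. f t * indicator {x<..} t \<partial>lborel)"
      by (intro Bochner_Integration.integral_cong) (auto simp: indicator_def max_def)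
    finally show ?thesis using zero by simp
  qed
  have "density lborel ?p = density lborel ?n"
    by (rule measure_eqI_lessThan) (auto simp: p n pn)
  then have "AE t in lborel. ennreal (?p t) = ennreal (?n t)"
    by (intro sigma_finite_measure.density_unique sigma_finite_lborel) auto
  then show ?thesis
  proof eventually_elim
    case (elim t)
    then show ?case by (cases "f t \<ge> 0") (auto simp: max_def split: if_splits)
  qed
qed

lemma AE_eq_on_pos_if_integrals_eq:
  fixes f g :: "real \<Rightarrow> real"
  assumes f: "\<And>a b. 0 < a \<Longrightarrow> a < b \<Longrightarrow> set_integrable lborel {a..b} f"
    and g: "\<And>a b. 0 < a \<Longrightarrow> a < b \<Longrightarrow> set_integrable lborel {a..b} g"
    and eq: "\<And>a b. 0 < a \<Longrightarrow> a < b \<Longrightarrow> (LBINT t:{a..b}. f t) = (LBINT t:{a..b}. g t)"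
  shows "AE t in lborel. t > 0 \<longrightarrow> f t = g t"
proof -
  \<comment> \<open>Compact intervals exhausting the positive half line; the summand 2 makes them
    nondegenerate already for \<open>n = 0\<close>.\<close>
  have "AE t in lborel. (f t - g t) * indicator {1 / (real n + 2)..real n + 2} t = 0" for n :: nat
  proof (rule AE_eq_0_if_greaterThan_integrals_0)
    define a b where ab: "a = 1 / (real n + 2)" "b = real n + 2"
    have ab': "0 < a" "a < b" unfolding ab by (auto simp: field_simps power2_eq_square add_pos_nonneg)
    have int: "integrable lborel (\<lambda>t. (f t - g t) * indicator {c..d} t)" if "0 < c" "c < d" for c d
    proof -
      have "set_integrable lborel {c..d} (\<lambda>t. f t - g t)"
        using f g that by (intro set_integral_diff) auto
      then show ?thesis by (simp add: set_integrable_def mult.commute)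
    qed
    have zero: "(\<integral>t. (f t - g t) * indicator {c..d} t \<partial>lborel) = 0" if "0 < c" "c < d" for c d
    proof -
      have "(LBINT t:{c..d}. f t - g t) = 0"
        using f g eq that by (subst set_integral_diff) auto
      then show ?thesis by (simp add: set_lebesgue_integral_def mult.commute)
    qed
    show "integrable lborel (\<lambda>t. (f t - g t) * indicator {1 / (real n + 2)..real n + 2} t)"
      using int[OF ab'] by (simp add: ab)
    fix x :: real
    let ?c = "max x a"
    have "(\<integral>t. (f t - g t) * indicator {a..b} t * indicator {x<..} t \<partial>lborel) = 0"
    proof (cases "?c < b")
      case True
      have "(\<integral>t. (f t - g t) * indicator {a..b} t * indicator {x<..} t \<partial>lborel)
         = (\<integral>t. (f t - g t) * indicator {?c..b} t \<partial>lborel)"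
        using int[OF ab'] int[of ?c b] ab' True AE_lborel_singleton[of x]
        by (intro integral_cong_AE) (auto elim!: eventually_mono simp: indicator_def
            dest!: borel_measurable_integrable)
      then show ?thesis using zero[of ?c b] ab' True by simp
    next
      case False
      then have "b \<le> x" using ab' by auto
      then have "(\<lambda>t. (f t - g t) * indicator {a..b} t * indicator {x<..} t) = (\<lambda>_. 0)"
        by (auto simp: indicator_def)
      then show ?thesis by simp
    qed
    then show "(\<integral>t. (f t - g t) * indicator {1 / (real n + 2)..real n + 2} t * indicator {x<..} t \<partial>lborel) = 0"
      by (simp add: ab)
  qed
  then have "AE t in lborel. \<forall>n::nat. (f t - g t) * indicator {1 / (real n + 2)..real n + 2} t = 0"
    by (subst AE_all_countable) auto
  then show ?thesis
  proof (rule AE_mp, intro AE_I2 impI)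
    fix t :: real assume *: "\<forall>n::nat. (f t - g t) * indicator {1 / (real n + 2)..real n + 2} t = 0" and t: "t > 0"
    obtain n where n: "max t (1 / t) < real n" using reals_Archimedean2 by blast
    then have "1 / (real n + 2) \<le> t" using t by (auto simp: field_simps)
    then show "f t = g t" using spec[OF *, of n] n by (auto simp: indicator_def split: if_splits)
  qed
qed

text \<open>Halving the length changes an average by half the difference of two neighbouring averages, so the
  averages of \<open>f\<close> over dyadic lengths converge uniformly.\<close>

lemma hoelder_half_representative:
  fixes f :: "real \<Rightarrow> real"
  assumes f: "\<And>a b. 0 < a \<Longrightarrow> a < b \<Longrightarrow> set_integrable lborel {a..b} f"
    and C: "C \<ge> 0"
    and osc: "\<And>a b h. 0 < a \<Longrightarrow> a \<le> b \<Longrightarrow> 0 < h \<Longrightarrow>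
      \<bar>(LBINT t:{a..a+h}. f t) - (LBINT t:{b..b+h}. f t)\<bar> \<le> C * h * sqrt (b - a + h)"
  obtains G where "\<And>a b. 0 < a \<Longrightarrow> 0 < b \<Longrightarrow> \<bar>G a - G b\<bar> \<le> C * sqrt \<bar>a - b\<bar>"
    and "AE t in lborel. t > 0 \<longrightarrow> f t = G t"
proof -
  define A where "A a h = integral {a..a+h} f" for a h
  have fi: "f integrable_on {a..b}" if "0 < a" for a b
    using f[of a b] set_borel_integral_eq_integral(1)[of "{a..b}" f] that
    by (cases "a < b") (auto simp: not_less order_le_less)
  have A: "A a h = (LBINT t:{a..a+h}. f t)" if "0 < a" "0 < h" for a h
    using f[of a "a + h"] that by (auto simp: A_def set_borel_integral_eq_integral(2))
  have A_osc: "\<bar>A a h - A b h\<bar> \<le> C * h * sqrt (\<bar>b - a\<bar> + h)" if "0 < a" "0 < b" "0 < h" for a b h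
  proof (cases "a \<le> b")
    case True
    then show ?thesis using osc[of a b h] that by (simp add: A)
  next
    case False
    then show ?thesis using osc[of b a h] that by (simp add: A abs_minus_commute)
  qed
  have A_add: "A a (h + k) = A a h + A (a + h) k" if "0 < a" "0 \<le> h" "0 \<le> k" for a h k
    using Henstock_Kurzweil_Integration.integral_combine[of a "a + h" "a + h + k" f] that fi[of a "a + h + k"]
    by (simp add: A_def add.assoc)
  define \<eta> :: "nat \<Rightarrow> real" where "\<eta> j = (1 / 2) ^ j" for j
  have \<eta>: "\<eta> j > 0" "\<eta> j \<le> 1" for j by (auto simp: \<eta>_def power_le_one)
  have \<eta>0: "\<eta> \<longlonglongrightarrow> 0" unfolding \<eta>_def by (rule LIMSEQ_power_zero) simp
  define D where "D j a = A a (\<eta> j) / \<eta> j" for j a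
  have D_osc: "\<bar>D j a - D j b\<bar> \<le> C * sqrt (\<bar>a - b\<bar> + \<eta> j)" if "0 < a" "0 < b" for j a b
  proof -
    have "\<bar>D j a - D j b\<bar> = \<bar>A a (\<eta> j) - A b (\<eta> j)\<bar> / \<eta> j"
      using \<eta>(1)[of j] by (simp add: D_def diff_divide_distrib[symmetric] abs_divide)
    also have "\<dots> \<le> C * \<eta> j * sqrt (\<bar>b - a\<bar> + \<eta> j) / \<eta> j"
      using A_osc[OF that \<eta>(1)[of j]] \<eta>(1)[of j] by (intro divide_right_mono) auto
    finally show ?thesis using \<eta>(1)[of j] by (simp add: abs_minus_commute)
  qed
  have D_step: "\<bar>D (Suc j) a - D j a\<bar> \<le> C * sqrt (1 / 2) ^ j" if "0 < a" for j a
  proof -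
    let ?h = "\<eta> (Suc j)"
    have h: "?h > 0" "\<eta> j = ?h + ?h" using \<eta> by (auto simp: \<eta>_def)
    have "D (Suc j) a - D j a = (D (Suc j) a - D (Suc j) (a + ?h)) / 2"
      unfolding D_def h(2) using that h(1) by (subst A_add) (auto simp: field_simps)
    then have "\<bar>D (Suc j) a - D j a\<bar> \<le> \<bar>D (Suc j) a - D (Suc j) (a + ?h)\<bar>" by simp
    also have "\<dots> \<le> C * sqrt (\<bar>a - (a + ?h)\<bar> + ?h)"
      using that h by (intro D_osc) auto
    also have "\<bar>a - (a + ?h)\<bar> + ?h = (1 / 2) ^ j" using h by (simp add: \<eta>_def)
    finally show ?thesis by (simp add: real_sqrt_power)
  qed
  \<comment> \<open>The limit of \<open>D j a\<close> is written as a telescoping series so that the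
    geometric bound on the increments gives uniform convergence by the Weierstrass test.\<close>
  define G where "G a = D 0 a + (\<Sum>i. D (Suc i) a - D i a)" for a
  have "uniform_limit {0<..} (\<lambda>n a. \<Sum>i<n. D (Suc i) a - D i a) (\<lambda>a. \<Sum>i. D (Suc i) a - D i a) sequentially"
  proof (rule Weierstrass_m_test)
    show "summable (\<lambda>j. C * sqrt (1 / 2) ^ j)"
      by (intro summable_mult summable_geometric) (auto simp: real_sqrt_lt_1_iff)
  qed (use D_step in auto)
  then have "uniform_limit {0<..} (\<lambda>n a. D 0 a + (\<Sum>i<n. D (Suc i) a - D i a)) G sequentially"
    unfolding G_def by (intro uniform_limit_add uniform_limit_const)
  moreover have "(\<lambda>n a. D 0 a + (\<Sum>i<n. D (Suc i) a - D i a)) = D"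
  proof (intro ext)
    show "D 0 a + (\<Sum>i<n. D (Suc i) a - D i a) = D n a" for n a
      using sum_lessThan_telescope[of "\<lambda>i. D i a" n] by simp
  qed
  ultimately have UL: "uniform_limit {0<..} D G sequentially" by simp
  then have lim: "(\<lambda>j. D j a) \<longlonglongrightarrow> G a" if "0 < a" for a
    using that by (auto intro: tendsto_uniform_limitI)
  have G: "\<bar>G a - G b\<bar> \<le> C * sqrt \<bar>a - b\<bar>" if "0 < a" "0 < b" for a b
  proof (rule LIMSEQ_le)
    show "(\<lambda>j. \<bar>D j a - D j b\<bar>) \<longlonglongrightarrow> \<bar>G a - G b\<bar>"
      using that by (intro tendsto_intros lim)
    have "(\<lambda>j. C * sqrt (\<bar>a - b\<bar> + \<eta> j)) \<longlonglongrightarrow> C * sqrt (\<bar>a - b\<bar> + 0)"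
      by (intro tendsto_intros \<eta>0)
    then show "(\<lambda>j. C * sqrt (\<bar>a - b\<bar> + \<eta> j)) \<longlonglongrightarrow> C * sqrt \<bar>a - b\<bar>" by simp
  qed (use D_osc that in auto)
  have G_cont: "continuous_on {0<..} G"
  proof -
    have "(G \<longlongrightarrow> G a) (at a within {0<..})" if "0 < a" for a
    proof -
      have "((\<lambda>b. C * sqrt \<bar>b - a\<bar>) \<longlongrightarrow> C * sqrt \<bar>a - a\<bar>) (at a within {0<..})"
        by (intro tendsto_intros)
      then have "((\<lambda>b. C * sqrt \<bar>b - a\<bar>) \<longlongrightarrow> 0) (at a within {0<..})" by simp
      then have "((\<lambda>b. G b - G a) \<longlongrightarrow> 0) (at a within {0<..})"
        by (rule Lim_null_comparison[rotated]) (use G that in \<open>auto simp: eventually_at_filter\<close>)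
      then show ?thesis using Lim_null by blast
    qed
    then show ?thesis by (auto simp: continuous_on_def)
  qed
  have Gi: "set_integrable lborel {a..b} G" if "0 < a" for a b
    using that G_cont by (intro borel_integrable_atLeastAtMost') (auto intro: continuous_on_subset)
  \<comment> \<open>Averages are not shown to converge to \<open>f\<close> pointwise. With
    \<open>F\<close> a primitive of \<open>f\<close> and \<open>P\<close> a primitive of
    \<open>F\<close>, the integral of \<open>D j\<close> over \<open>{a..b}\<close> is a difference
    of two difference quotients of \<open>P\<close>, so it tends to \<open>F b - F a\<close>;
    uniform convergence says that it also tends to the integral of \<open>G\<close>.\<close>
  have "integral {a..b} f = integral {a..b} G" if ab: "0 < a" "a < b" for a b
  proof -
    define F where "F x = integral {a..x} f" for x
    \<comment> \<open>The end point \<open>b + 1\<close> leaves room for the shifts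
      \<open>\<eta> j\<close>, which are at most 1.\<close>
    have F_cont: "continuous_on {a..b+1} F"
      unfolding F_def by (rule indefinite_integral_continuous_1) (use ab fi in auto)
    define P where "P x = integral {a..x} F" for x
    have Fi: "F integrable_on {c..d}" if "a \<le> c" "d \<le> b + 1" for c d
      using that F_cont by (intro integrable_continuous_real) (auto intro: continuous_on_subset)
    have P: "(P has_real_derivative F t) (at t within {a..b+1})" if "t \<in> {a..b+1}" for t
      unfolding P_def by (rule integral_has_real_derivative[OF F_cont that])
    have quot: "(\<lambda>j. (P (t + \<eta> j) - P t) / \<eta> j) \<longlonglongrightarrow> F t" if t: "a \<le> t" "t \<le> b" for t
    proof -
      have "((\<lambda>y. (P y - P t) / (y - t)) \<longlongrightarrow> F t) (at t within {a..b+1})"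
        using P[of t] t by (simp add: has_field_derivative_iff)
      moreover have "filterlim (\<lambda>j. t + \<eta> j) (at t within {a..b+1}) sequentially"
      proof -
        have "(\<lambda>j. t + \<eta> j) \<longlonglongrightarrow> t + 0" by (intro tendsto_intros \<eta>0)
        moreover have "t + \<eta> j \<in> {a..b+1} - {t}" for j
          using t \<eta>[of j] by auto
        ultimately show ?thesis by (auto simp: filterlim_at)
      qed
      ultimately have "(\<lambda>j. (P (t + \<eta> j) - P t) / (t + \<eta> j - t)) \<longlonglongrightarrow> F t"
        by (rule filterlim_compose)
      then show ?thesis by simp
    qed
    have D_F: "D j s = (F (s + \<eta> j) - F s) / \<eta> j" if "s \<in> {a..b}" for s j
    proof -
      have "F (s + \<eta> j) = F s + integral {s..s + \<eta> j} f"
        unfolding F_def using that ab \<eta>[of j] fi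
        by (intro Henstock_Kurzweil_Integration.integral_combine[symmetric]) auto
      then show ?thesis by (simp add: D_def A_def)
    qed
    have cont_shift: "continuous_on {a..b} (\<lambda>s. F (s + \<eta> j))" for j
      by (rule continuous_on_compose2[OF F_cont]) (use \<eta>[of j] in \<open>auto intro!: continuous_intros\<close>)
    have cont_D: "continuous_on {a..b} (D j)" for j
    proof -
      have "continuous_on {a..b} (\<lambda>s. (F (s + \<eta> j) - F s) / \<eta> j)"
        using \<eta>(1)[of j] cont_shift[of j]
        by (intro continuous_intros) (auto intro: continuous_on_subset[OF F_cont])
      then show ?thesis by (rule continuous_on_eq) (simp add: D_F)
    qed
    have int_D: "integral {a..b} (D j) = (P (b + \<eta> j) - P b) / \<eta> j - (P (a + \<eta> j) - P a) / \<eta> j" for j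
    proof -
      have sh: "integral {a..b} (\<lambda>s. F (s + \<eta> j)) = integral {a + \<eta> j..b + \<eta> j} F"
        using integral_shift_real_ivl[of "a + \<eta> j" "\<eta> j" "b + \<eta> j" F] by simp
      have "P (a + \<eta> j) + integral {a + \<eta> j..b + \<eta> j} F = P (b + \<eta> j)"
        unfolding P_def using ab \<eta>[of j] Fi
        by (intro Henstock_Kurzweil_Integration.integral_combine) auto
      with sh have sh': "integral {a..b} (\<lambda>s. F (s + \<eta> j)) = P (b + \<eta> j) - P (a + \<eta> j)" by simp
      have "integral {a..b} (D j) = integral {a..b} (\<lambda>s. (F (s + \<eta> j) - F s) / \<eta> j)"
        using D_F by (intro Henstock_Kurzweil_Integration.integral_cong) auto
      also have "\<dots> = (integral {a..b} (\<lambda>s. F (s + \<eta> j)) - integral {a..b} F) / \<eta> j"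
        using cont_shift[of j] Fi[of a b]
        by (simp add: Henstock_Kurzweil_Integration.integral_diff integrable_continuous_real)
      finally show ?thesis
        unfolding sh' by (simp add: P_def diff_divide_distrib)
    qed
    have "(\<lambda>j. integral {a..b} (D j)) \<longlonglongrightarrow> F b - F a"
      unfolding int_D using ab by (intro tendsto_diff quot) auto
    moreover have "(\<lambda>j. integral {a..b} (D j)) \<longlonglongrightarrow> integral {a..b} G"
    proof -
      have "uniform_limit (cbox a b) D G sequentially"
        using UL by (rule uniform_limit_on_subset) (use ab in auto)
      then obtain I J where "\<And>n. (D n has_integral I n) (cbox a b)" "(G has_integral J) (cbox a b)" "I \<longlonglongrightarrow> J"
        by (rule uniform_limit_integral_cbox[where f = D]) (use cont_D in auto)
      then show ?thesis by (metis LIMSEQ_unique cbox_interval ext integral_unique)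
    qed
    ultimately have "F b - F a = integral {a..b} G" by (rule LIMSEQ_unique)
    then show ?thesis by (simp add: F_def)
  qed
  then have "(LBINT t:{a..b}. f t) = (LBINT t:{a..b}. G t)" if "0 < a" "a < b" for a b
    using that f Gi by (simp add: set_borel_integral_eq_integral(2))
  then have "AE t in lborel. t > 0 \<longrightarrow> f t = G t"
    using f Gi by (intro AE_eq_on_pos_if_integrals_eq) auto
  with G show ?thesis using that by blast
qed

section \<open>Norm bounds, Cauchy-Schwarz and integration of functions of the Newtonian
  kernel\<close>

lemma ennpow_less_top_iff: "ennpow x a < \<infinity> \<longleftrightarrow> x < \<infinity>"
  by (simp add: ennpow_def less_top)

lemma ennpow_le_ennrealD:
  assumes "ennpow x a \<le> ennreal C" "0 < a" "0 \<le> C"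
  shows "x \<le> ennreal (C powr (1 / a))"
proof (cases x)
  case (real r)
  then have "r powr a \<le> C" using assms by (simp add: ennpow_def)
  then have "(r powr a) powr (1 / a) \<le> C powr (1 / a)"
    using assms by (intro powr_mono2) auto
  then show ?thesis using real assms by (simp add: powr_powr)
next
  case top
  then show ?thesis using assms by (simp add: ennpow_def top_unique)
qed

lemma Lp_norm_2_sq: "(Lp_norm 2 u)\<^sup>2 = (\<integral>\<^sup>+ x. ennreal ((u x)\<^sup>2) \<partial>lebesgue)"
proof -
  have "ennpow x (1 / 2) ^ 2 = x" for x
  proof (cases x)
    case (real r)
    then show ?thesis by (simp add: ennpow_def ennreal_power powr_half_sqrt)
  qed (simp add: ennpow_def)
  then show ?thesis
    by (simp add: Lp_norm_def)
qed

lemma H1_space_measurable: "u \<in> H1_space \<Longrightarrow> u \<in> borel_measurable lebesgue"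
  by (simp add: H1_space_def Lp_space_def)

lemma H1_space_weak_partial:
  assumes "u \<in> H1_space" "b \<in> Basis"
  shows "weak_partial b u \<in> Lp_space 2" "has_weak_partial b u (weak_partial b u)"
proof -
  have "\<exists>v. v \<in> Lp_space 2 \<and> has_weak_partial b u v"
    using assms by (auto simp: H1_space_def)
  from someI_ex[OF this] show "weak_partial b u \<in> Lp_space 2" "has_weak_partial b u (weak_partial b u)"
    by (auto simp: weak_partial_def)
qed

lemma H1_norm_leD:
  fixes u :: "'a::euclidean_space \<Rightarrow> real"
  assumes "H1_norm u \<le> ennreal K" "K \<ge> 0"
  shows "(\<integral>\<^sup>+ x. ennreal ((u x)\<^sup>2) \<partial>lebesgue) \<le> ennreal (K\<^sup>2)"
    and "b \<in> Basis \<Longrightarrow> (\<integral>\<^sup>+ x. ennreal ((weak_partial b u x)\<^sup>2) \<partial>lebesgue) \<le> ennreal (K\<^sup>2)"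
proof -
  have *: "(Lp_norm 2 u)\<^sup>2 + (\<Sum>b\<in>Basis. (Lp_norm 2 (weak_partial b u))\<^sup>2) \<le> ennreal (K\<^sup>2)"
    using ennpow_le_ennrealD[OF assms(1)[unfolded H1_norm_def]] assms(2) by simp
  have "(Lp_norm 2 u)\<^sup>2 \<le> (Lp_norm 2 u)\<^sup>2 + (\<Sum>b\<in>Basis. (Lp_norm 2 (weak_partial b u))\<^sup>2)"
    by simp
  from this * show "(\<integral>\<^sup>+ x. ennreal ((u x)\<^sup>2) \<partial>lebesgue) \<le> ennreal (K\<^sup>2)"
    unfolding Lp_norm_2_sq[symmetric] by (rule order_trans)
  assume "b \<in> Basis"
  then have "(Lp_norm 2 (weak_partial b u))\<^sup>2 \<le> (\<Sum>b\<in>Basis. (Lp_norm 2 (weak_partial b u))\<^sup>2)"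
    by (intro member_le_sum) auto
  also have "\<dots> \<le> (Lp_norm 2 u)\<^sup>2 + (\<Sum>b\<in>Basis. (Lp_norm 2 (weak_partial b u))\<^sup>2)"
    by simp
  finally show "(\<integral>\<^sup>+ x. ennreal ((weak_partial b u x)\<^sup>2) \<partial>lebesgue) \<le> ennreal (K\<^sup>2)"
    using * unfolding Lp_norm_2_sq[symmetric] by (rule order_trans)
qed

lemma integrable_locally_integrable_mult:
  fixes u \<phi> :: "'a::euclidean_space \<Rightarrow> real"
  assumes "locally_integrable u" "continuous_on UNIV \<phi>" "compact S" "\<And>x. x \<notin> S \<Longrightarrow> \<phi> x = 0"
  shows "integrable lebesgue (\<lambda>x. u x * \<phi> x)"
proof -
  have "compact (\<phi> ` S)"
    using assms by (intro compact_continuous_image) (auto intro: continuous_on_subset)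
  then obtain M where M: "\<And>x. x \<in> S \<Longrightarrow> \<bar>\<phi> x\<bar> \<le> M"
    using compact_imp_bounded bounded_iff by (metis image_eqI real_norm_def)
  have i: "integrable lebesgue (\<lambda>x. u x * indicator S x)"
    using assms(1,3) by (simp add: locally_integrable_def set_integrable_def mult.commute)
  have "\<phi> \<in> borel_measurable borel"
    using assms(2) by (rule borel_measurable_continuous_onI)
  then have m: "\<phi> \<in> borel_measurable lebesgue"
    by (simp add: measurable_completion)
  have "integrable lebesgue (\<lambda>x. (u x * indicator S x) * \<phi> x)"
  proof (rule Bochner_Integration.integrable_bound)
    show "integrable lebesgue (\<lambda>x. M * (u x * indicator S x))"
      using i by (rule integrable_mult_right)
    show "(\<lambda>x. u x * indicator S x * \<phi> x) \<in> borel_measurable lebesgue"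
      by (rule borel_measurable_times[OF borel_measurable_integrable[OF i] m])
    show "AE x in lebesgue. norm (u x * indicator S x * \<phi> x) \<le> norm (M * (u x * indicator S x))"
    proof (rule AE_I2)
      fix x
      show "norm (u x * indicator S x * \<phi> x) \<le> norm (M * (u x * indicator S x))"
      proof (cases "x \<in> S")
        case True
        then have "\<bar>u x\<bar> * \<bar>\<phi> x\<bar> \<le> \<bar>u x\<bar> * \<bar>M\<bar>" using M[of x] by (intro mult_left_mono) auto
        then show ?thesis using True by (simp add: abs_mult mult.commute)
      qed simp
    qed
  qed
  moreover have "(\<lambda>x. (u x * indicator S x) * \<phi> x) = (\<lambda>x. u x * \<phi> x)"
  proof
    show "(u x * indicator S x) * \<phi> x = u x * \<phi> x" for x
      using assms(4)[of x] by (cases "x \<in> S") auto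
  qed
  ultimately show ?thesis by simp
qed

lemma partial_deriv_test_function:
  assumes "test_function \<phi>" "b \<in> Basis"
  shows "continuous_on UNIV (partial_deriv b \<phi>)"
    and "x \<notin> closure {x. \<phi> x \<noteq> 0} \<Longrightarrow> partial_deriv b \<phi> x = 0"
proof -
  have "C_class (Suc 0) \<phi>" using assms by (simp add: test_function_def)
  then show "continuous_on UNIV (partial_deriv b \<phi>)" using assms(2) by simp
  assume x: "x \<notin> closure {x. \<phi> x \<noteq> 0}"
  have "((\<lambda>_. 0) has_derivative (\<lambda>_. 0)) (at x)" by simp
  then have "(\<phi> has_derivative (\<lambda>_. 0)) (at x)"
    by (rule has_derivative_transform_within_open[where s = "- closure {x. \<phi> x \<noteq> 0}"])
      (use x closure_subset[of "{x. \<phi> x \<noteq> 0}"] in auto)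
  then show "partial_deriv b \<phi> x = 0" by (rule partial_deriv_eqI)
qed

lemma test_function_continuous: "test_function \<phi> \<Longrightarrow> continuous_on UNIV \<phi>"
  by (metis C_class.simps(1) test_function_def)

lemma integral_mult_bound_L2:
  fixes f g :: "'a \<Rightarrow> real"
  assumes [measurable]: "f \<in> borel_measurable M" "g \<in> borel_measurable M"
    and f: "(\<integral>\<^sup>+ x. ennreal ((f x)\<^sup>2) \<partial>M) \<le> ennreal (A\<^sup>2)"
    and g: "(\<integral>\<^sup>+ x. ennreal ((g x)\<^sup>2) \<partial>M) \<le> ennreal (B\<^sup>2)"
    and "A \<ge> 0" "B \<ge> 0"
  shows "\<bar>\<integral>x. f x * g x \<partial>M\<bar> \<le> A * B"
proof (cases "integrable M (\<lambda>x. f x * g x)")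
  case True
  have "(ennreal \<bar>\<integral>x. f x * g x \<partial>M\<bar>)\<^sup>2 \<le> (\<integral>\<^sup>+ x. ennreal \<bar>f x\<bar> * ennreal \<bar>g x\<bar> \<partial>M)\<^sup>2"
    using integral_norm_bound_ennreal[OF True]
    by (intro power_mono) (auto simp: abs_mult ennreal_mult)
  also have "\<dots> \<le> (\<integral>\<^sup>+x. ennreal \<bar>f x\<bar> ^ 2 \<partial>M) * (\<integral>\<^sup>+x. ennreal \<bar>g x\<bar> ^ 2 \<partial>M)"
    by (rule Cauchy_Schwarz_nn_integral) auto
  also have "\<dots> \<le> ennreal (A\<^sup>2) * ennreal (B\<^sup>2)"
    using f g by (intro mult_mono) (auto simp: ennreal_power)
  finally have "ennreal (\<bar>\<integral>x. f x * g x \<partial>M\<bar>\<^sup>2) \<le> ennreal ((A * B)\<^sup>2)"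
    by (simp add: ennreal_power ennreal_mult[symmetric] power_mult_distrib)
  then have "\<bar>\<integral>x. f x * g x \<partial>M\<bar>\<^sup>2 \<le> (A * B)\<^sup>2"
    by (subst (asm) ennreal_le_iff) auto
  then show ?thesis using assms(5,6) by (auto intro: power2_le_imp_le)
\<comment> \<open>Without integrability of the product its Bochner integral is 0 by
  convention.\<close>
qed (use assms in \<open>simp add: not_integrable_integral_eq\<close>)

lemma nn_integral_newton:
  fixes f :: "real \<Rightarrow> ennreal"
  assumes N: "DIM('a::euclidean_space) \<ge> 3" and [measurable]: "f \<in> borel_measurable borel"
  shows "(\<integral>\<^sup>+ (x::'a). f (newton x) \<partial>lborel) =
    (\<integral>\<^sup>+ t. ennreal (newton_const TYPE('a) * t powr (- newton_exp TYPE('a))) * indicator {0<..} t * f t \<partial>lborel)"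
proof -
  have "(\<integral>\<^sup>+ (x::'a). f (newton x) \<partial>lborel) = (\<integral>\<^sup>+ t. f t \<partial>distr lborel borel (newton :: 'a \<Rightarrow> real))"
    by (subst nn_integral_distr) auto
  also have "\<dots> = (\<integral>\<^sup>+ t. ennreal (newton_const TYPE('a) * t powr (- newton_exp TYPE('a))) * indicator {0<..} t * f t \<partial>lborel)"
    unfolding distr_newton[OF N] by (subst nn_integral_density) auto
  finally show ?thesis .
qed

lemma newton_const_pos: "DIM('a::euclidean_space) \<ge> 3 \<Longrightarrow> newton_const TYPE('a) > 0"
  by (simp add: newton_const_def)

lemma integral_newton:
  fixes f :: "real \<Rightarrow> real"
  assumes N: "DIM('a::euclidean_space) \<ge> 3" and [measurable]: "f \<in> borel_measurable borel"
  shows "(\<integral> (x::'a). f (newton x) \<partial>lborel) =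
    (\<integral> t. newton_const TYPE('a) * t powr (- newton_exp TYPE('a)) * indicator {0<..} t * f t \<partial>lborel)"
proof -
  have [simp]: "newton_const TYPE('a) \<ge> 0" using newton_const_pos[OF N] by simp
  have "(\<integral> (x::'a). f (newton x) \<partial>lborel) = (\<integral> t. f t \<partial>distr lborel borel (newton :: 'a \<Rightarrow> real))"
    by (subst integral_distr) auto
  also have "distr lborel borel (newton :: 'a \<Rightarrow> real) =
      density lborel (\<lambda>t. ennreal (newton_const TYPE('a) * t powr (- newton_exp TYPE('a)) * indicator {0<..} t))"
    unfolding distr_newton[OF N] by (intro density_cong) (auto simp: indicator_def)
  also have "(\<integral> t. f t \<partial>\<dots>) =
      (\<integral> t. newton_const TYPE('a) * t powr (- newton_exp TYPE('a)) * indicator {0<..} t * f t \<partial>lborel)"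
    by (subst integral_density) auto
  finally show ?thesis .
qed

text \<open>Null sets of the half line pull back to null sets, since the image measure has a
  density.\<close>

lemma AE_newton:
  assumes N: "DIM('a::euclidean_space) \<ge> 3" and P: "AE t in lborel. t > 0 \<longrightarrow> P t"
  shows "AE x::'a in lborel. P (newton x)"
proof -
  have "AE t in distr lborel borel (newton :: 'a \<Rightarrow> real). P t"
    unfolding distr_newton[OF N]
    by (subst AE_density) (use P in \<open>auto elim!: eventually_mono simp: indicator_def split: if_splits\<close>)
  then show ?thesis by (rule AE_distrD[rotated]) simp
qed

lemma norm_powr_eq_newton_powr:
  fixes x :: "'a::euclidean_space"
  assumes "DIM('a) \<ge> 3"
  shows "norm x powr (2 - 2 * real DIM('a)) = newton x powr newton_exp TYPE('a)"
proof -
  have "(2 - real DIM('a)) * newton_exp TYPE('a) = 2 - 2 * real DIM('a)"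
    using assms by (simp add: newton_exp_def field_simps)
  then show ?thesis by (simp add: newton_def powr_powr)
qed


section \<open>Radial Sobolev functions\<close>

lemma newton_square: "x \<noteq> 0 \<Longrightarrow> (x \<bullet> x) powr (1 - real DIM('a) / 2) = newton (x::'a::euclidean_space)"
proof -
  have "x \<bullet> x = norm x powr 2" by (simp add: dot_square_norm)
  then show ?thesis by (simp only: powr_powr newton_def) (simp add: algebra_simps)
qed

text \<open>Each component of the field is at most |x|^(1-N) |X(\<tau>)|, whose square is
  newton(x)^\<gamma> X^2. In the variable \<tau> the density removes the power, leaving a constant
  times the integral of X^2 over the support. The square root of the support length obtained here is
  what becomes the Hoelder exponent 1/2.\<close>

lemma radial_field_L2_bound:
  fixes b :: "'a::euclidean_space"
  assumes N: "DIM('a) \<ge> 3" and \<alpha>\<beta>: "0 < \<alpha>" "\<alpha> \<le> \<beta>" and b: "b \<in> Basis"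
    and X: "continuous_on UNIV X" "\<And>s. s \<notin> {\<alpha>..\<beta>} \<Longrightarrow> X s = 0" "\<And>s. \<bar>X s\<bar> \<le> 1"
  shows "(\<integral>\<^sup>+ x. ennreal (((x \<bullet> b) * radial_profile (real DIM('a)) X (x \<bullet> x))\<^sup>2) \<partial>lebesgue)
    \<le> ennreal (newton_const TYPE('a) * (\<beta> - \<alpha>))"
proof -
  let ?m = "real DIM('a)" and ?\<gamma> = "newton_exp TYPE('a)" and ?c = "newton_const TYPE('a)"
  have [measurable]: "X \<in> borel_measurable borel"
    using X(1) by (rule borel_measurable_continuous_onI)
  have c: "?c > 0" by (rule newton_const_pos[OF N])
  have pw: "((x \<bullet> b) * radial_profile ?m X (x \<bullet> x))\<^sup>2 \<le> newton x powr ?\<gamma> * (X (newton x))\<^sup>2" for x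
  proof (cases "x = 0")
    case False
    then have x: "norm x > 0" by simp
    have "\<bar>x \<bullet> b\<bar> \<le> norm x" using Cauchy_Schwarz_ineq2[of x b] b by simp
    then have "(x \<bullet> b)\<^sup>2 \<le> (norm x)\<^sup>2" by (simp add: abs_le_square_iff[symmetric])
    then have "(x \<bullet> b)\<^sup>2 * ((norm x powr (- ?m))\<^sup>2 * (X (newton x))\<^sup>2) \<le>
        (norm x)\<^sup>2 * ((norm x powr (- ?m))\<^sup>2 * (X (newton x))\<^sup>2)"
      by (intro mult_right_mono) auto
    moreover have "(norm x)\<^sup>2 * (norm x powr (- ?m))\<^sup>2 = norm x powr (2 - 2 * ?m)"
    proof -
      have "norm x powr 2 * (norm x powr (- ?m) * norm x powr (- ?m)) = norm x powr (2 - 2 * ?m)"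
        unfolding powr_add[symmetric] by (simp add: algebra_simps)
      then show ?thesis using x by (simp add: power2_eq_square)
    qed
    moreover have "radial_profile ?m X (x \<bullet> x) = norm x powr (- ?m) * X (newton x)"
    proof -
      have "x \<bullet> x = norm x powr 2" using x by (simp add: dot_square_norm)
      then have "(x \<bullet> x) powr (- ?m / 2) = norm x powr (- ?m)"
        by (simp only: powr_powr) simp
      then show ?thesis using False by (simp add: radial_profile_def newton_square)
    qed
    ultimately show ?thesis
      by (simp add: norm_powr_eq_newton_powr[OF N, symmetric] power_mult_distrib mult.assoc)
        (simp add: mult.assoc[symmetric])
  qed simp
  have "(\<integral>\<^sup>+ x. ennreal (((x \<bullet> b) * radial_profile ?m X (x \<bullet> x))\<^sup>2) \<partial>lebesgue)
      \<le> (\<integral>\<^sup>+ (x::'a). ennreal (newton x powr ?\<gamma> * (X (newton x))\<^sup>2) \<partial>lborel)"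
    unfolding nn_integral_completion using pw by (intro nn_integral_mono ennreal_leI)
  also have "\<dots> = (\<integral>\<^sup>+ t. ennreal (?c * t powr (- ?\<gamma>)) * indicator {0<..} t * ennreal (t powr ?\<gamma> * (X t)\<^sup>2) \<partial>lborel)"
    by (rule nn_integral_newton[OF N]) measurable
  also have "\<dots> \<le> (\<integral>\<^sup>+ t. ennreal ?c * indicator {\<alpha>..\<beta>} t \<partial>lborel)"
  proof (rule nn_integral_mono)
    fix t :: real
    show "ennreal (?c * t powr (- ?\<gamma>)) * indicator {0<..} t * ennreal (t powr ?\<gamma> * (X t)\<^sup>2)
        \<le> ennreal ?c * indicator {\<alpha>..\<beta>} t"
    proof (cases "t \<in> {\<alpha>..\<beta>}")
      case True
      then have t: "t > 0" using \<alpha>\<beta> by simp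
      have "(X t)\<^sup>2 \<le> 1" using X(3)[of t] by (simp add: abs_square_le_1)
      then have "?c * (X t)\<^sup>2 \<le> ?c" using c by simp
      moreover have "?c * t powr (- ?\<gamma>) * (t powr ?\<gamma> * (X t)\<^sup>2) = ?c * (X t)\<^sup>2"
        using t by (simp add: powr_minus field_simps)
      ultimately have "ennreal (?c * t powr (- ?\<gamma>) * (t powr ?\<gamma> * (X t)\<^sup>2)) \<le> ennreal ?c"
        by (simp only: ennreal_leI)
      then show ?thesis
        using True t c by (subst (asm) ennreal_mult) auto
    next
      case False
      then show ?thesis using X(2) by simp
    qed
  qed
  also have "\<dots> = ennreal (?c * (\<beta> - \<alpha>))"
    using \<alpha>\<beta> c by (simp add: nn_integral_cmult_indicator ennreal_mult)
  finally show ?thesis .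
qed

text \<open>With N the dimension and c = \<open>newton_const\<close>: each of the N coordinates
  contributes K sqrt(c (\<beta> - \<alpha>)), and the divergence identity carries the factor (N-2)
  c. Dividing the sum of the contributions by this factor gives the constant.\<close>

definition hoelder_const :: "'a::euclidean_space itself \<Rightarrow> real" where
  "hoelder_const _ = real DIM('a) / ((real DIM('a) - 2) * sqrt (newton_const TYPE('a)))"

context
  fixes u :: "'a::euclidean_space \<Rightarrow> real" and \<kappa> :: "real \<Rightarrow> real" and K :: real
  assumes N: "DIM('a) \<ge> 3" and u: "u \<in> H1_space" and K: "H1_norm u \<le> ennreal K" "K \<ge> 0"
    and \<kappa> [measurable]: "\<kappa> \<in> borel_measurable borel"
    and u_eq: "AE x in lborel. u x = \<kappa> (newton x)"
begin

text \<open>Adding the weak identities over all coordinates turns the partial derivatives into the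
  divergence of the field. Its weight newton^\<gamma> cancels the density, so a one-dimensional
  integral with respect to Lebesgue measure remains. The other side is bounded coordinatewise by
  Cauchy-Schwarz.\<close>

lemma profile_weak_derivative_bound:
  assumes \<alpha>\<beta>: "0 < \<alpha>" "\<alpha> \<le> \<beta>"
    and X: "\<And>k. C_class_on k UNIV X" "\<And>s. s \<notin> {\<alpha>..\<beta>} \<Longrightarrow> X s = 0" "\<And>s. \<bar>X s\<bar> \<le> 1"
    and X': "\<And>s. (X has_real_derivative X' s) (at s)" "continuous_on UNIV X'"
  shows "\<bar>\<integral>t. indicator {0<..} t * (\<kappa> t * X' t) \<partial>lborel\<bar> \<le> hoelder_const TYPE('a) * K * sqrt (\<beta> - \<alpha>)"
proof -
  let ?m = "real DIM('a)" and ?\<gamma> = "newton_exp TYPE('a)" and ?c = "newton_const TYPE('a)"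
  let ?I = "\<integral>t. indicator {0<..} t * (\<kappa> t * X' t) \<partial>lborel"
  define \<phi> where "\<phi> b x = (x \<bullet> b) * radial_profile ?m X (x \<bullet> x)" for b x :: 'a
  have m: "?m > 2" using N by simp
  have c: "?c > 0" by (rule newton_const_pos[OF N])
  have [measurable]: "X' \<in> borel_measurable borel"
    using X'(2) by (rule borel_measurable_continuous_onI)
  have test: "test_function (\<phi> b)" for b
    unfolding \<phi>_def[abs_def] by (rule test_function_radial_field[OF m \<alpha>\<beta> X(1,2)])
  have weak: "(\<integral>x. u x * partial_deriv b (\<phi> b) x \<partial>lebesgue) = - (\<integral>x. weak_partial b u x * \<phi> b x \<partial>lebesgue)"
    if "b \<in> Basis" for b
    using H1_space_weak_partial(2)[OF u that] test by (simp add: has_weak_partial_def)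
  have bound: "\<bar>\<integral>x. weak_partial b u x * \<phi> b x \<partial>lebesgue\<bar> \<le> K * sqrt (?c * (\<beta> - \<alpha>))" if b: "b \<in> Basis" for b
  proof (rule integral_mult_bound_L2)
    show "weak_partial b u \<in> borel_measurable lebesgue"
      using H1_space_weak_partial(1)[OF u b] by (simp add: Lp_space_def)
    show "\<phi> b \<in> borel_measurable lebesgue"
      using borel_measurable_continuous_onI[OF test_function_continuous[OF test[of b]]]
      by (simp add: measurable_completion)
    show "(\<integral>\<^sup>+ x. ennreal ((weak_partial b u x)\<^sup>2) \<partial>lebesgue) \<le> ennreal (K\<^sup>2)"
      by (rule H1_norm_leD(2)[OF K b])
    have "continuous_on UNIV X" using X(1)[of 0] by simp
    then show "(\<integral>\<^sup>+ x. ennreal ((\<phi> b x)\<^sup>2) \<partial>lebesgue) \<le> ennreal ((sqrt (?c * (\<beta> - \<alpha>)))\<^sup>2)"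
      using radial_field_L2_bound[OF N \<alpha>\<beta> b _ X(2,3)] c \<alpha>\<beta> by (simp add: \<phi>_def)
  qed (use K c \<alpha>\<beta> in auto)
  have loc: "locally_integrable u"
  proof -
    obtain b :: 'a where "b \<in> Basis" using nonempty_Basis by blast
    then show ?thesis using H1_space_weak_partial(2)[OF u] by (auto simp: has_weak_partial_def)
  qed
  have int: "integrable lebesgue (\<lambda>x. u x * partial_deriv b (\<phi> b) x)" if "b \<in> Basis" for b
    using partial_deriv_test_function[OF test that] test[of b]
    by (intro integrable_locally_integrable_mult[OF loc, where S = "closure {x. \<phi> b x \<noteq> 0}"])
      (auto simp: test_function_def)
  have "(\<Sum>b\<in>Basis. \<integral>x. u x * partial_deriv b (\<phi> b) x \<partial>lebesgue)
      = (\<integral>x. (\<Sum>b\<in>Basis. u x * partial_deriv b (\<phi> b) x) \<partial>lebesgue)"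
    using int by (simp add: Bochner_Integration.integral_sum)
  also have "\<dots> = (\<integral>x. u x * ((2 - ?m) * newton x powr ?\<gamma> * X' (newton x)) \<partial>lebesgue)"
    unfolding sum_distrib_left[symmetric] \<phi>_def[abs_def]
    by (subst sum_partial_radial_field[OF m \<alpha>\<beta> X(1,2) refl X'(1)])
      (simp_all add: norm_powr_eq_newton_powr[OF N] newton_def[symmetric])
  also have "\<dots> = (\<integral>(x::'a). \<kappa> (newton x) * ((2 - ?m) * newton x powr ?\<gamma> * X' (newton x)) \<partial>lebesgue)"
  proof (rule integral_cong_AE)
    show "(\<lambda>x. u x * ((2 - ?m) * newton x powr ?\<gamma> * X' (newton x))) \<in> borel_measurable lebesgue"
      using H1_space_measurable[OF u]
      by (rule borel_measurable_times) (intro measurable_completion, measurable)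
    show "(\<lambda>x::'a. \<kappa> (newton x) * ((2 - ?m) * newton x powr ?\<gamma> * X' (newton x))) \<in> borel_measurable lebesgue"
      by (intro measurable_completion) measurable
    show "AE x in lebesgue. u x * ((2 - ?m) * newton x powr ?\<gamma> * X' (newton x)) =
        \<kappa> (newton x) * ((2 - ?m) * newton x powr ?\<gamma> * X' (newton x))"
      by (rule AE_completion, rule eventually_mono[OF u_eq]) simp
  qed
  also have "\<dots> = (\<integral>(x::'a). \<kappa> (newton x) * ((2 - ?m) * newton x powr ?\<gamma> * X' (newton x)) \<partial>lborel)"
    by (rule integral_completion) measurable
  also have "\<dots> = (\<integral>t. ?c * t powr (- ?\<gamma>) * indicator {0<..} t * (\<kappa> t * ((2 - ?m) * t powr ?\<gamma> * X' t)) \<partial>lborel)"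
    by (rule integral_newton[OF N]) measurable
  also have "\<dots> = (\<integral>t. (2 - ?m) * ?c * (indicator {0<..} t * (\<kappa> t * X' t)) \<partial>lborel)"
    by (intro Bochner_Integration.integral_cong) (auto simp: indicator_def powr_minus field_simps)
  also have "\<dots> = (2 - ?m) * ?c * ?I" by simp
  finally have eq: "(2 - ?m) * ?c * ?I = - (\<Sum>b\<in>Basis. \<integral>x. weak_partial b u x * \<phi> b x \<partial>lebesgue)"
    using weak by (simp add: sum_negf)
  have "(?m - 2) * ?c * \<bar>?I\<bar> = \<bar>(2 - ?m) * ?c * ?I\<bar>"
    using m c by (simp add: abs_mult)
  also have "\<dots> \<le> (\<Sum>b\<in>(Basis::'a set). \<bar>\<integral>x. weak_partial b u x * \<phi> b x \<partial>lebesgue\<bar>)"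
    unfolding eq by (simp add: sum_abs)
  also have "\<dots> \<le> (\<Sum>b\<in>(Basis::'a set). K * sqrt (?c * (\<beta> - \<alpha>)))"
    by (rule sum_mono) (rule bound)
  also have "\<dots> = ?m * (K * sqrt (?c * (\<beta> - \<alpha>)))" by simp
  finally have "\<bar>?I\<bar> \<le> ?m * (K * sqrt (?c * (\<beta> - \<alpha>))) / ((?m - 2) * ?c)"
    using m c by (subst pos_le_divide_eq) (auto simp: mult_ac)
  also have "\<dots> = hoelder_const TYPE('a) * K * sqrt (\<beta> - \<alpha>)"
  proof -
    have "?m * (K * (r * s)) / ((?m - 2) * (r * r)) = ?m / ((?m - 2) * r) * K * s" if "r > 0" for r s
      using m that by (simp add: divide_simps)
    from this[of "sqrt ?c"]
    have "?m * (K * (sqrt ?c * s)) / ((?m - 2) * ?c) = ?m / ((?m - 2) * sqrt ?c) * K * s" for s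
      using c by simp
    then show ?thesis by (simp add: hoelder_const_def real_sqrt_mult)
  qed
  finally show ?thesis .
qed

text \<open>On a compact interval in the positive half line the density is bounded below by its
  value at \<open>b\<close>, so square integrability of \<open>u\<close> passes to \<kappa>; then
  |\<kappa>| \<le> 1 + \<kappa>^2.\<close>

lemma profile_set_integrable:
  assumes ab: "0 < a" "a < b"
  shows "set_integrable lborel {a..b} \<kappa>"
proof -
  let ?\<gamma> = "newton_exp TYPE('a)" and ?c = "newton_const TYPE('a)"
  have c: "?c > 0" by (rule newton_const_pos[OF N])
  have \<gamma>: "?\<gamma> > 0" using N by (simp add: newton_exp_def)
  let ?w = "?c * b powr (- ?\<gamma>)"
  have w: "?w > 0" using c ab by simp
  have "(\<integral>\<^sup>+ x. ennreal ((u x)\<^sup>2) \<partial>lebesgue) = (\<integral>\<^sup>+ (x::'a). ennreal ((\<kappa> (newton x))\<^sup>2) \<partial>lborel)"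
    unfolding nn_integral_completion using u_eq by (intro nn_integral_cong_AE) auto
  also have "\<dots> = (\<integral>\<^sup>+ t. ennreal (?c * t powr (- ?\<gamma>)) * indicator {0<..} t * ennreal ((\<kappa> t)\<^sup>2) \<partial>lborel)"
    by (rule nn_integral_newton[OF N]) measurable
  also have "\<dots> \<ge> (\<integral>\<^sup>+ t. ennreal ?w * (ennreal ((\<kappa> t)\<^sup>2) * indicator {a..b} t) \<partial>lborel)"
  proof (rule nn_integral_mono)
    fix t :: real
    show "ennreal ?w * (ennreal ((\<kappa> t)\<^sup>2) * indicator {a..b} t) \<le>
        ennreal (?c * t powr (- ?\<gamma>)) * indicator {0<..} t * ennreal ((\<kappa> t)\<^sup>2)"
    proof (cases "t \<in> {a..b}")
      case True
      then have "b powr (- ?\<gamma>) \<le> t powr (- ?\<gamma>)"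
        using ab \<gamma> by (intro powr_mono2') auto
      then have "ennreal ?w \<le> ennreal (?c * t powr (- ?\<gamma>))"
        using c by (intro ennreal_leI) auto
      then show ?thesis using True ab by (auto intro!: mult_right_mono)
    qed auto
  qed
  finally have "ennreal ?w * (\<integral>\<^sup>+ t. ennreal ((\<kappa> t)\<^sup>2) * indicator {a..b} t \<partial>lborel) \<le> ennreal (K\<^sup>2)"
    using H1_norm_leD(1)[OF K] by (subst (asm) nn_integral_cmult) (auto intro: order_trans)
  then have "ennreal ?w * (\<integral>\<^sup>+ t. ennreal ((\<kappa> t)\<^sup>2) * indicator {a..b} t \<partial>lborel) < \<infinity>"
    by (rule le_less_trans) simp
  then have fin: "(\<integral>\<^sup>+ t. ennreal ((\<kappa> t)\<^sup>2) * indicator {a..b} t \<partial>lborel) < \<infinity>"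
    using w by (auto simp: ennreal_mult_less_top)
  have "integrable lborel (\<lambda>t. indicator {a..b} t *\<^sub>R \<kappa> t)"
  proof (rule integrableI_bounded)
    have "(\<integral>\<^sup>+ t. ennreal (norm (indicator {a..b} t *\<^sub>R \<kappa> t)) \<partial>lborel)
        \<le> (\<integral>\<^sup>+ t. indicator {a..b} t + ennreal ((\<kappa> t)\<^sup>2) * indicator {a..b} t \<partial>lborel)"
    proof (rule nn_integral_mono)
      fix t :: real
      have "\<bar>\<kappa> t\<bar> \<le> 1 + (\<kappa> t)\<^sup>2"
        using sum_squares_ge_zero[of "\<bar>\<kappa> t\<bar> - 1" 0] power2_diff[of "\<bar>\<kappa> t\<bar>" 1]
        by (simp add: power2_eq_square[symmetric])
      then have "ennreal \<bar>\<kappa> t\<bar> \<le> 1 + ennreal ((\<kappa> t)\<^sup>2)"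
        using ennreal_leI by (fastforce simp flip: ennreal_plus ennreal_1)
      then show "ennreal (norm (indicator {a..b} t *\<^sub>R \<kappa> t)) \<le>
          indicator {a..b} t + ennreal ((\<kappa> t)\<^sup>2) * indicator {a..b} t"
        by (auto simp: indicator_def)
    qed
    also have "\<dots> < \<infinity>"
      using fin ab by (subst nn_integral_add) auto
    finally show "(\<integral>\<^sup>+ t. ennreal (norm (indicator {a..b} t *\<^sub>R \<kappa> t)) \<partial>lborel) < \<infinity>" .
  qed measurable
  then show ?thesis by (simp add: set_integrable_def)
qed

text \<open>The test functions \<open>X n\<close> approximate the trapezoid with slopes \<open>1/h\<close> on \<open>[a, a+h]\<close> and \<open>-1/h\<close>
  on \<open>[b, b+h]\<close>.\<close>

lemma profile_oscillation:
  assumes ab: "0 < a" "a \<le> b" and h: "0 < h"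
  shows "\<bar>(LBINT t:{a..a+h}. \<kappa> t) - (LBINT t:{b..b+h}. \<kappa> t)\<bar>
    \<le> hoelder_const TYPE('a) * K * h * sqrt (b - a + h)"
proof -
  define f where "f n s = 1 / h * (flat_exp 0 (real (Suc n) * (s - a)) * flat_exp 0 (real (Suc n) * (a + h - s)))" for n s
  have "\<exists>F. (\<forall>k. C_class_on k UNIV F) \<and> (\<forall>s. (F has_real_derivative f n s) (at s)) \<and> (\<forall>s. 0 \<le> F s \<and> F s \<le> 1) \<and>
      (\<forall>s\<le>a. F s = 0) \<and> (\<forall>s\<ge>a + h. F s = F (a + h))" for n
    using smooth_step_exists[OF h, of "real (Suc n)" a] unfolding f_def by (metis of_nat_0_less_iff zero_less_Suc)
  then obtain F where F: "\<And>n k. C_class_on k UNIV (F n)" "\<And>n s. (F n has_real_derivative f n s) (at s)"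
      "\<And>n s. 0 \<le> F n s" "\<And>n s. F n s \<le> 1" "\<And>n s. s \<le> a \<Longrightarrow> F n s = 0"
      "\<And>n s. a + h \<le> s \<Longrightarrow> F n s = F n (a + h)"
    by metis
  \<comment> \<open>A step minus its translate by \<open>b - a\<close>. Beyond \<open>b + h\<close>
    both have reached the same constant \<open>F n (a + h)\<close>, so the difference has compact
    support, whatever the height of the step and even if the two ramps overlap.\<close>
  define X where "X n s = F n s + (- 1) * F n (s - (b - a))" for n s
  define X' where "X' n s = f n s - f n (s - (b - a))" for n s
  have flat01: "0 \<le> flat_exp 0 t" "flat_exp 0 t \<le> 1" for t
    by (auto simp: flat_exp_def)
  have flat_exp_cont: "continuous_on UNIV (flat_exp 0)"
    using C_class_on_flat[of 0 0] by simp
  have f_cont: "continuous_on UNIV (f n)" for n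
    unfolding f_def by (intro continuous_intros continuous_on_compose2[OF flat_exp_cont]) auto
  have X'_cont: "continuous_on UNIV (X' n)" for n
    unfolding X'_def by (intro continuous_intros continuous_on_compose2[OF f_cont]) auto
  have f_bound: "\<bar>f n s\<bar> \<le> 1 / h" for n s
    using h mult_le_one[OF flat01(2) flat01(1) flat01(2)]
    by (auto simp: f_def abs_mult flat01 intro!: divide_right_mono)
  have f_0: "f n s = 0" if "s \<notin> {a..a+h}" for n s
  proof -
    have "real (Suc n) * (s - a) \<le> 0 \<or> real (Suc n) * (a + h - s) \<le> 0"
      using that by (auto simp: mult_le_0_iff)
    then show ?thesis by (auto simp: f_def flat_exp_def)
  qed
  have X_bound: "\<bar>\<integral>t. indicator {0<..} t * (\<kappa> t * X' n t) \<partial>lborel\<bar>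
      \<le> hoelder_const TYPE('a) * K * sqrt (b + h - a)" for n
  proof (rule profile_weak_derivative_bound)
    show "C_class_on k UNIV (X n)" for k
      unfolding X_def
    proof (intro C_class_on_add C_class_on_mult C_class_on_const open_UNIV F(1))
      show "C_class_on k UNIV (\<lambda>s. F n (s - (b - a)))"
      proof (rule C_class_on_compose[OF open_UNIV open_UNIV _ _ F(1)])
        show "C_class_on k UNIV (\<lambda>s. s - (b - a))"
          using C_class_on_affine[of k 1 "- (b - a)"] by (simp only: mult_1 diff_conv_add_uminus)
      qed simp
    qed
    show "X n s = 0" if "s \<notin> {a..b+h}" for s
    proof (cases "s < a")
      case True
      then show ?thesis using F(5)[of s n] F(5)[of "s - (b - a)" n] ab by (simp add: X_def)
    next
      case False
      then have "b + h < s" using that by auto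
      then show ?thesis using F(6)[of s n] F(6)[of "s - (b - a)" n] ab by (simp add: X_def)
    qed
    show "\<bar>X n s\<bar> \<le> 1" for s
      using F(3,4)[of n s] F(3,4)[of n "s - (b - a)"] by (simp add: X_def)
    show "(X n has_real_derivative X' n s) (at s)" for s
    proof -
      have "((\<lambda>s. F n (s - (b - a))) has_real_derivative f n (s - (b - a)) * 1) (at s)"
        by (rule DERIV_chain2[OF F(2)]) (auto intro!: derivative_eq_intros)
      then show ?thesis
        unfolding X_def[abs_def] X'_def using F(2)[of n s] by (auto intro!: derivative_eq_intros)
    qed
  qed (use ab h X'_cont in auto)
  let ?ind = "\<lambda>t. indicator {a<..<a+h} t - indicator {b<..<b+h} t :: real"
  have \<kappa>i: "integrable lborel (\<lambda>t. indicator {c..d} t * \<kappa> t)" if "0 < c" "c < d" for c d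
    using profile_set_integrable[OF that] by (simp add: set_integrable_def)
  have f_lim: "(\<lambda>n. f n s) \<longlonglongrightarrow> indicator {a<..<a+h} s / h" for s
  proof -
    have "(\<lambda>n. f n s) \<longlonglongrightarrow> 1 / h * ((if s - a > 0 then 1 else 0) * (if a + h - s > 0 then 1 else 0))"
      unfolding f_def by (intro tendsto_intros flat_exp_0_scaled_tendsto)
    then show ?thesis by (simp add: indicator_def of_bool_def if_distrib cong: if_cong split: if_splits)
  qed
  have lim: "(\<lambda>n. \<integral>t. indicator {0<..} t * (\<kappa> t * X' n t) \<partial>lborel)
      \<longlonglongrightarrow> (\<integral>t. indicator {0<..} t * (\<kappa> t * (?ind t / h)) \<partial>lborel)"
  proof (rule integral_dominated_convergence[where w = "\<lambda>t. 2 / h * \<bar>indicator {a..b+h} t * \<kappa> t\<bar>"])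
    have [measurable]: "X' n \<in> borel_measurable borel" for n
      using X'_cont by (rule borel_measurable_continuous_onI)
    show "(\<lambda>t. indicator {0<..} t * (\<kappa> t * X' n t)) \<in> borel_measurable lborel" for n
      by measurable
    show "(\<lambda>t. indicator {0<..} t * (\<kappa> t * (?ind t / h))) \<in> borel_measurable lborel"
      by measurable
    show "integrable lborel (\<lambda>t. 2 / h * \<bar>indicator {a..b+h} t * \<kappa> t\<bar>)"
      using \<kappa>i[of a "b + h"] ab h by (intro integrable_mult_right integrable_abs) auto
    show "AE t in lborel. (\<lambda>n. indicator {0<..} t * (\<kappa> t * X' n t)) \<longlonglongrightarrow> indicator {0<..} t * (\<kappa> t * (?ind t / h))"
    proof (intro AE_I2)
      fix t
      have "indicator {a<..<a+h} (t - (b - a)) = (indicator {b<..<b+h} t :: real)"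
        by (auto simp: indicator_def)
      then have "(\<lambda>n. X' n t) \<longlonglongrightarrow> indicator {a<..<a+h} t / h - indicator {b<..<b+h} t / h"
        unfolding X'_def using tendsto_diff[OF f_lim[of t] f_lim[of "t - (b - a)"]] by simp
      then show "(\<lambda>n. indicator {0<..} t * (\<kappa> t * X' n t)) \<longlonglongrightarrow> indicator {0<..} t * (\<kappa> t * (?ind t / h))"
        by (intro tendsto_intros) (simp add: diff_divide_distrib)
    qed
    show "AE t in lborel. norm (indicator {0<..} t * (\<kappa> t * X' n t)) \<le> 2 / h * \<bar>indicator {a..b+h} t * \<kappa> t\<bar>" for n
    proof (intro AE_I2)
      fix t
      show "norm (indicator {0<..} t * (\<kappa> t * X' n t)) \<le> 2 / h * \<bar>indicator {a..b+h} t * \<kappa> t\<bar>"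
      proof (cases "t \<in> {a..b+h}")
        case True
        have "\<bar>X' n t\<bar> \<le> 2 / h"
          using f_bound[of n t] f_bound[of n "t - (b - a)"] by (simp add: X'_def)
        then have "\<bar>\<kappa> t\<bar> * \<bar>X' n t\<bar> \<le> \<bar>\<kappa> t\<bar> * (2 / h)" by (intro mult_left_mono) auto
        then show ?thesis using True ab by (simp add: abs_mult mult.commute)
      next
        case False
        then have "X' n t = 0" using f_0[of t n] f_0[of "t - (b - a)" n] ab by (auto simp: X'_def)
        then show ?thesis using False h by simp
      qed
    qed
  qed
  have "(\<integral>t. indicator {0<..} t * (\<kappa> t * (?ind t / h)) \<partial>lborel)
      = (\<integral>t. 1 / h * (indicator {a..a+h} t * \<kappa> t - indicator {b..b+h} t * \<kappa> t) \<partial>lborel)"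
  proof (rule integral_cong_AE)
    \<comment> \<open>The limit slopes live on open intervals, the averages on closed ones; they
      differ only in these four points.\<close>
    have "AE t in lborel. t \<notin> {a, a + h, b, b + h}"
      by (rule AE_not_in) (intro finite_imp_null_set_lborel, simp)
    then show "AE t in lborel. indicator {0<..} t * (\<kappa> t * (?ind t / h))
        = 1 / h * (indicator {a..a+h} t * \<kappa> t - indicator {b..b+h} t * \<kappa> t)"
    proof eventually_elim
      case (elim t)
      then have 1: "indicator {a..a+h} t = (indicator {a<..<a+h} t :: real)"
          "indicator {b..b+h} t = (indicator {b<..<b+h} t :: real)"
        by (auto simp: indicator_def)
      have "indicator {0<..} t * ?ind t = ?ind t"
        using ab by (auto simp: indicator_def)
      then have "indicator {0<..} t * (\<kappa> t * (?ind t / h)) = ?ind t * (\<kappa> t / h)"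
        by (metis (no_types, lifting) mult.commute mult.left_commute times_divide_eq_right)
      also have "\<dots> = 1 / h * (indicator {a..a+h} t * \<kappa> t - indicator {b..b+h} t * \<kappa> t)"
        unfolding 1 by (simp add: left_diff_distrib diff_divide_distrib)
      finally show ?case .
    qed
  qed measurable
  also have "\<dots> = 1 / h * ((LBINT t:{a..a+h}. \<kappa> t) - (LBINT t:{b..b+h}. \<kappa> t))"
    using \<kappa>i[of a "a + h"] \<kappa>i[of b "b + h"] ab h by (simp add: set_lebesgue_integral_def)
  finally have lim': "(\<lambda>n. \<integral>t. indicator {0<..} t * (\<kappa> t * X' n t) \<partial>lborel)
      \<longlonglongrightarrow> 1 / h * ((LBINT t:{a..a+h}. \<kappa> t) - (LBINT t:{b..b+h}. \<kappa> t))"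
    using lim by (simp only:)
  have "\<bar>1 / h * ((LBINT t:{a..a+h}. \<kappa> t) - (LBINT t:{b..b+h}. \<kappa> t))\<bar>
      \<le> hoelder_const TYPE('a) * K * sqrt (b + h - a)"
    using tendsto_rabs[OF lim'] by (rule LIMSEQ_le_const2) (use X_bound in auto)
  then show ?thesis using h by (simp add: abs_mult field_simps)
qed

end

section \<open>From the profile to a pointwise bound\<close>

lemma emeasure_exterior_ball: "emeasure lborel (- cball (0::'a::euclidean_space) R) = \<infinity>"
proof (rule ccontr)
  assume *: "emeasure lborel (- cball (0::'a) R) \<noteq> \<infinity>"
  have "emeasure lborel (UNIV :: 'a set) \<le> emeasure lborel (cball (0::'a) R) + emeasure lborel (- cball (0::'a) R)"
    using emeasure_subadditive[of "cball (0::'a) R" lborel "- cball 0 R"] by (simp add: Compl_partition)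
  moreover have "emeasure lborel (cball (0::'a) R) \<noteq> \<infinity>"
    using emeasure_bounded_finite[OF bounded_cball[of "0::'a" R]] by simp
  ultimately show False using * by (simp add: top_unique)
qed

lemma newton_less_exterior:
  fixes x :: "'a::euclidean_space"
  assumes "DIM('a) \<ge> 3" "\<tau> > 0" "norm x > \<tau> powr (1 / (2 - real DIM('a)))"
  shows "0 < newton x" "newton x < \<tau>"
proof -
  have x: "x \<noteq> 0" using assms(3) by auto
  then show "0 < newton x" by (simp add: newton_def)
  have e: "2 - real DIM('a) < 0" using assms by simp
  have "norm x powr (2 - real DIM('a)) < (\<tau> powr (1 / (2 - real DIM('a)))) powr (2 - real DIM('a))"
    using assms e by (intro powr_less_mono2_neg) auto
  also have "\<dots> = \<tau>" using assms e by (simp add: powr_powr)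
  finally show "newton x < \<tau>" by (simp add: newton_def)
qed

lemma hoelder_const_nonneg: "DIM('a::euclidean_space) \<ge> 3 \<Longrightarrow> hoelder_const TYPE('a) \<ge> 0"
  using newton_const_pos[where 'a = 'a] by (auto simp: hoelder_const_def)

text \<open>\<open>H1_rad\<close> does not ask the radial representative to be measurable.
  Completeness provides it: its superlevel sets differ from those of a Borel function only inside a
  null set.\<close>

lemma borel_measurable_lebesgue_AE_eq:
  fixes u w :: "'a::euclidean_space \<Rightarrow> real"
  assumes "u \<in> borel_measurable lebesgue" "AE x in lebesgue. u x = w x"
  shows "w \<in> borel_measurable lebesgue"
proof -
  obtain g where g [measurable]: "g \<in> borel_measurable lborel" and "AE x in lborel. u x = g x"
    using completion_ex_borel_measurable_real[OF assms(1)] by auto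
  then have ae: "AE x in lborel. w x = g x"
    using assms(2) by (auto simp: AE_completion_iff)
  have gm [measurable]: "g \<in> borel_measurable lebesgue" by (rule measurable_completion[OF g])
  have "{x. w x > a} \<in> sets lebesgue" for a
  proof -
    have [measurable]: "Measurable.pred lebesgue (\<lambda>x. w x \<noteq> g x \<and> w x > a)"
        "Measurable.pred lebesgue (\<lambda>x. w x \<noteq> g x)"
      by (rule sets_completion_AE, rule eventually_mono[OF ae], simp)+
    have "Measurable.pred lebesgue (\<lambda>x. (w x \<noteq> g x \<and> w x > a) \<or> (\<not> (w x \<noteq> g x) \<and> g x > a))"
      by measurable
    moreover have "(\<lambda>x. (w x \<noteq> g x \<and> w x > a) \<or> (\<not> (w x \<noteq> g x) \<and> g x > a)) = (\<lambda>x. w x > a)"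
      by auto
    ultimately show ?thesis by (simp add: pred_def)
  qed
  then show ?thesis by (simp add: borel_measurable_iff_greater)
qed

lemma H1_rad_representative:
  fixes u :: "'a::euclidean_space \<Rightarrow> real"
  assumes N: "DIM('a) \<ge> 3" and u: "u \<in> H1_rad" and K: "H1_norm u \<le> ennreal K" "K \<ge> 0"
  obtains G where
    "AE x in lborel. u x = G (newton x)"
    "\<And>a b. 0 < a \<Longrightarrow> 0 < b \<Longrightarrow> \<bar>G a - G b\<bar> \<le> hoelder_const TYPE('a) * K * sqrt \<bar>a - b\<bar>"
    "\<And>a. 0 < a \<Longrightarrow> \<bar>G a\<bar> \<le> hoelder_const TYPE('a) * K * sqrt a"
proof -
  let ?m = "real DIM('a)" and ?C = "hoelder_const TYPE('a) * K"
  obtain w where w: "radial w" "AE x in lebesgue. u x = w x" and uH: "u \<in> H1_space"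
    using u by (auto simp: H1_rad_def)
  have "w \<in> borel_measurable lebesgue"
    using H1_space_measurable[OF uH] w(2) by (rule borel_measurable_lebesgue_AE_eq)
  then obtain g where g: "g \<in> borel_measurable borel" "AE x in lborel. w x = g (norm x)"
    using radial_borel_profile w(1) by blast
  define \<kappa> where "\<kappa> t = g (t powr (1 / (2 - ?m)))" for t
  have \<kappa>: "\<kappa> \<in> borel_measurable borel"
    unfolding \<kappa>_def using g(1) by measurable
  \<comment> \<open>True at the origin as well, since \<open>0 powr s = 0\<close> makes both sides
    \<open>g 0\<close>.\<close>
  have "\<kappa> (newton x) = g (norm x)" for x :: 'a
    using N by (cases "x = 0") (auto simp: \<kappa>_def newton_def powr_powr)
  then have u_eq: "AE x in lborel. u x = \<kappa> (newton x)"
    using w(2) g(2) by (auto simp: AE_completion_iff)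
  note ctx = N uH K \<kappa> u_eq
  have C: "?C \<ge> 0" using hoelder_const_nonneg[OF N] K by simp
  have "\<exists>G. (\<forall>a b. 0 < a \<longrightarrow> 0 < b \<longrightarrow> \<bar>G a - G b\<bar> \<le> ?C * sqrt \<bar>a - b\<bar>) \<and>
      (AE t in lborel. t > 0 \<longrightarrow> \<kappa> t = G t)"
    by (rule hoelder_half_representative[OF profile_set_integrable[OF ctx] C profile_oscillation[OF ctx]])
      blast+
  then obtain G where G: "\<And>a b. 0 < a \<Longrightarrow> 0 < b \<Longrightarrow> \<bar>G a - G b\<bar> \<le> ?C * sqrt \<bar>a - b\<bar>"
      "AE t in lborel. t > 0 \<longrightarrow> \<kappa> t = G t"
    by blast
  have uG: "AE x in lborel. u x = G (newton x)"
    using AE_newton[OF N G(2)] u_eq by auto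
  \<comment> \<open>A defect \<epsilon> at \<open>a\<close> would persist: by Hoelder continuity |G|
    \<ge> \<epsilon> on all of (0, a), which means |u| \<ge> \<epsilon> almost everywhere outside a
    ball, a set of infinite measure.\<close>
  have "\<bar>G a\<bar> \<le> ?C * sqrt a" if a: "0 < a" for a
  proof (rule ccontr)
    assume "\<not> \<bar>G a\<bar> \<le> ?C * sqrt a"
    define \<epsilon> where "\<epsilon> = \<bar>G a\<bar> - ?C * sqrt a"
    have \<epsilon>: "\<epsilon> > 0" using \<open>\<not> \<bar>G a\<bar> \<le> ?C * sqrt a\<close> by (simp add: \<epsilon>_def)
    have low: "\<epsilon> \<le> \<bar>G t\<bar>" if "0 < t" "t < a" for t
    proof -
      have "\<bar>G a - G t\<bar> \<le> ?C * sqrt \<bar>a - t\<bar>" by (rule G(1)[OF a that(1)])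
      also have "\<dots> \<le> ?C * sqrt a" using that C by (intro mult_left_mono) auto
      finally show ?thesis by (simp add: \<epsilon>_def)
    qed
    let ?R = "a powr (1 / (2 - ?m))"
    have "ennreal (\<epsilon>\<^sup>2) * emeasure lborel (- cball (0::'a) ?R)
        = (\<integral>\<^sup>+ x. ennreal (\<epsilon>\<^sup>2) * indicator (- cball (0::'a) ?R) x \<partial>lborel)"
      by (subst nn_integral_cmult_indicator) auto
    also have "\<dots> \<le> (\<integral>\<^sup>+ x. ennreal ((u x)\<^sup>2) \<partial>lborel)"
    proof (rule nn_integral_mono_AE)
      show "AE x in lborel. ennreal (\<epsilon>\<^sup>2) * indicator (- cball (0::'a) ?R) x \<le> ennreal ((u x)\<^sup>2)"
        using uG
      proof eventually_elim
        case (elim x)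
        show ?case
        proof (cases "x \<in> - cball 0 ?R")
          case True
          then have "\<epsilon> \<le> \<bar>u x\<bar>"
            using newton_less_exterior[OF N a, of x] low[of "newton x"] elim by simp
          then have "\<epsilon>\<^sup>2 \<le> (u x)\<^sup>2" using \<epsilon> by (simp add: abs_le_square_iff[symmetric])
          then show ?thesis using True by (simp add: ennreal_leI)
        qed auto
      qed
    qed
    also have "\<dots> \<le> ennreal (K\<^sup>2)"
      using H1_norm_leD(1)[OF K] by (simp add: nn_integral_completion)
    finally have "ennreal (\<epsilon>\<^sup>2) * \<infinity> \<le> ennreal (K\<^sup>2)"
      unfolding emeasure_exterior_ball .
    then show False using \<epsilon> by (simp add: ennreal_mult_top top_unique)
  qed
  with uG G(1) show ?thesis by (rule that)
qed


section \<open>Lorentz spaces and interpolation\<close>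

lemma ennpow_mono:
  assumes "x \<le> y" "a \<ge> 0"
  shows "ennpow x a \<le> ennpow y a"
proof (cases "y = \<infinity>")
  case False
  then have "enn2real x \<le> enn2real y" "x \<noteq> \<infinity>"
    using assms by (auto simp: top_unique less_top intro: enn2real_mono)
  then show ?thesis using False assms by (auto simp: ennpow_def intro!: ennreal_leI powr_mono2)
qed (simp add: ennpow_def)

lemma rearrangement_antimono: "s \<le> t \<Longrightarrow> rearrangement u t \<le> rearrangement u s"
  unfolding rearrangement_def
  by (rule Inf_superset_mono) (blast intro: order_trans[OF _ ennreal_leI])

text \<open>The inclusion of L(p,q) in L(p,\<infinity>) with a uniform constant. For finite q,
  restrict the integral to [s/2, s]: there the integrand is at least its value with t^(1/p) replaced
  by (s/2)^(1/p) and the rearrangement by its value at s, while ds/s gives the interval mass at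
  least 1/2.\<close>

lemma lorentz_norm_imp_rearrangement_bound:
  assumes p: "p > 0" and q: "1 \<le> q" and C: "C \<ge> 0"
  obtains A :: real where "A > 0"
    "\<And>(u::'a::euclidean_space \<Rightarrow> real) s. lorentz_norm p q u \<le> ennreal C \<Longrightarrow> s > 0 \<Longrightarrow>
      ennreal (s powr (1 / p)) * rearrangement u s \<le> ennreal A"
proof (cases "q = \<infinity>")
  case True
  have "ennreal (s powr (1 / p)) * rearrangement u s \<le> ennreal (C + 1)"
    if "lorentz_norm p q u \<le> ennreal C" "s > 0" for u :: "'a \<Rightarrow> real" and s
  proof -
    have "ennreal (s powr (1 / p)) * rearrangement u s \<le> lorentz_norm p q u"
      using True that(2) by (simp add: lorentz_norm_def) (rule SUP_upper2[of s], auto)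
    also have "\<dots> \<le> ennreal (C + 1)"
      using that(1) by (rule order_trans) (simp add: ennreal_leI)
    finally show ?thesis .
  qed
  then show ?thesis using that[of "C + 1"] C by auto
next
  case False
  define r where "r = enn2real q"
  have r: "r \<ge> 1"
    using q False unfolding r_def by (cases q) (auto simp flip: ennreal_1)
  define A where "A = 2 powr (1 / p) * (2 * C powr r) powr (1 / r)"
  have bound: "ennreal (s powr (1 / p)) * rearrangement u s \<le> ennreal (A + 1)"
    if u: "lorentz_norm p q u \<le> ennreal C" and s: "s > 0" for u :: "'a \<Rightarrow> real" and s
  proof -
    let ?x = "ennreal ((s / 2) powr (1 / p)) * rearrangement u s"
    let ?I = "\<integral>\<^sup>+ t\<in>{0<..}. ennpow (ennreal (t powr (1 / p)) * rearrangement u t) r * ennreal (1 / t) \<partial>lborel"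
    have "ennpow ?x r * ennreal (1 / 2) = ennpow ?x r * ennreal (1 / s) * emeasure lborel {s/2..s}"
      using s by (simp add: mult.assoc ennreal_mult[symmetric])
    also have "\<dots> = (\<integral>\<^sup>+ t. ennpow ?x r * ennreal (1 / s) * indicator {s/2..s} t \<partial>lborel)"
      by (subst nn_integral_cmult_indicator) auto
    also have "\<dots> \<le> ?I"
    proof (rule nn_integral_mono)
      fix t
      show "ennpow ?x r * ennreal (1 / s) * indicator {s/2..s} t \<le>
          ennpow (ennreal (t powr (1 / p)) * rearrangement u t) r * ennreal (1 / t) * indicator {0<..} t"
      proof (cases "t \<in> {s/2..s}")
        case True
        then have t: "t > 0" "s / 2 \<le> t" "t \<le> s" using s by auto
        have "?x \<le> ennreal (t powr (1 / p)) * rearrangement u t"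
          using t s p by (intro mult_mono rearrangement_antimono ennreal_leI powr_mono2) auto
        then have "ennpow ?x r \<le> ennpow (ennreal (t powr (1 / p)) * rearrangement u t) r"
          using r by (intro ennpow_mono) auto
        moreover have "ennreal (1 / s) \<le> ennreal (1 / t)"
          using t s by (intro ennreal_leI) (simp add: field_simps)
        ultimately show ?thesis using True t by (auto intro!: mult_mono)
      qed simp
    qed
    also have "?I \<le> ennreal (C powr (1 / (1 / r)))"
      using u False r C by (intro ennpow_le_ennrealD) (auto simp: lorentz_norm_def r_def)
    finally have "2 * (ennpow ?x r * ennreal (1 / 2)) \<le> 2 * ennreal (C powr r)"
      by (intro mult_left_mono) auto
    moreover have "2 * (ennpow ?x r * ennreal (1 / 2)) = ennpow ?x r"
    proof -
      have "2 * ennreal (1 / 2) = 1"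
        by (metis ennreal_1 ennreal_mult'' ennreal_numeral nonzero_mult_div_cancel_left one_neq_zero
            times_divide_eq_right zero_le_divide_1_iff zero_le_numeral zero_neq_numeral mult.right_neutral)
      then show ?thesis by (metis mult.left_commute mult.right_neutral)
    qed
    moreover have "2 * ennreal (C powr r) = ennreal (2 * C powr r)"
      by (simp add: ennreal_mult)
    ultimately have "?x \<le> ennreal ((2 * C powr r) powr (1 / r))"
      using r by (intro ennpow_le_ennrealD) auto
    then have "ennreal (2 powr (1 / p)) * ?x \<le> ennreal (2 powr (1 / p)) * ennreal ((2 * C powr r) powr (1 / r))"
      by (intro mult_left_mono) auto
    moreover have "ennreal (2 powr (1 / p)) * ?x = ennreal (s powr (1 / p)) * rearrangement u s"
      using s by (simp add: mult.assoc[symmetric] ennreal_mult[symmetric] powr_mult[symmetric])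
    ultimately have "ennreal (s powr (1 / p)) * rearrangement u s \<le> ennreal A"
      by (simp add: A_def ennreal_mult)
    also have "\<dots> \<le> ennreal (A + 1)" by (intro ennreal_leI) simp
    finally show ?thesis .
  qed
  \<comment> \<open>\<open>A\<close> is 0 when \<open>C\<close> is; a strictly positive constant is
    wanted because it is divided by later.\<close>
  have "A + 1 > 0" by (simp add: A_def add_nonneg_pos)
  then show ?thesis using that bound by blast
qed

text \<open>Choose \<open>s\<close> so that the bound on the rearrangement at \<open>s\<close>
  becomes \<open>l / 2\<close>. The factor 2 gives strict inequality with \<open>l\<close>, so the
  infimum defining the rearrangement has a competitor \<open>l' < l\<close> whose superlevel set has
  measure at most \<open>s\<close>, and \<open>s\<close> is the required multiple of
  \<open>l powr (- p)\<close>.\<close>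

lemma lorentz_norm_imp_weak_Lp:
  assumes p: "p > 0" and q: "1 \<le> q" and C: "C \<ge> 0"
  obtains B :: real where "B \<ge> 0"
    "\<And>(u::'a::euclidean_space \<Rightarrow> real) l. u \<in> borel_measurable lebesgue \<Longrightarrow>
      lorentz_norm p q u \<le> ennreal C \<Longrightarrow> l > 0 \<Longrightarrow>
      emeasure lebesgue {x. \<bar>u x\<bar> > l} \<le> ennreal (B * l powr (- p))"
proof -
  obtain A :: real where A: "A > 0"
    "\<And>(u::'a \<Rightarrow> real) s. lorentz_norm p q u \<le> ennreal C \<Longrightarrow> s > 0 \<Longrightarrow>
      ennreal (s powr (1 / p)) * rearrangement u s \<le> ennreal A"
    using lorentz_norm_imp_rearrangement_bound[OF p q C, where 'a = 'a] by blast
  have "emeasure lebesgue {x. \<bar>u x\<bar> > l} \<le> ennreal ((2 * A) powr p * l powr (- p))"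
    if u: "u \<in> borel_measurable lebesgue" "lorentz_norm p q u \<le> ennreal C" and l: "l > 0"
    for u :: "'a \<Rightarrow> real" and l
  proof -
    define s where "s = (2 * A / l) powr p"
    have s: "s > 0" "s powr (1 / p) = 2 * A / l"
      using A l p by (auto simp: s_def powr_powr)
    have "ennreal (2 * A / l) * rearrangement u s \<le> ennreal A"
      using A(2)[OF u(2) s(1)] by (simp add: s)
    then have "ennreal (l / (2 * A)) * (ennreal (2 * A / l) * rearrangement u s) \<le> ennreal (l / (2 * A)) * ennreal A"
      by (intro mult_left_mono) auto
    moreover have "ennreal (l / (2 * A)) * (ennreal (2 * A / l) * rearrangement u s) = rearrangement u s"
      using A l by (simp add: mult.assoc[symmetric] ennreal_mult[symmetric])
    moreover have "ennreal (l / (2 * A)) * ennreal A = ennreal (l / 2)"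
      using A l by (simp add: ennreal_mult[symmetric])
    ultimately have "rearrangement u s \<le> ennreal (l / 2)" by simp
    also have "\<dots> < ennreal l" using l by (intro ennreal_lessI) auto
    finally obtain l' where l': "ennreal l' < ennreal l" "emeasure lebesgue {x. \<bar>u x\<bar> > l'} \<le> ennreal s"
      unfolding rearrangement_def Inf_less_iff by auto
    have "l' < l" using l'(1) by (meson ennreal_leI not_le)
    have "{x \<in> space lebesgue. l' < \<bar>u x\<bar>} \<in> sets lebesgue"
      using u(1) by measurable
    then have "{x. \<bar>u x\<bar> > l'} \<in> sets lebesgue" by simp
    then have "emeasure lebesgue {x. \<bar>u x\<bar> > l} \<le> emeasure lebesgue {x. \<bar>u x\<bar> > l'}"
      using \<open>l' < l\<close> by (intro emeasure_mono) auto
    also have "\<dots> \<le> ennreal s" by (rule l')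
    also have "s = (2 * A) powr p * l powr (- p)"
      using A l by (simp add: s_def powr_divide powr_minus_divide)
    finally show ?thesis .
  qed
  then show ?thesis using that[of "(2 * A) powr p"] by auto
qed

text \<open>On the side of \<open>|u| = 1\<close> where \<open>u\<^sup>2\<close> does not dominate \<open>|u|\<^sup>s\<close>, a dyadic decomposition into
  the level sets \<open>\<theta> j < |u| \<le> 2 \<theta> j\<close> yields a geometric series.\<close>

lemma weak_Lp_interpolation:
  assumes B: "B \<ge> 0" and D: "D \<ge> 0" and s: "(p < s \<and> s \<le> 2) \<or> (2 \<le> s \<and> s < p)" and p: "p > 0"
  obtains E :: real where "E \<ge> 0"
    "\<And>(u::'a::euclidean_space \<Rightarrow> real). u \<in> borel_measurable lebesgue \<Longrightarrow>
      (\<And>l. l > 0 \<Longrightarrow> emeasure lebesgue {x. \<bar>u x\<bar> > l} \<le> ennreal (B * l powr (- p))) \<Longrightarrow>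
      (\<integral>\<^sup>+ x. ennreal ((u x)\<^sup>2) \<partial>lebesgue) \<le> ennreal D \<Longrightarrow>
      (\<integral>\<^sup>+ x. ennreal (\<bar>u x\<bar> powr s) \<partial>lebesgue) \<le> ennreal E"
proof -
  \<comment> \<open>The intervals with left end \<open>\<theta> j\<close> excluded and right end
    \<open>2 * \<theta> j\<close> included tile (0, 1] if \<open>p < s\<close> and (1, \<infinity>)
    otherwise. The shift by 1 in the first case places the right end for \<open>j = 0\<close> at
    1.\<close>
  define \<theta> :: "nat \<Rightarrow> real" where "\<theta> j = 2 powr (if p < s then - (real j + 1) else real j)" for j
  define \<rho> :: real where "\<rho> = 2 powr (- \<bar>s - p\<bar>)"
  have \<theta>: "\<theta> j > 0" for j by (simp add: \<theta>_def)
  have s0: "s > 0" using s p by auto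
  have sp: "s \<noteq> p" using s by auto
  have \<rho>: "0 \<le> \<rho>" "\<rho> < 1" using sp by (auto simp: \<rho>_def powr_less_one)
  have \<theta>_pow: "\<theta> j powr (s - p) \<le> \<rho> ^ j" for j
  proof -
    have "\<theta> j powr (s - p) = 2 powr ((if p < s then - (real j + 1) else real j) * (s - p))"
      by (simp add: \<theta>_def powr_powr)
    also have "\<dots> \<le> 2 powr (- \<bar>s - p\<bar> * real j)"
      using sp by (intro powr_mono) (auto simp: algebra_simps)
    also have "\<dots> = \<rho> powr real j" by (simp add: \<rho>_def powr_powr)
    also have "\<dots> = \<rho> ^ j" by (simp add: \<rho>_def powr_realpow)
    finally show ?thesis .
  qed
  have cover: "\<exists>j. \<theta> j < y \<and> y \<le> 2 * \<theta> j" if "y > 0" "(p < s \<and> y < 1) \<or> (s < p \<and> y > 1)" for y :: real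
  proof -
    define t where "t = log 2 y"
    have y: "y = 2 powr t" using that by (simp add: t_def)
    show ?thesis
    proof (cases "p < s")
      case True
      then have "t < 0" using that by (simp add: t_def)
      define j where "j = nat \<lfloor>- t\<rfloor>"
      have "real j \<le> - t" "- t < real j + 1" using \<open>t < 0\<close> by (auto simp: j_def)
      moreover have "2 * \<theta> j = 2 powr (- real j)"
        using True powr_add[of "2::real" 1 "- (real j + 1)"] by (simp add: \<theta>_def)
      ultimately show ?thesis using True by (intro exI[of _ j]) (auto simp: y \<theta>_def)
    next
      case False
      then have "t > 0" using that by (simp add: t_def)
      define j where "j = nat (\<lceil>t\<rceil> - 1)"
      have "real j < t" "t \<le> real j + 1" using \<open>t > 0\<close> by (auto simp: j_def) linarith+
      moreover have "2 * \<theta> j = 2 powr (real j + 1)"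
        using False powr_add[of "2::real" "real j" 1] by (simp add: \<theta>_def)
      ultimately show ?thesis using False by (intro exI[of _ j]) (auto simp: y \<theta>_def)
    qed
  qed
  define E where "E = D + 2 powr s * B * (\<Sum>j. \<rho> ^ j)"
  have summ: "summable (\<lambda>j. 2 powr s * B * \<rho> ^ j)"
    using \<rho> by (intro summable_mult summable_geometric) auto
  have le_suminf: "f j \<le> (\<Sum>j. f j)" for f :: "nat \<Rightarrow> ennreal" and j
    using sum_le_suminf[of f "{j}"] by (simp add: summableI)
  have "(\<integral>\<^sup>+ x. ennreal (\<bar>u x\<bar> powr s) \<partial>lebesgue) \<le> ennreal E"
    if [measurable]: "u \<in> borel_measurable lebesgue"
      and weak: "\<And>l. l > 0 \<Longrightarrow> emeasure lebesgue {x. \<bar>u x\<bar> > l} \<le> ennreal (B * l powr (- p))"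
      and L2: "(\<integral>\<^sup>+ x. ennreal ((u x)\<^sup>2) \<partial>lebesgue) \<le> ennreal D"
    for u :: "'a \<Rightarrow> real"
  proof -
    let ?S = "\<lambda>j. {x. \<bar>u x\<bar> > \<theta> j}"
    have S: "?S j \<in> sets lebesgue" for j
    proof -
      have "{x \<in> space lebesgue. \<theta> j < \<bar>u x\<bar>} \<in> sets lebesgue" by measurable
      then show ?thesis by simp
    qed
    let ?t = "\<lambda>j x. ennreal ((2 * \<theta> j) powr s) * indicator (?S j) x"
    have pw: "ennreal (\<bar>u x\<bar> powr s) \<le> ennreal ((u x)\<^sup>2) + (\<Sum>j. ?t j x)" for x
    proof (cases "\<bar>u x\<bar> > 0 \<and> ((p < s \<and> \<bar>u x\<bar> < 1) \<or> (s < p \<and> \<bar>u x\<bar> > 1))")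
      case True
      then obtain j where j: "\<theta> j < \<bar>u x\<bar>" "\<bar>u x\<bar> \<le> 2 * \<theta> j" using cover by blast
      have "ennreal (\<bar>u x\<bar> powr s) \<le> ?t j x"
        using j s0 by (auto intro!: ennreal_leI powr_mono2)
      also have "\<dots> \<le> (\<Sum>j. ?t j x)"
        by (rule le_suminf)
      finally show ?thesis by (simp add: add_increasing)
    next
      case False
      \<comment> \<open>Here \<open>u x = 0\<close>, or |u| \<ge> 1 with s \<le> 2, or |u| \<le> 1
        with s \<ge> 2: the square dominates.\<close>
      have "\<bar>u x\<bar> powr s \<le> \<bar>u x\<bar> powr 2"
      proof (cases "u x = 0")
        case nz: False
        show ?thesis
        proof (cases "p < s")
          case True
          then have "1 \<le> \<bar>u x\<bar>" "s \<le> 2" using False nz s by auto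
          then show ?thesis by (intro powr_mono) auto
        next
          case False2: False
          then have "\<bar>u x\<bar> \<le> 1" "2 \<le> s" using False nz s by auto
          then show ?thesis using nz by (intro powr_mono') auto
        qed
      qed simp
      then have "ennreal (\<bar>u x\<bar> powr s) \<le> ennreal ((u x)\<^sup>2)" by (simp add: ennreal_leI)
      then show ?thesis by (simp add: add_increasing2)
    qed
    have "(\<integral>\<^sup>+ x. ennreal (\<bar>u x\<bar> powr s) \<partial>lebesgue) \<le> (\<integral>\<^sup>+ x. ennreal ((u x)\<^sup>2) + (\<Sum>j. ?t j x) \<partial>lebesgue)"
      by (intro nn_integral_mono pw)
    also have "\<dots> = (\<integral>\<^sup>+ x. ennreal ((u x)\<^sup>2) \<partial>lebesgue) + (\<Sum>j. \<integral>\<^sup>+ x. ?t j x \<partial>lebesgue)"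
      using S by (subst nn_integral_add) (auto simp: nn_integral_suminf)
    also have "\<dots> \<le> ennreal D + (\<Sum>j. ennreal (2 powr s * B * \<rho> ^ j))"
    proof (intro add_mono L2 suminf_le)
      fix j
      have "(\<integral>\<^sup>+ x. ?t j x \<partial>lebesgue) = ennreal ((2 * \<theta> j) powr s) * emeasure lebesgue (?S j)"
        using S by (subst nn_integral_cmult_indicator) auto
      also have "\<dots> \<le> ennreal ((2 * \<theta> j) powr s) * ennreal (B * \<theta> j powr (- p))"
        by (intro mult_left_mono weak \<theta>) auto
      also have "\<dots> = ennreal (2 powr s * B * (\<theta> j powr (s - p)))"
        using \<theta>[of j] B by (simp add: ennreal_mult[symmetric] powr_mult powr_diff powr_minus_divide mult_ac)
      also have "\<dots> \<le> ennreal (2 powr s * B * \<rho> ^ j)"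
        using B \<theta>_pow by (intro ennreal_leI mult_left_mono) auto
      finally show "(\<integral>\<^sup>+ x. ?t j x \<partial>lebesgue) \<le> ennreal (2 powr s * B * \<rho> ^ j)" .
    qed (auto intro: summableI)
    also have "(\<Sum>j. ennreal (2 powr s * B * \<rho> ^ j)) = ennreal (2 powr s * B * (\<Sum>j. \<rho> ^ j))"
      using B \<rho> summ by (subst suminf_ennreal2) (auto simp: suminf_mult summable_geometric)
    also have "ennreal D + \<dots> = ennreal E"
      unfolding E_def using D B \<rho> by (subst ennreal_plus) (auto intro!: mult_nonneg_nonneg suminf_nonneg summable_geometric)
    finally show ?thesis .
  qed
  moreover have "E \<ge> 0"
    unfolding E_def using D B \<rho> by (intro add_nonneg_nonneg mult_nonneg_nonneg suminf_nonneg summable_geometric) auto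
  ultimately show ?thesis using that by blast
qed

section \<open>Limit theorems for nonnegative integrals\<close>

lemma ennreal_tendsto_0I:
  assumes "\<And>\<epsilon>::real. \<epsilon> > 0 \<Longrightarrow> eventually (\<lambda>k. f k \<le> ennreal \<epsilon>) F"
  shows "(f \<longlongrightarrow> (0::ennreal)) F"
proof (rule order_tendstoI)
  fix a :: ennreal assume "0 < a"
  then obtain \<epsilon> :: real where e: "\<epsilon> > 0" "ennreal \<epsilon> < a"
  proof (cases a)
    case (real r)
    then show ?thesis using that[of "r / 2"] \<open>0 < a\<close> by (simp add: ennreal_less_iff)
  next
    case top
    then show ?thesis using that[of 1] by auto
  qed
  show "eventually (\<lambda>k. f k < a) F"
    using assms[OF e(1)] by eventually_elim (use e in auto)
qed simp

text \<open>A variant of Vitali's theorem. The minimum of \<open>f k\<close> and \<open>D\<close> is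
  handled by dominated convergence, and the excess over \<open>D\<close> is at most
  \<open>e\<close>. The majorant \<open>D\<close> may depend on \<epsilon> but not on
  \<open>k\<close>; the error \<open>e\<close> may depend on both.\<close>

lemma nn_integral_tendsto_0_if_dominated_up_to_eps:
  fixes f :: "nat \<Rightarrow> 'a \<Rightarrow> real"
  assumes f [measurable]: "\<And>k. f k \<in> borel_measurable M" "\<And>k x. 0 \<le> f k x"
    and lim: "AE x in M. (\<lambda>k. f k x) \<longlonglongrightarrow> 0"
    and dom: "\<And>\<epsilon>::real. \<epsilon> > 0 \<Longrightarrow> \<exists>D. integrable M D \<and> (\<forall>x. 0 \<le> D x) \<and>
        (\<forall>k. \<exists>e\<in>borel_measurable M. (AE x in M. ennreal (f k x) \<le> ennreal (D x) + e x) \<and>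
          (\<integral>\<^sup>+ x. e x \<partial>M) \<le> ennreal \<epsilon>)"
  shows "(\<lambda>k. \<integral>\<^sup>+ x. ennreal (f k x) \<partial>M) \<longlonglongrightarrow> 0"
proof (rule ennreal_tendsto_0I)
  fix \<epsilon> :: real assume \<epsilon>: "\<epsilon> > 0"
  then obtain D where D: "integrable M D" "\<And>x. 0 \<le> D x"
      "\<And>k. \<exists>e\<in>borel_measurable M. (AE x in M. ennreal (f k x) \<le> ennreal (D x) + e x) \<and>
          (\<integral>\<^sup>+ x. e x \<partial>M) \<le> ennreal (\<epsilon> / 2)"
    using dom[of "\<epsilon> / 2"] by auto
  have [measurable]: "D \<in> borel_measurable M" using D(1) by simp
  have "(\<lambda>k. \<integral>\<^sup>+ x. ennreal (min (f k x) (D x)) \<partial>M) \<longlonglongrightarrow> (\<integral>\<^sup>+ x. 0 \<partial>M)"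
  proof (rule nn_integral_dominated_convergence[where w = "\<lambda>x. ennreal (D x)"])
    show "(\<integral>\<^sup>+ x. ennreal (D x) \<partial>M) < \<infinity>"
      using D by (simp add: integrable_iff_bounded)
    show "AE x in M. (\<lambda>k. ennreal (min (f k x) (D x))) \<longlonglongrightarrow> 0"
      using lim
    proof eventually_elim
      case (elim x)
      have "(\<lambda>k. min (f k x) (D x)) \<longlonglongrightarrow> 0"
        by (rule tendsto_sandwich[OF _ _ tendsto_const elim]) (use f(2) D(2) in auto)
      then show ?case using tendsto_ennrealI by fastforce
    qed
  qed (auto intro!: AE_I2 ennreal_leI)
  then have "eventually (\<lambda>k. (\<integral>\<^sup>+ x. ennreal (min (f k x) (D x)) \<partial>M) < ennreal (\<epsilon> / 2)) sequentially"
    using \<epsilon> by (intro order_tendstoD(2)[of _ 0]) auto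
  then show "eventually (\<lambda>k. (\<integral>\<^sup>+ x. ennreal (f k x) \<partial>M) \<le> ennreal \<epsilon>) sequentially"
  proof eventually_elim
    case (elim k)
    obtain e where e [measurable]: "e \<in> borel_measurable M" and
      e': "AE x in M. ennreal (f k x) \<le> ennreal (D x) + e x" "(\<integral>\<^sup>+ x. e x \<partial>M) \<le> ennreal (\<epsilon> / 2)"
      using D(3)[of k] by blast
    have "(\<integral>\<^sup>+ x. ennreal (f k x) \<partial>M) \<le> (\<integral>\<^sup>+ x. ennreal (min (f k x) (D x)) + e x \<partial>M)"
    proof (rule nn_integral_mono_AE)
      show "AE x in M. ennreal (f k x) \<le> ennreal (min (f k x) (D x)) + e x"
        using e'(1) by eventually_elim (auto simp: min_def add_increasing2)
    qed
    also have "\<dots> = (\<integral>\<^sup>+ x. ennreal (min (f k x) (D x)) \<partial>M) + (\<integral>\<^sup>+ x. e x \<partial>M)"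
      by (intro nn_integral_add) auto
    also have "\<dots> \<le> ennreal (\<epsilon> / 2) + ennreal (\<epsilon> / 2)"
      using elim e'(2) by (intro add_mono) auto
    also have "\<dots> = ennreal \<epsilon>" using \<epsilon> by (simp flip: ennreal_plus)
    finally show ?case .
  qed
qed

text \<open>Fatou's lemma; it puts the limit function into the target space and transfers to it the
  bounds of the sequence.\<close>

lemma nn_integral_bound_AE_limit:
  fixes u :: "nat \<Rightarrow> 'a \<Rightarrow> real"
  assumes [measurable]: "\<And>k. u k \<in> borel_measurable M"
    and lim: "AE x in M. (\<lambda>k. u k x) \<longlonglongrightarrow> v x"
    and bound: "\<And>k. (\<integral>\<^sup>+ x. ennreal (\<bar>u k x\<bar> powr s) \<partial>M) \<le> E" and s: "s > 0"
  shows "(\<integral>\<^sup>+ x. ennreal (\<bar>v x\<bar> powr s) \<partial>M) \<le> E"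
proof -
  have "(\<integral>\<^sup>+ x. ennreal (\<bar>v x\<bar> powr s) \<partial>M) = (\<integral>\<^sup>+ x. liminf (\<lambda>k. ennreal (\<bar>u k x\<bar> powr s)) \<partial>M)"
  proof (rule nn_integral_cong_AE)
    show "AE x in M. ennreal (\<bar>v x\<bar> powr s) = liminf (\<lambda>k. ennreal (\<bar>u k x\<bar> powr s))"
      using lim
    proof eventually_elim
      case (elim x)
      have "(\<lambda>k. \<bar>u k x\<bar> powr s) \<longlonglongrightarrow> \<bar>v x\<bar> powr s"
        using s by (intro tendsto_powr' tendsto_rabs elim tendsto_const) auto
      then have "(\<lambda>k. ennreal (\<bar>u k x\<bar> powr s)) \<longlonglongrightarrow> ennreal (\<bar>v x\<bar> powr s)"
        by (rule tendsto_ennrealI)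
      then show ?case by (intro lim_imp_Liminf[symmetric]) auto
    qed
  qed
  also have "\<dots> \<le> liminf (\<lambda>k. \<integral>\<^sup>+ x. ennreal (\<bar>u k x\<bar> powr s) \<partial>M)"
    by (rule nn_integral_liminf) measurable
  also have "\<dots> \<le> E"
    using bound by (intro Liminf_le) auto
  finally show ?thesis .
qed

lemma abs_diff_powr_le:
  fixes a b s :: real
  assumes "s > 0"
  shows "\<bar>a - b\<bar> powr s \<le> 2 powr s * (\<bar>a\<bar> powr s + \<bar>b\<bar> powr s)"
proof -
  have "\<bar>a - b\<bar> \<le> 2 * max \<bar>a\<bar> \<bar>b\<bar>" by (auto simp: max_def)
  then have "\<bar>a - b\<bar> powr s \<le> (2 * max \<bar>a\<bar> \<bar>b\<bar>) powr s"
    using assms by (intro powr_mono2) auto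
  also have "\<dots> = 2 powr s * (max \<bar>a\<bar> \<bar>b\<bar>) powr s" by (simp add: powr_mult)
  also have "(max \<bar>a\<bar> \<bar>b\<bar>) powr s \<le> \<bar>a\<bar> powr s + \<bar>b\<bar> powr s" by (auto simp: max_def)
  finally show ?thesis by simp
qed


section \<open>Compactness\<close>

text \<open>The Arzela-Ascoli argument, keeping only pointwise convergence: a diagonal sequence
  converges at the positive rationals, and equicontinuity carries the Cauchy property from a nearby
  rational to every \<open>t\<close>.\<close>

lemma hoelder_half_pointwise_subsequence:
  fixes G :: "nat \<Rightarrow> real \<Rightarrow> real"
  assumes C: "C \<ge> 0"
    and osc: "\<And>k a b. 0 < a \<Longrightarrow> 0 < b \<Longrightarrow> \<bar>G k a - G k b\<bar> \<le> C * sqrt \<bar>a - b\<bar>"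
    and bnd: "\<And>k a. 0 < a \<Longrightarrow> \<bar>G k a\<bar> \<le> C * sqrt a"
  obtains \<sigma> :: "nat \<Rightarrow> nat" where "strict_mono \<sigma>" "\<And>t. 0 < t \<Longrightarrow> convergent (\<lambda>k. G (\<sigma> k) t)"
proof -
  define q :: "nat \<Rightarrow> real" where "q n = real_of_rat (nat_to_rat_surj n)" for n
  define P where "P n s \<longleftrightarrow> (q n > 0 \<longrightarrow> convergent (\<lambda>k. G (s k) (q n)))" for n and s :: "nat \<Rightarrow> nat"
  interpret subseqs P
  proof
    fix n and s :: "nat \<Rightarrow> nat"
    show "\<exists>r. strict_mono r \<and> P n (s \<circ> r)"
    proof (cases "q n > 0")
      case True
      have "bounded (range (\<lambda>k. G (s k) (q n)))"
        unfolding bounded_iff using bnd[OF True] by auto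
      then obtain l r where "strict_mono (r :: nat \<Rightarrow> nat)" "((\<lambda>k. G (s k) (q n)) \<circ> r) \<longlonglongrightarrow> l"
        using bounded_imp_convergent_subsequence by blast
      then show ?thesis by (auto simp: P_def convergent_def o_def)
    next
      case False
      then show ?thesis using strict_mono_id by (auto simp: P_def)
    qed
  qed
  have rat: "convergent (\<lambda>k. G (diagseq k) (q n))" if qn: "q n > 0" for n
  proof -
    \<comment> \<open>Only after dropping its first \<open>Suc n\<close> terms is the diagonal
      sequence a subsequence of the one selected for \<open>q n\<close>.\<close>
    have "P n (diagseq \<circ> (+) (Suc n))"
    proof (rule diagseq_holds)
      fix m s and r :: "nat \<Rightarrow> nat" assume r: "strict_mono r" "P m s"
      show "P m (s \<circ> r)"
        unfolding P_def
      proof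
        assume "q m > 0"
        then obtain l where "(\<lambda>k. G (s k) (q m)) \<longlonglongrightarrow> l" using r(2) by (auto simp: P_def convergent_def)
        from LIMSEQ_subseq_LIMSEQ[OF this r(1)] show "convergent (\<lambda>k. G ((s \<circ> r) k) (q m))"
          by (auto simp: convergent_def o_def)
      qed
    qed
    then obtain l where "(\<lambda>k. G (diagseq (k + Suc n)) (q n)) \<longlonglongrightarrow> l"
      using qn by (auto simp: P_def convergent_def o_def add.commute)
    from LIMSEQ_offset[OF this] show ?thesis by (auto simp: convergent_def)
  qed
  have "convergent (\<lambda>k. G (diagseq k) t)" if t: "0 < t" for t
  proof -
    have "Cauchy (\<lambda>k. G (diagseq k) t)"
    proof (rule CauchyI)
      fix e :: real assume e: "e > 0"
      \<comment> \<open>Makes \<open>C * sqrt \<delta>\<close> smaller than \<open>e / 3\<close>;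
        \<open>C + 1\<close> replaces \<open>C\<close>, which may be 0.\<close>
      define \<delta> where "\<delta> = (e / (3 * (C + 1)))\<^sup>2"
      have \<delta>: "\<delta> > 0" "sqrt \<delta> = e / (3 * (C + 1))" using e C by (auto simp: \<delta>_def)
      obtain r where r: "t < real_of_rat r" "real_of_rat r < t + \<delta>"
        using of_rat_dense[of t "t + \<delta>"] \<delta> by auto
      obtain n where n: "r = nat_to_rat_surj n" using surj_nat_to_rat_surj by (metis surj_def)
      have q: "t < q n" "q n < t + \<delta>" using r n by (auto simp: q_def)
      have near: "\<bar>G k t - G k (q n)\<bar> < e / 3" for k
      proof -
        have "\<bar>G k t - G k (q n)\<bar> \<le> C * sqrt \<bar>t - q n\<bar>" by (rule osc) (use t q in auto)
        also have "\<dots> \<le> C * sqrt \<delta>" using q C by (intro mult_left_mono) auto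
        also have "\<dots> < e / 3" using C e by (simp add: \<delta> field_simps)
        finally show ?thesis .
      qed
      have "Cauchy (\<lambda>k. G (diagseq k) (q n))"
        using rat[of n] t q by (simp add: Cauchy_convergent_iff)
      then obtain M where M: "\<And>k l. k \<ge> M \<Longrightarrow> l \<ge> M \<Longrightarrow> \<bar>G (diagseq k) (q n) - G (diagseq l) (q n)\<bar> < e / 3"
        using CauchyD[of "\<lambda>k. G (diagseq k) (q n)" "e / 3"] e by (auto simp: real_norm_def)
      show "\<exists>M. \<forall>m\<ge>M. \<forall>k\<ge>M. norm (G (diagseq m) t - G (diagseq k) t) < e"
      proof (intro exI[of _ M] allI impI)
        fix m k assume "M \<le> m" "M \<le> k"
        then show "norm (G (diagseq m) t - G (diagseq k) t) < e"
          using M[of m k] near[of "diagseq m"] near[of "diagseq k"] unfolding real_norm_def by linarith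
      qed
    qed
    then show ?thesis by (rule Cauchy_convergent)
  qed
  then show ?thesis using that subseq_diagseq by blast
qed

lemma AE_newton_pos:
  "AE x::'a::euclidean_space in lborel. newton x > 0"
proof -
  have "AE x::'a in lborel. x \<noteq> 0" by (rule AE_lborel_singleton)
  then show ?thesis by eventually_elim (simp add: newton_def)
qed

lemma H1_rad_bounded_subsequence:
  fixes u :: "nat \<Rightarrow> 'a::euclidean_space \<Rightarrow> real"
  assumes N: "DIM('a) \<ge> 3" and u: "\<And>k. u k \<in> H1_rad"
    and K: "\<And>k. H1_norm (u k) \<le> ennreal K" "K \<ge> 0"
  obtains \<sigma> v C where "strict_mono \<sigma>" "v \<in> borel_measurable lebesgue" "C \<ge> 0"
    "AE x in lebesgue. (\<lambda>k. u (\<sigma> k) x) \<longlonglongrightarrow> v x"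
    "\<And>k. AE x in lebesgue. \<bar>u (\<sigma> k) x - v x\<bar> \<le> C * sqrt (newton x)"
proof -
  let ?C = "hoelder_const TYPE('a) * K"
  have C: "?C \<ge> 0" using hoelder_const_nonneg[OF N] K by simp
  have "\<exists>G. (AE x in lborel. u k x = G (newton x)) \<and>
      (\<forall>a b. 0 < a \<longrightarrow> 0 < b \<longrightarrow> \<bar>G a - G b\<bar> \<le> ?C * sqrt \<bar>a - b\<bar>) \<and>
      (\<forall>a. 0 < a \<longrightarrow> \<bar>G a\<bar> \<le> ?C * sqrt a)" for k
    by (rule H1_rad_representative[OF N u K]) blast
  then obtain G where G: "\<And>k. AE x in lborel. u k x = G k (newton x)"
      "\<And>k a b. 0 < a \<Longrightarrow> 0 < b \<Longrightarrow> \<bar>G k a - G k b\<bar> \<le> ?C * sqrt \<bar>a - b\<bar>"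
      "\<And>k a. 0 < a \<Longrightarrow> \<bar>G k a\<bar> \<le> ?C * sqrt a"
    by metis
  have "\<exists>\<sigma>. strict_mono \<sigma> \<and> (\<forall>t>0. convergent (\<lambda>k. G (\<sigma> k) t))"
    by (rule hoelder_half_pointwise_subsequence[where G = G, OF C G(2,3)]) blast+
  then obtain \<sigma> :: "nat \<Rightarrow> nat" where
    \<sigma>: "strict_mono \<sigma>" "\<And>t. 0 < t \<Longrightarrow> convergent (\<lambda>k. G (\<sigma> k) t)"
    by blast
  \<comment> \<open>The limit is taken of the functions themselves, not of their profiles, which
    gives Lebesgue measurability at once; on the null set of divergence the value is
    arbitrary.\<close>
  define v where "v x = lim (\<lambda>k. u (\<sigma> k) x)" for x
  have um: "u k \<in> borel_measurable lebesgue" for k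
    using u[of k] by (auto simp: H1_rad_def intro: H1_space_measurable)
  have vm: "v \<in> borel_measurable lebesgue"
    unfolding v_def[abs_def] by (rule borel_measurable_lim_metric) (rule um)
  have "AE x in lborel. \<forall>k. u k x = G k (newton x)"
    using G(1) by (simp add: AE_all_countable)
  with AE_newton_pos have ae: "AE x in lborel. (\<lambda>k. u (\<sigma> k) x) \<longlonglongrightarrow> v x \<and>
      (\<forall>k. \<bar>u (\<sigma> k) x - v x\<bar> \<le> 2 * ?C * sqrt (newton x))"
  proof eventually_elim
    case (elim x)
    have conv: "(\<lambda>k. u (\<sigma> k) x) \<longlonglongrightarrow> v x"
      using \<sigma>(2)[of "newton x"] elim by (simp add: v_def convergent_LIMSEQ_iff)
    have b: "\<bar>u k x\<bar> \<le> ?C * sqrt (newton x)" for k using G(3) elim by simp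
    have "\<bar>v x\<bar> \<le> ?C * sqrt (newton x)"
      using tendsto_rabs[OF conv] by (rule LIMSEQ_le_const2) (use b in auto)
    then have "\<bar>u (\<sigma> k) x - v x\<bar> \<le> 2 * ?C * sqrt (newton x)" for k
      using b[of "\<sigma> k"] by linarith
    with conv show ?case by blast
  qed
  show ?thesis
  proof (rule that[OF \<sigma>(1) vm])
    show "2 * ?C \<ge> 0" using C by simp
    show "AE x in lebesgue. (\<lambda>k. u (\<sigma> k) x) \<longlonglongrightarrow> v x"
      by (rule AE_completion, rule eventually_mono[OF ae]) blast
    show "AE x in lebesgue. \<bar>u (\<sigma> k) x - v x\<bar> \<le> 2 * ?C * sqrt (newton x)" for k
      by (rule AE_completion, rule eventually_mono[OF ae]) blast
  qed
qed

lemma exists_small_powr: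
  fixes C a E \<epsilon> :: real
  assumes "C \<ge> 0" "a > 0" "E \<ge> 0" "\<epsilon> > 0"
  obtains \<tau> where "\<tau> > 0" "(C * sqrt \<tau>) powr a * E \<le> \<epsilon>"
proof -
  define y where "y = (\<epsilon> / (E + 1)) powr (1 / a)"
  have y: "y > 0" using assms by (simp add: y_def)
  define \<tau> where "\<tau> = (y / (C + 1))\<^sup>2"
  have \<tau>: "\<tau> > 0" "sqrt \<tau> = y / (C + 1)" using y assms by (auto simp: \<tau>_def)
  have "C * sqrt \<tau> \<le> y" using assms y by (simp add: \<tau> field_simps)
  moreover have "0 \<le> C * sqrt \<tau>" using assms(1) \<tau>(1) by simp
  ultimately have "(C * sqrt \<tau>) powr a \<le> y powr a" using assms(2) by (intro powr_mono2) auto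
  also have "\<dots> = \<epsilon> / (E + 1)" using assms by (simp add: y_def powr_powr)
  finally have "(C * sqrt \<tau>) powr a * E \<le> \<epsilon> / (E + 1) * E" using assms by (intro mult_right_mono)
  also have "\<dots> \<le> \<epsilon>" using assms by (simp add: field_simps)
  finally show ?thesis using that \<tau> by blast
qed

lemma newton_superlevel_finite:
  fixes M \<tau> :: real
  assumes N: "DIM('a::euclidean_space) \<ge> 3" and \<tau>: "\<tau> > 0"
  shows "integrable lebesgue (\<lambda>x::'a. M * indicator {x. newton x \<ge> \<tau>} x)"
proof -
  let ?S = "{x::'a. newton x \<ge> \<tau>}"
  have "{x \<in> space lborel. newton (x::'a) \<ge> \<tau>} \<in> sets lborel" by measurable
  then have S: "?S \<in> sets lborel" by simp
  have "?S \<subseteq> cball 0 (\<tau> powr (1 / (2 - real DIM('a))))"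
  proof
    fix x :: 'a assume "x \<in> ?S"
    then show "x \<in> cball 0 (\<tau> powr (1 / (2 - real DIM('a))))"
      using newton_less_exterior(2)[OF N \<tau>, of x] by (force simp: not_le[symmetric])
  qed
  then have "emeasure lborel ?S < \<infinity>"
    by (intro emeasure_bounded_finite) (rule bounded_subset[OF bounded_cball])
  then have "integrable lborel (indicator ?S :: 'a \<Rightarrow> real)"
    using S by (intro integrable_real_indicator)
  then have "integrable lborel (\<lambda>x. M * indicator ?S x)"
    by (rule integrable_mult_right)
  then show ?thesis by (rule integrable_completion[THEN iffD2, rotated]) (use S in simp)
qed

text \<open>In the variable t the integrand is c t^(1-\<gamma>) on [\<tau>, \<infinity>), integrable
  because \<gamma> = 2 + 2/(N-2) exceeds 2.\<close>

lemma newton_locally_integrable: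
  fixes M \<tau> :: real
  assumes N: "DIM('a::euclidean_space) \<ge> 3" and \<tau>: "\<tau> > 0"
  shows "integrable lebesgue (\<lambda>x::'a. M * (newton x * indicator {\<tau>..} (newton x)))"
proof -
  let ?\<gamma> = "newton_exp TYPE('a)" and ?c = "newton_const TYPE('a)"
  have c: "?c > 0" by (rule newton_const_pos[OF N])
  have \<gamma>: "?\<gamma> > 2" using N by (simp add: newton_exp_def field_simps)
  have pos: "newton x \<ge> 0" for x :: 'a by (simp add: newton_def)
  have "(\<integral>\<^sup>+ (x::'a). ennreal (newton x * indicator {\<tau>..} (newton x)) \<partial>lborel)
      = (\<integral>\<^sup>+ t. ennreal (?c * t powr (- ?\<gamma>)) * indicator {0<..} t * ennreal (t * indicator {\<tau>..} t) \<partial>lborel)"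
    by (rule nn_integral_newton[OF N]) measurable
  also have "\<dots> = (\<integral>\<^sup>+ t. ennreal (?c * t powr (1 - ?\<gamma>)) * indicator {\<tau>..} t \<partial>lborel)"
  proof (rule nn_integral_cong)
    fix t :: real
    show "ennreal (?c * t powr (- ?\<gamma>)) * indicator {0<..} t * ennreal (t * indicator {\<tau>..} t)
        = ennreal (?c * t powr (1 - ?\<gamma>)) * indicator {\<tau>..} t"
    proof (cases "t \<ge> \<tau>")
      case True
      then have t: "t > 0" using \<tau> by simp
      have "t * t powr (- ?\<gamma>) = t powr (1 - ?\<gamma>)"
        using t powr_mult_base[of t "- ?\<gamma>"] by (simp add: add.commute)
      then have "?c * t powr (- ?\<gamma>) * t = ?c * t powr (1 - ?\<gamma>)" by (simp add: mult_ac)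
      moreover have "ennreal (?c * t powr (- ?\<gamma>)) * ennreal t = ennreal (?c * t powr (- ?\<gamma>) * t)"
        using c t by (intro ennreal_mult[symmetric]) auto
      ultimately have "ennreal (?c * t powr (- ?\<gamma>)) * ennreal t = ennreal (?c * t powr (1 - ?\<gamma>))"
        by (simp only:)
      then show ?thesis using True t by simp
    qed simp
  qed
  also have "\<dots> = ennreal (0 - ?c / (2 - ?\<gamma>) * \<tau> powr (2 - ?\<gamma>))"
  proof (rule nn_integral_FTC_atLeast)
    fix t assume t: "\<tau> \<le> t"
    have "((\<lambda>t. ?c / (2 - ?\<gamma>) * t powr (2 - ?\<gamma>)) has_real_derivative
        ?c / (2 - ?\<gamma>) * ((2 - ?\<gamma>) * t powr (2 - ?\<gamma> - 1))) (at t)"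
      using t \<tau> by (intro DERIV_cmult has_real_derivative_powr) auto
    moreover have "?c / (2 - ?\<gamma>) * ((2 - ?\<gamma>) * t powr (2 - ?\<gamma> - 1)) = ?c * t powr (1 - ?\<gamma>)"
      using \<gamma> by simp
    ultimately show "((\<lambda>t. ?c / (2 - ?\<gamma>) * t powr (2 - ?\<gamma>)) has_real_derivative ?c * t powr (1 - ?\<gamma>)) (at t)"
      by simp
    show "0 \<le> ?c * t powr (1 - ?\<gamma>)" using c by simp
  next
    have "((\<lambda>t. ?c / (2 - ?\<gamma>) * t powr (2 - ?\<gamma>)) \<longlongrightarrow> ?c / (2 - ?\<gamma>) * 0) at_top"
      using \<gamma> by (intro tendsto_intros tendsto_neg_powr filterlim_ident) auto
    then show "((\<lambda>t. ?c / (2 - ?\<gamma>) * t powr (2 - ?\<gamma>)) \<longlongrightarrow> 0) at_top" by simp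
  qed simp
  finally have "(\<integral>\<^sup>+ (x::'a). ennreal (newton x * indicator {\<tau>..} (newton x)) \<partial>lborel) < \<infinity>" by simp
  then have "integrable lborel (\<lambda>x::'a. newton x * indicator {\<tau>..} (newton x))"
    using pos by (intro integrableI_nonneg) auto
  then have "integrable lborel (\<lambda>x::'a. M * (newton x * indicator {\<tau>..} (newton x)))"
    by (rule integrable_mult_right)
  then show ?thesis by (rule integrable_completion[THEN iffD2, rotated]) measurable
qed

section \<open>Convergence of the differences in the two target norms\<close>

context
  fixes d :: "nat \<Rightarrow> 'a::euclidean_space \<Rightarrow> real" and C :: real
  assumes N: "DIM('a) \<ge> 3" and C: "C \<ge> 0"
    and dm [measurable]: "\<And>k. d k \<in> borel_measurable lebesgue"
    and lim: "AE x in lebesgue. (\<lambda>k. d k x) \<longlonglongrightarrow> 0"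
    and dom: "\<And>k. AE x in lebesgue. \<bar>d k x\<bar> \<le> C * sqrt (newton x)"
begin

text \<open>Near the origin, where \<open>newton x \<ge> \<tau>\<close>, the squared envelope is an
  integrable majorant. Elsewhere |d| \<le> C sqrt(\<tau>), so |d|^2 is at most (C
  sqrt(\<tau>))^(2-s) |d|^s, with integral at most \<epsilon> for small \<tau>.\<close>

lemma radial_L2_convergence:
  assumes s: "0 < s" "s < 2" and E: "E \<ge> 0" "\<And>k. (\<integral>\<^sup>+ x. ennreal (\<bar>d k x\<bar> powr s) \<partial>lebesgue) \<le> ennreal E"
  shows "(\<lambda>k. \<integral>\<^sup>+ x. ennreal (\<bar>d k x\<bar> powr 2) \<partial>lebesgue) \<longlonglongrightarrow> 0"
proof (rule nn_integral_tendsto_0_if_dominated_up_to_eps)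
  show "(\<lambda>x. \<bar>d k x\<bar> powr 2) \<in> borel_measurable lebesgue" for k by measurable
  show "AE x in lebesgue. (\<lambda>k. \<bar>d k x\<bar> powr 2) \<longlonglongrightarrow> 0"
    using lim
  proof eventually_elim
    case (elim x)
    have "(\<lambda>k. \<bar>d k x\<bar> powr 2) \<longlonglongrightarrow> \<bar>0\<bar> powr 2"
      by (intro tendsto_powr' tendsto_rabs elim tendsto_const) auto
    then show ?case by simp
  qed
  fix \<epsilon> :: real assume \<epsilon>: "\<epsilon> > 0"
  obtain \<tau> where \<tau>: "\<tau> > 0" "(C * sqrt \<tau>) powr (2 - s) * E \<le> \<epsilon>"
    using exists_small_powr[OF C _ E(1) \<epsilon>, of "2 - s"] s by auto
  let ?D = "\<lambda>x::'a. C\<^sup>2 * (newton x * indicator {\<tau>..} (newton x))"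
  let ?w = "(C * sqrt \<tau>) powr (2 - s)"
  let ?e = "\<lambda>k x. ennreal ?w * ennreal (\<bar>d k x\<bar> powr s)"
  show "\<exists>D. integrable lebesgue D \<and> (\<forall>x. 0 \<le> D x) \<and>
      (\<forall>k. \<exists>e\<in>borel_measurable lebesgue. (AE x in lebesgue. ennreal (\<bar>d k x\<bar> powr 2) \<le> ennreal (D x) + e x) \<and>
        (\<integral>\<^sup>+ x. e x \<partial>lebesgue) \<le> ennreal \<epsilon>)"
  proof (intro exI[of _ ?D] conjI allI bexI)
    show "integrable lebesgue ?D" by (rule newton_locally_integrable[OF N \<tau>(1)])
    show "0 \<le> ?D x" for x by (simp add: newton_def)
    fix k
    show "?e k \<in> borel_measurable lebesgue" by measurable
    show "AE x in lebesgue. ennreal (\<bar>d k x\<bar> powr 2) \<le> ennreal (?D x) + ?e k x"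
      using dom[of k]
    proof eventually_elim
      case (elim x)
      have k0: "newton x \<ge> 0" by (simp add: newton_def)
      show ?case
      proof (cases "newton x \<ge> \<tau>")
        case True
        have "(\<bar>d k x\<bar>)\<^sup>2 \<le> (C * sqrt (newton x))\<^sup>2"
          using elim by (intro power_mono) auto
        then have "ennreal (\<bar>d k x\<bar> powr 2) \<le> ennreal (?D x)"
          using True k0 by (intro ennreal_leI) (simp add: power_mult_distrib)
        then show ?thesis by (simp add: add_increasing2)
      next
        case False
        have "\<bar>d k x\<bar> \<le> C * sqrt \<tau>"
          using elim False C mult_left_mono[of "sqrt (newton x)" "sqrt \<tau>" C] by simp
        then have "\<bar>d k x\<bar> powr (2 - s) \<le> ?w" using s by (intro powr_mono2) auto
        then have "\<bar>d k x\<bar> powr (2 - s) * \<bar>d k x\<bar> powr s \<le> ?w * \<bar>d k x\<bar> powr s"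
          by (intro mult_right_mono) auto
        moreover have "\<bar>d k x\<bar> powr (2 - s) * \<bar>d k x\<bar> powr s = \<bar>d k x\<bar> powr 2"
          by (simp only: powr_add[symmetric]) simp
        ultimately have "ennreal (\<bar>d k x\<bar> powr 2) \<le> ?e k x"
          by (simp only: ennreal_mult''[OF powr_ge_zero, symmetric] ennreal_leI)
        then show ?thesis by (simp add: add_increasing)
      qed
    qed
    have "(\<integral>\<^sup>+ x. ?e k x \<partial>lebesgue) = ennreal ?w * (\<integral>\<^sup>+ x. ennreal (\<bar>d k x\<bar> powr s) \<partial>lebesgue)"
      by (rule nn_integral_cmult) measurable
    also have "\<dots> \<le> ennreal ?w * ennreal E" by (intro mult_left_mono E) auto
    also have "\<dots> = ennreal (?w * E)" using E by (simp add: ennreal_mult)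
    also have "\<dots> \<le> ennreal \<epsilon>" by (intro ennreal_leI \<tau>)
    finally show "(\<integral>\<^sup>+ x. ?e k x \<partial>lebesgue) \<le> ennreal \<epsilon>" .
  qed
qed simp

text \<open>Three regions. Where \<open>newton x < \<tau>\<close>, |d|^r is a small multiple of
  |d|^2. Where |d| > M, it is at most M^(r-s) |d|^s, small for large M since r < s; this excludes
  concentration. The rest lies in a bounded set and is dominated by M^r.\<close>

lemma radial_Lr_convergence:
  assumes r: "2 < r" "r < s"
    and E: "E \<ge> 0" "\<And>k. (\<integral>\<^sup>+ x. ennreal (\<bar>d k x\<bar> powr 2) \<partial>lebesgue) \<le> ennreal E"
      "\<And>k. (\<integral>\<^sup>+ x. ennreal (\<bar>d k x\<bar> powr s) \<partial>lebesgue) \<le> ennreal E"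
  shows "(\<lambda>k. \<integral>\<^sup>+ x. ennreal (\<bar>d k x\<bar> powr r) \<partial>lebesgue) \<longlonglongrightarrow> 0"
proof (rule nn_integral_tendsto_0_if_dominated_up_to_eps)
  show "(\<lambda>x. \<bar>d k x\<bar> powr r) \<in> borel_measurable lebesgue" for k by measurable
  show "AE x in lebesgue. (\<lambda>k. \<bar>d k x\<bar> powr r) \<longlonglongrightarrow> 0"
    using lim
  proof eventually_elim
    case (elim x)
    have "(\<lambda>k. \<bar>d k x\<bar> powr r) \<longlonglongrightarrow> \<bar>0\<bar> powr r"
      using r by (intro tendsto_powr' tendsto_rabs elim tendsto_const) auto
    then show ?case using r by simp
  qed
  fix \<epsilon> :: real assume \<epsilon>: "\<epsilon> > 0"
  obtain \<tau> where \<tau>: "\<tau> > 0" "(C * sqrt \<tau>) powr (r - 2) * E \<le> \<epsilon> / 2"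
    using exists_small_powr[OF C _ E(1), of "r - 2" "\<epsilon> / 2"] r \<epsilon> by auto
  \<comment> \<open>Solves \<open>M powr (r - s) = \<epsilon> / (2 * (E + 1))\<close>; the exponent
    \<open>r - s\<close> is negative, so \<open>M\<close> is large for small \<epsilon>.\<close>
  define M where "M = (\<epsilon> / (2 * (E + 1))) powr (1 / (r - s))"
  have M: "M > 0" "M powr (r - s) * E \<le> \<epsilon> / 2"
  proof -
    show "M > 0" using \<epsilon> E by (simp add: M_def)
    have eq: "M powr (r - s) = \<epsilon> / (2 * (E + 1))" using \<epsilon> E r by (simp add: M_def powr_powr)
    have "M powr (r - s) * E \<le> M powr (r - s) * (E + 1)" by (intro mult_left_mono) auto
    also have "\<dots> = \<epsilon> / 2" unfolding eq using E(1) by (simp add: divide_simps)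
    finally show "M powr (r - s) * E \<le> \<epsilon> / 2" .
  qed
  let ?D = "\<lambda>x::'a. M powr r * indicator {x. newton x \<ge> \<tau>} x"
  let ?w = "(C * sqrt \<tau>) powr (r - 2)" and ?z = "M powr (r - s)"
  let ?e1 = "\<lambda>k x. ennreal ?w * ennreal (\<bar>d k x\<bar> powr 2)"
  let ?e2 = "\<lambda>k x. ennreal ?z * ennreal (\<bar>d k x\<bar> powr s)"
  show "\<exists>D. integrable lebesgue D \<and> (\<forall>x. 0 \<le> D x) \<and>
      (\<forall>k. \<exists>e\<in>borel_measurable lebesgue. (AE x in lebesgue. ennreal (\<bar>d k x\<bar> powr r) \<le> ennreal (D x) + e x) \<and>
        (\<integral>\<^sup>+ x. e x \<partial>lebesgue) \<le> ennreal \<epsilon>)"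
  proof (rule exI[of _ ?D], intro conjI allI)
    show "integrable lebesgue ?D" by (rule newton_superlevel_finite[OF N \<tau>(1)])
    show "0 \<le> ?D x" for x by simp
    fix k
    show "\<exists>e\<in>borel_measurable lebesgue. (AE x in lebesgue. ennreal (\<bar>d k x\<bar> powr r) \<le> ennreal (?D x) + e x) \<and>
        (\<integral>\<^sup>+ x. e x \<partial>lebesgue) \<le> ennreal \<epsilon>"
    proof (rule bexI[of _ "\<lambda>x. ?e1 k x + ?e2 k x"], rule conjI)
      show "(\<lambda>x. ?e1 k x + ?e2 k x) \<in> borel_measurable lebesgue" by measurable
      show "AE x in lebesgue. ennreal (\<bar>d k x\<bar> powr r) \<le> ennreal (?D x) + (?e1 k x + ?e2 k x)"
        using dom[of k]
      proof eventually_elim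
        case (elim x)
        consider "newton x < \<tau>" | "newton x \<ge> \<tau>" "\<bar>d k x\<bar> \<le> M" | "M < \<bar>d k x\<bar>" by linarith
        then show ?case
        proof cases
          case 1
          have "\<bar>d k x\<bar> \<le> C * sqrt \<tau>"
            using elim 1 C mult_left_mono[of "sqrt (newton x)" "sqrt \<tau>" C] by simp
          then have "\<bar>d k x\<bar> powr (r - 2) \<le> ?w" using r by (intro powr_mono2) auto
          then have "\<bar>d k x\<bar> powr (r - 2) * \<bar>d k x\<bar> powr 2 \<le> ?w * \<bar>d k x\<bar> powr 2"
            by (intro mult_right_mono) auto
          moreover have "\<bar>d k x\<bar> powr (r - 2) * \<bar>d k x\<bar> powr 2 = \<bar>d k x\<bar> powr r"
            by (simp only: powr_add[symmetric]) simp
          ultimately have "ennreal (\<bar>d k x\<bar> powr r) \<le> ?e1 k x"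
            by (simp only: ennreal_mult''[OF powr_ge_zero, symmetric] ennreal_leI)
          also have "\<dots> \<le> ennreal (?D x) + (?e1 k x + ?e2 k x)"
            by (intro add_increasing add_increasing2) auto
          finally show ?thesis .
        next
          case 2
          then have "ennreal (\<bar>d k x\<bar> powr r) \<le> ennreal (?D x)"
            using r by (auto intro!: ennreal_leI powr_mono2)
          then show ?thesis by (rule order_trans) (intro add_increasing2, auto)
        next
          case 3
          then have "\<bar>d k x\<bar> powr (r - s) \<le> ?z" using r M(1) by (intro powr_mono2') auto
          then have "\<bar>d k x\<bar> powr (r - s) * \<bar>d k x\<bar> powr s \<le> ?z * \<bar>d k x\<bar> powr s"
            by (intro mult_right_mono) auto
          moreover have "\<bar>d k x\<bar> powr (r - s) * \<bar>d k x\<bar> powr s = \<bar>d k x\<bar> powr r"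
            by (simp only: powr_add[symmetric]) simp
          ultimately have "ennreal (\<bar>d k x\<bar> powr r) \<le> ?e2 k x"
            by (simp only: ennreal_mult''[OF powr_ge_zero, symmetric] ennreal_leI)
          also have "\<dots> \<le> ennreal (?D x) + (?e1 k x + ?e2 k x)"
            by (intro add_increasing) auto
          finally show ?thesis .
        qed
      qed
      have "(\<integral>\<^sup>+ x. ?e1 k x + ?e2 k x \<partial>lebesgue) = (\<integral>\<^sup>+ x. ?e1 k x \<partial>lebesgue) + (\<integral>\<^sup>+ x. ?e2 k x \<partial>lebesgue)"
        by (rule nn_integral_add) measurable
      also have "\<dots> = ennreal ?w * (\<integral>\<^sup>+ x. ennreal (\<bar>d k x\<bar> powr 2) \<partial>lebesgue)
          + ennreal ?z * (\<integral>\<^sup>+ x. ennreal (\<bar>d k x\<bar> powr s) \<partial>lebesgue)"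
        by (intro arg_cong2[where f = "(+)"] nn_integral_cmult) measurable
      also have "\<dots> \<le> ennreal ?w * ennreal E + ennreal ?z * ennreal E"
        by (intro add_mono mult_left_mono E) auto
      also have "\<dots> = ennreal (?w * E + ?z * E)" using E by (simp add: ennreal_mult)
      also have "\<dots> \<le> ennreal \<epsilon>" using \<tau> M by (intro ennreal_leI) auto
      finally show "(\<integral>\<^sup>+ x. ?e1 k x + ?e2 k x \<partial>lebesgue) \<le> ennreal \<epsilon>" .
    qed
  qed
qed simp

end

section \<open>From convergence of integrals to compact embeddings\<close>

lemma Lp_norm_less_top_iff: "Lp_norm r u < \<infinity> \<longleftrightarrow> (\<integral>\<^sup>+ x. ennreal (\<bar>u x\<bar> powr r) \<partial>lebesgue) < \<infinity>"
  by (simp only: Lp_norm_def ennpow_less_top_iff)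

lemma Lp_norm_tendsto_0I:
  assumes r: "r > 0" and lim: "(\<lambda>k. \<integral>\<^sup>+ x. ennreal (\<bar>d k x\<bar> powr r) \<partial>lebesgue) \<longlonglongrightarrow> 0"
  shows "(\<lambda>k. Lp_norm r (d k)) \<longlonglongrightarrow> 0"
proof (rule ennreal_tendsto_0I)
  fix \<epsilon> :: real assume \<epsilon>: "\<epsilon> > 0"
  have "eventually (\<lambda>k. (\<integral>\<^sup>+ x. ennreal (\<bar>d k x\<bar> powr r) \<partial>lebesgue) < ennreal (\<epsilon> powr r)) sequentially"
    using \<epsilon> by (intro order_tendstoD(2)[OF lim]) simp
  then show "eventually (\<lambda>k. Lp_norm r (d k) \<le> ennreal \<epsilon>) sequentially"
  proof eventually_elim
    case (elim k)
    then have "Lp_norm r (d k) \<le> ennpow (ennreal (\<epsilon> powr r)) (1 / r)"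
      unfolding Lp_norm_def using r by (intro ennpow_mono) auto
    also have "\<dots> = ennreal \<epsilon>" using r \<epsilon> by (simp add: ennpow_def powr_powr)
    finally show ?case .
  qed
qed

lemma finite_ennreal_bound:
  assumes "x < (\<infinity> :: ennreal)"
  obtains C :: real where "C \<ge> 0" "x \<le> ennreal C"
  using assms by (cases x) auto

lemma H1_rad_lorentz_Lp_bound:
  assumes p: "p > 0" and q: "1 \<le> q" and s: "(p < s \<and> s \<le> 2) \<or> (2 \<le> s \<and> s < p)"
    and K: "K \<ge> 0" and L: "L \<ge> 0"
  obtains E :: real where "E \<ge> 0"
    "\<And>u::'a::euclidean_space \<Rightarrow> real. u \<in> H1_rad \<Longrightarrow> H1_norm u \<le> ennreal K \<Longrightarrow>
      lorentz_norm p q u \<le> ennreal L \<Longrightarrow> (\<integral>\<^sup>+ x. ennreal (\<bar>u x\<bar> powr s) \<partial>lebesgue) \<le> ennreal E"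
proof -
  obtain B :: real where B: "B \<ge> 0"
    "\<And>(u::'a \<Rightarrow> real) l. u \<in> borel_measurable lebesgue \<Longrightarrow> lorentz_norm p q u \<le> ennreal L \<Longrightarrow> l > 0 \<Longrightarrow>
      emeasure lebesgue {x. \<bar>u x\<bar> > l} \<le> ennreal (B * l powr (- p))"
    using lorentz_norm_imp_weak_Lp[OF p q L, where 'a = 'a] by blast
  have "K\<^sup>2 \<ge> 0" by simp
  from weak_Lp_interpolation[OF B(1) this s p, where 'a = 'a]
  obtain E :: real where E: "E \<ge> 0"
    "\<And>u::'a \<Rightarrow> real. u \<in> borel_measurable lebesgue \<Longrightarrow>
      (\<And>l. l > 0 \<Longrightarrow> emeasure lebesgue {x. \<bar>u x\<bar> > l} \<le> ennreal (B * l powr (- p))) \<Longrightarrow>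
      (\<integral>\<^sup>+ x. ennreal ((u x)\<^sup>2) \<partial>lebesgue) \<le> ennreal (K\<^sup>2) \<Longrightarrow>
      (\<integral>\<^sup>+ x. ennreal (\<bar>u x\<bar> powr s) \<partial>lebesgue) \<le> ennreal E"
    by blast
  show ?thesis
  proof (rule that[OF E(1)])
    fix u :: "'a \<Rightarrow> real"
    assume u: "u \<in> H1_rad" "H1_norm u \<le> ennreal K" "lorentz_norm p q u \<le> ennreal L"
    have m: "u \<in> borel_measurable lebesgue"
      using u(1) by (auto simp: H1_rad_def intro: H1_space_measurable)
    show "(\<integral>\<^sup>+ x. ennreal (\<bar>u x\<bar> powr s) \<partial>lebesgue) \<le> ennreal E"
      by (rule E(2)[OF m B(2)[OF m u(3)] H1_norm_leD(1)[OF u(2) K]])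
  qed
qed

lemma nn_integral_diff_powr_bound:
  fixes u v :: "'a \<Rightarrow> real"
  assumes [measurable]: "u \<in> borel_measurable M" "v \<in> borel_measurable M"
    and s: "s > 0" and E: "E \<ge> 0"
    and u: "(\<integral>\<^sup>+ x. ennreal (\<bar>u x\<bar> powr s) \<partial>M) \<le> ennreal E"
    and v: "(\<integral>\<^sup>+ x. ennreal (\<bar>v x\<bar> powr s) \<partial>M) \<le> ennreal E"
  shows "(\<integral>\<^sup>+ x. ennreal (\<bar>u x - v x\<bar> powr s) \<partial>M) \<le> ennreal (2 powr s * (E + E))"
proof -
  have "(\<integral>\<^sup>+ x. ennreal (\<bar>u x - v x\<bar> powr s) \<partial>M) \<le>
      (\<integral>\<^sup>+ x. ennreal (2 powr s) * (ennreal (\<bar>u x\<bar> powr s) + ennreal (\<bar>v x\<bar> powr s)) \<partial>M)"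
    using abs_diff_powr_le[OF s]
    by (intro nn_integral_mono) (simp add: ennreal_mult[symmetric] ennreal_plus[symmetric] ennreal_leI del: ennreal_plus)
  also have "\<dots> = ennreal (2 powr s) * ((\<integral>\<^sup>+ x. ennreal (\<bar>u x\<bar> powr s) \<partial>M) + (\<integral>\<^sup>+ x. ennreal (\<bar>v x\<bar> powr s) \<partial>M))"
    by (subst nn_integral_cmult) (auto simp: nn_integral_add)
  also have "\<dots> \<le> ennreal (2 powr s) * (ennreal E + ennreal E)"
    using u v by (intro mult_left_mono add_mono) auto
  also have "\<dots> = ennreal (2 powr s * (E + E))"
    using E by (simp add: ennreal_mult[symmetric] ennreal_plus[symmetric] del: ennreal_plus)
  finally show ?thesis .
qed

lemma H1_norm_less_top:
  assumes "u \<in> H1_space"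
  shows "H1_norm u < \<infinity>"
proof -
  have fin: "(Lp_norm 2 w)\<^sup>2 < \<infinity>" if "w \<in> Lp_space 2" for w :: "'a \<Rightarrow> real"
    using that by (auto simp: Lp_space_def power2_eq_square ennreal_mult_less_top)
  have "(Lp_norm 2 (weak_partial b u))\<^sup>2 < \<infinity>" if "b \<in> Basis" for b
    using H1_space_weak_partial(1)[OF assms that] by (rule fin)
  then have "(\<Sum>b\<in>Basis. (Lp_norm 2 (weak_partial b u))\<^sup>2) < \<infinity>"
    by (simp add: less_top)
  moreover have "(Lp_norm 2 u)\<^sup>2 < \<infinity>"
    using assms by (intro fin) (simp add: H1_space_def)
  ultimately show ?thesis
    unfolding H1_norm_def ennpow_less_top_iff by simp
qed

lemma H1_rad_lorentz_subset_Lp: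
  assumes p: "p > 0" and q: "1 \<le> q" and s: "(p < s \<and> s \<le> 2) \<or> (2 \<le> s \<and> s < p)"
  shows "H1_rad \<inter> lorentz_space p q \<subseteq> (Lp_space s :: ('a::euclidean_space \<Rightarrow> real) set)"
proof
  fix u :: "'a \<Rightarrow> real" assume u: "u \<in> H1_rad \<inter> lorentz_space p q"
  then have H: "u \<in> H1_space" by (simp add: H1_rad_def)
  obtain K where K: "K \<ge> 0" "H1_norm u \<le> ennreal K"
    using finite_ennreal_bound[OF H1_norm_less_top[OF H]] by blast
  obtain L where L: "L \<ge> 0" "lorentz_norm p q u \<le> ennreal L"
    using u finite_ennreal_bound[of "lorentz_norm p q u"] by (auto simp: lorentz_space_def)
  obtain E :: real where "(\<integral>\<^sup>+ x. ennreal (\<bar>u x\<bar> powr s) \<partial>lebesgue) \<le> ennreal E"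
    using H1_rad_lorentz_Lp_bound[OF p q s K(1) L(1), where 'a = 'a] u K(2) L(2) by blast
  then have "Lp_norm s u < \<infinity>"
    unfolding Lp_norm_less_top_iff by (rule le_less_trans) simp
  then show "u \<in> Lp_space s" using H1_space_measurable[OF H] by (simp add: Lp_space_def)
qed

text \<open>Common frame of both embeddings, with target exponent \<open>r\<close> and auxiliary
  exponent \<open>s\<close>. A subsequence and its almost everywhere limit come from the radial
  structure; Fatou transfers the L^2 and L^s bounds to the limit and hence to the differences
  \<open>d\<close>. Only the convergence argument \<open>conv\<close> separates the two
  cases.\<close>

lemma compact_embedding_criterion:
  assumes N: "DIM('a::euclidean_space) \<ge> 3" and p: "p > 0" and q: "1 \<le> q"
    and r: "r > 0" "(p < r \<and> r \<le> 2) \<or> (2 \<le> r \<and> r < p)"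
    and s: "s > 0" "(p < s \<and> s \<le> 2) \<or> (2 \<le> s \<and> s < p)"
    and conv: "\<And>(d :: nat \<Rightarrow> 'a \<Rightarrow> real) C E.
      C \<ge> 0 \<Longrightarrow> E \<ge> 0 \<Longrightarrow> (\<And>k. d k \<in> borel_measurable lebesgue) \<Longrightarrow>
      (AE x in lebesgue. (\<lambda>k. d k x) \<longlonglongrightarrow> 0) \<Longrightarrow>
      (\<And>k. AE x in lebesgue. \<bar>d k x\<bar> \<le> C * sqrt (newton x)) \<Longrightarrow>
      (\<And>k. (\<integral>\<^sup>+ x. ennreal (\<bar>d k x\<bar> powr 2) \<partial>lebesgue) \<le> ennreal E) \<Longrightarrow>
      (\<And>k. (\<integral>\<^sup>+ x. ennreal (\<bar>d k x\<bar> powr s) \<partial>lebesgue) \<le> ennreal E) \<Longrightarrow>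
      (\<lambda>k. \<integral>\<^sup>+ x. ennreal (\<bar>d k x\<bar> powr r) \<partial>lebesgue) \<longlonglongrightarrow> 0"
  shows "compact_embedding_Int (H1_rad :: ('a \<Rightarrow> real) set) H1_norm
    (lorentz_space p q) (lorentz_norm p q) (Lp_space r) (Lp_norm r)"
  unfolding compact_embedding_Int_def
proof (intro conjI allI impI)
  show "H1_rad \<inter> lorentz_space p q \<subseteq> (Lp_space r :: ('a \<Rightarrow> real) set)"
    by (rule H1_rad_lorentz_subset_Lp[OF p q r(2)])
next
  fix u :: "nat \<Rightarrow> 'a \<Rightarrow> real"
  assume *: "(\<forall>k. u k \<in> H1_rad \<inter> lorentz_space p q) \<and> (\<exists>C::real. \<forall>k. H1_norm (u k) \<le> ennreal C) \<and>
    (\<exists>C::real. \<forall>k. lorentz_norm p q (u k) \<le> ennreal C)"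
  then have u: "u k \<in> H1_rad" for k by blast
  have um: "u k \<in> borel_measurable lebesgue" for k
    using u[of k] by (auto simp: H1_rad_def intro: H1_space_measurable)
  from * obtain K0 L0 :: real where KL0: "\<And>k. H1_norm (u k) \<le> ennreal K0" "\<And>k. lorentz_norm p q (u k) \<le> ennreal L0"
    by (elim conjE exE) blast
  \<comment> \<open>The constants in the definition of boundedness are arbitrary reals, possibly
    negative.\<close>
  define K L where "K = max K0 0" and "L = max L0 0"
  have K: "K \<ge> 0" "H1_norm (u k) \<le> ennreal K" and L: "L \<ge> 0" "lorentz_norm p q (u k) \<le> ennreal L" for k
    using order_trans[OF KL0(1)[of k] ennreal_leI[of K0 K]] order_trans[OF KL0(2)[of k] ennreal_leI[of L0 L]]
    by (auto simp: K_def L_def)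
  have "\<exists>\<sigma> v C. strict_mono \<sigma> \<and> v \<in> borel_measurable lebesgue \<and> C \<ge> 0 \<and>
      (AE x in lebesgue. (\<lambda>k. u (\<sigma> k) x) \<longlonglongrightarrow> v x) \<and>
      (\<forall>k. AE x in lebesgue. \<bar>u (\<sigma> k) x - v x\<bar> \<le> C * sqrt (newton x))"
    by (rule H1_rad_bounded_subsequence[where u = u and K = K, OF N u K(2) K(1)]) blast
  then obtain \<sigma> v C where \<sigma>: "strict_mono \<sigma>" and vm: "v \<in> borel_measurable lebesgue" and C: "C \<ge> 0"
    and lim: "AE x in lebesgue. (\<lambda>k. u (\<sigma> k) x) \<longlonglongrightarrow> v x"
    and dom: "\<And>k. AE x in lebesgue. \<bar>u (\<sigma> k) x - v x\<bar> \<le> C * sqrt (newton x)"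
    by blast
  have bound: "\<exists>E\<ge>0. \<forall>k. (\<integral>\<^sup>+ x. ennreal (\<bar>u k x\<bar> powr t) \<partial>lebesgue) \<le> ennreal E"
    if t: "(p < t \<and> t \<le> 2) \<or> (2 \<le> t \<and> t < p)" for t
  proof (rule H1_rad_lorentz_Lp_bound[OF p q t K(1) L(1), where 'a = 'a])
    fix E :: real
    assume E: "E \<ge> 0" "\<And>u::'a \<Rightarrow> real. u \<in> H1_rad \<Longrightarrow> H1_norm u \<le> ennreal K \<Longrightarrow>
      lorentz_norm p q u \<le> ennreal L \<Longrightarrow> (\<integral>\<^sup>+ x. ennreal (\<bar>u x\<bar> powr t) \<partial>lebesgue) \<le> ennreal E"
    show ?thesis using E(1) E(2)[OF u K(2) L(2)] by blast
  qed
  from bound[OF r(2)] obtain Er where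
    Er: "Er \<ge> 0" "\<And>k. (\<integral>\<^sup>+ x. ennreal (\<bar>u k x\<bar> powr r) \<partial>lebesgue) \<le> ennreal Er"
    by blast
  from bound[OF s(2)] obtain Es where
    Es: "Es \<ge> 0" "\<And>k. (\<integral>\<^sup>+ x. ennreal (\<bar>u k x\<bar> powr s) \<partial>lebesgue) \<le> ennreal Es"
    by blast
  have E2: "K\<^sup>2 \<ge> 0" "(\<integral>\<^sup>+ x. ennreal (\<bar>u k x\<bar> powr 2) \<partial>lebesgue) \<le> ennreal (K\<^sup>2)" for k
    using H1_norm_leD(1)[OF K(2) K(1)] by simp_all
  note bound_v = nn_integral_bound_AE_limit[OF um lim]
  have "(\<integral>\<^sup>+ x. ennreal (\<bar>v x\<bar> powr r) \<partial>lebesgue) \<le> ennreal Er"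
    by (rule bound_v) (use Er r in auto)
  then have "Lp_norm r v < \<infinity>"
    unfolding Lp_norm_less_top_iff by (rule le_less_trans) simp
  then have vY: "v \<in> Lp_space r" using vm by (simp add: Lp_space_def)
  let ?d = "\<lambda>k x. u (\<sigma> k) x - v x"
  define E where "E = max (2 powr 2 * (K\<^sup>2 + K\<^sup>2)) (2 powr s * (Es + Es))"
  have "(\<lambda>k. \<integral>\<^sup>+ x. ennreal (\<bar>?d k x\<bar> powr r) \<partial>lebesgue) \<longlonglongrightarrow> 0"
  proof (rule conv[OF C _ _ _ dom])
    show "E \<ge> 0" by (simp add: E_def le_max_iff_disj)
    show "?d k \<in> borel_measurable lebesgue" for k
      using um vm by (rule borel_measurable_diff)
    show "AE x in lebesgue. (\<lambda>k. ?d k x) \<longlonglongrightarrow> 0"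
      using lim by eventually_elim (simp add: LIM_zero)
    show "(\<integral>\<^sup>+ x. ennreal (\<bar>?d k x\<bar> powr 2) \<partial>lebesgue) \<le> ennreal E" for k
    proof -
      have "(\<integral>\<^sup>+ x. ennreal (\<bar>v x\<bar> powr 2) \<partial>lebesgue) \<le> ennreal (K\<^sup>2)"
        by (rule bound_v[OF E2(2)]) simp
      then have "(\<integral>\<^sup>+ x. ennreal (\<bar>?d k x\<bar> powr 2) \<partial>lebesgue) \<le> ennreal (2 powr 2 * (K\<^sup>2 + K\<^sup>2))"
        by (intro nn_integral_diff_powr_bound um vm E2) auto
      also have "\<dots> \<le> ennreal E" by (intro ennreal_leI) (simp add: E_def)
      finally show ?thesis .
    qed
    show "(\<integral>\<^sup>+ x. ennreal (\<bar>?d k x\<bar> powr s) \<partial>lebesgue) \<le> ennreal E" for k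
    proof -
      have "(\<integral>\<^sup>+ x. ennreal (\<bar>v x\<bar> powr s) \<partial>lebesgue) \<le> ennreal Es"
        by (rule bound_v[OF Es(2) s(1)])
      then have "(\<integral>\<^sup>+ x. ennreal (\<bar>?d k x\<bar> powr s) \<partial>lebesgue) \<le> ennreal (2 powr s * (Es + Es))"
        by (intro nn_integral_diff_powr_bound um vm Es s)
      also have "\<dots> \<le> ennreal E" by (intro ennreal_leI) (simp add: E_def)
      finally show ?thesis .
    qed
  qed
  then have "(\<lambda>k. Lp_norm r (?d k)) \<longlonglongrightarrow> 0"
    by (rule Lp_norm_tendsto_0I[OF r(1)])
  with \<sigma> vY show "\<exists>\<sigma> v. strict_mono \<sigma> \<and> v \<in> Lp_space r \<and> (\<lambda>k. Lp_norm r (\<lambda>x. u (\<sigma> k) x - v x)) \<longlonglongrightarrow> 0"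
    by blast
qed

theorem theorem2:
  fixes q :: ennreal
  assumes "CARD('n::finite) \<ge> 3" and "1 \<le> q"
  shows
    "(\<forall>p::real. 1 \<le> p \<and> p < 2 \<longrightarrow>
        compact_embedding_Int (H1_rad :: (real ^ 'n \<Rightarrow> real) set) H1_norm
          (lorentz_space p q) (lorentz_norm p q)
          (Lp_space 2) (Lp_norm 2)) \<and>
     (\<forall>p::real. sobolev_exponent CARD('n) < p \<longrightarrow>
        compact_embedding_Int (H1_rad :: (real ^ 'n \<Rightarrow> real) set) H1_norm
          (lorentz_space p q) (lorentz_norm p q)
          (Lp_space (sobolev_exponent CARD('n))) (Lp_norm (sobolev_exponent CARD('n))))"
proof (intro conjI allI impI)
  have N: "DIM(real ^ 'n) \<ge> 3" using assms(1) by simp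
  fix p :: real assume p: "1 \<le> p \<and> p < 2"
  show "compact_embedding_Int (H1_rad :: (real ^ 'n \<Rightarrow> real) set) H1_norm
      (lorentz_space p q) (lorentz_norm p q) (Lp_space 2) (Lp_norm 2)"
  \<comment> \<open>The midpoint lies strictly between \<open>p\<close> and 2: above
    \<open>p\<close>, so that the weak L^p bound controls L^s, and below 2, so that the tails gain a
    positive power of the envelope.\<close>
  proof (rule compact_embedding_criterion[OF N _ assms(2), where s = "(p + 2) / 2"])
    fix d :: "nat \<Rightarrow> real ^ 'n \<Rightarrow> real" and C E :: real
    assume d: "C \<ge> 0" "E \<ge> 0" "\<And>k. d k \<in> borel_measurable lebesgue"
      "AE x in lebesgue. (\<lambda>k. d k x) \<longlonglongrightarrow> 0"
      "\<And>k. AE x in lebesgue. \<bar>d k x\<bar> \<le> C * sqrt (newton x)"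
      "\<And>k. (\<integral>\<^sup>+ x. ennreal (\<bar>d k x\<bar> powr ((p + 2) / 2)) \<partial>lebesgue) \<le> ennreal E"
    show "(\<lambda>k. \<integral>\<^sup>+ x. ennreal (\<bar>d k x\<bar> powr 2) \<partial>lebesgue) \<longlonglongrightarrow> 0"
      by (rule radial_L2_convergence[OF N d(1,3,4,5) _ _ d(2,6)]) (use p in auto)
  qed (use p in auto)
next
  have N: "DIM(real ^ 'n) \<ge> 3" using assms(1) by simp
  let ?r = "sobolev_exponent CARD('n)"
  have r: "2 < ?r" using assms(1) by (simp add: sobolev_exponent_def field_simps)
  fix p :: real assume p: "?r < p"
  show "compact_embedding_Int (H1_rad :: (real ^ 'n \<Rightarrow> real) set) H1_norm
      (lorentz_space p q) (lorentz_norm p q) (Lp_space ?r) (Lp_norm ?r)"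
  \<comment> \<open>Again the midpoint: below \<open>p\<close> for the weak L^p bound, and above the
    critical exponent to gain a negative power of the height M.\<close>
  proof (rule compact_embedding_criterion[OF N _ assms(2), where s = "(p + ?r) / 2"])
    fix d :: "nat \<Rightarrow> real ^ 'n \<Rightarrow> real" and C E :: real
    assume d: "C \<ge> 0" "E \<ge> 0" "\<And>k. d k \<in> borel_measurable lebesgue"
      "AE x in lebesgue. (\<lambda>k. d k x) \<longlonglongrightarrow> 0"
      "\<And>k. AE x in lebesgue. \<bar>d k x\<bar> \<le> C * sqrt (newton x)"
      "\<And>k. (\<integral>\<^sup>+ x. ennreal (\<bar>d k x\<bar> powr 2) \<partial>lebesgue) \<le> ennreal E"
      "\<And>k. (\<integral>\<^sup>+ x. ennreal (\<bar>d k x\<bar> powr ((p + ?r) / 2)) \<partial>lebesgue) \<le> ennreal E"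
    show "(\<lambda>k. \<integral>\<^sup>+ x. ennreal (\<bar>d k x\<bar> powr ?r) \<partial>lebesgue) \<longlonglongrightarrow> 0"
      by (rule radial_Lr_convergence[OF N d(1,3,4,5) r _ d(2,6,7)]) (use p in auto)
  qed (use p r in auto)
qed

end
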